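(* Let $g(t)=\sum_{k=1}^N \frac{a_k}{t-iw_k}$ with $a_k,w_k\in\mathbb{C}$, $a_k\ne 0$, such that $\Re w_k<0$ for $k=1,\dots,N$, $\Re w_k\neq\Re w_j$ for $j\neq k$, and $\hat g(\xi)\neq 0$ for all $\xi>0$. Then $\mathcal{G}(g;\alpha,\beta)$ is a frame in $L^2(\mathbb{R})$ for all $\alpha,\beta>0$ with $\alpha\beta<1$ and $\alpha\beta\notin\mathbb{Q}$.
   Context: The Fourier transform is normalized as $\hat g(\xi)=\int_{-\infty}^{\infty}g(t)e^{-2\pi i t\xi}\,dt$. For $\alpha,\beta>0$, $\mathcal{G}(g;\alpha,\beta)=\{e^{2\pi i\beta n t}g(t-\alpha m)\}_{m,n\in\mathbb{Z}}$; it is a frame in $L^2(\mathbb{R})$ if there are $0<A\le B<\infty$ with $A\|f\|^2\le\sum_{m,n}|\langle f, e^{2\pi i\beta n\cdot}g(\cdot-\alpha m)\rangle|^2\le B\|f\|^2$ for all $f\in L^2(\mathbb{R})$. *)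

theory Defs
  imports "HOL-Analysis.Analysis"
begin

text \<open>Fourier transform with normalization
  hat g(xi) = integral of g(t) exp(-2 pi i t xi) dt, taken as the limit of
  the integrals over [-R,R] as R tends to infinity (this covers functions such as
  1/(t - c) which are in L^2 but not in L^1).\<close>
definition has_fourier_transform_at :: "(real \<Rightarrow> complex) \<Rightarrow> real \<Rightarrow> complex \<Rightarrow> bool" where
  "has_fourier_transform_at g \<xi> c \<longleftrightarrow>
     ((\<lambda>R::real. integral {-R..R} (\<lambda>t. g t * cis (- 2 * pi * t * \<xi>))) \<longlongrightarrow> c) at_top"

definition L2 :: "(real \<Rightarrow> complex) set" where
  "L2 = {f. f \<in> borel_measurable lborel \<and> integrable lborel (\<lambda>t. (norm (f t))\<^sup>2)}"

definition L2_inner :: "(real \<Rightarrow> complex) \<Rightarrow> (real \<Rightarrow> complex) \<Rightarrow> complex" where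
  "L2_inner f h = (LINT t|lborel. f t * cnj (h t))"

definition L2_norm_sq :: "(real \<Rightarrow> complex) \<Rightarrow> real" where
  "L2_norm_sq f = (LINT t|lborel. (norm (f t))\<^sup>2)"

definition gabor_atom :: "(real \<Rightarrow> complex) \<Rightarrow> real \<Rightarrow> real \<Rightarrow> int \<Rightarrow> int \<Rightarrow> real \<Rightarrow> complex" where
  "gabor_atom g \<alpha> \<beta> m n t = cis (2 * pi * \<beta> * of_int n * t) * g (t - \<alpha> * of_int m)"

definition gabor_frame :: "(real \<Rightarrow> complex) \<Rightarrow> real \<Rightarrow> real \<Rightarrow> bool" where
  "gabor_frame g \<alpha> \<beta> \<longleftrightarrow>
     (\<exists>A B. 0 < A \<and> A \<le> B \<and>
        (\<forall>f \<in> L2.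
           (\<lambda>(m,n). (norm (L2_inner f (gabor_atom g \<alpha> \<beta> m n)))\<^sup>2) summable_on (UNIV :: (int \<times> int) set) \<and>
           A * L2_norm_sq f \<le> (\<Sum>\<^sub>\<infinity>(m,n)\<in>(UNIV :: (int \<times> int) set). (norm (L2_inner f (gabor_atom g \<alpha> \<beta> m n)))\<^sup>2) \<and>
           (\<Sum>\<^sub>\<infinity>(m,n)\<in>(UNIV :: (int \<times> int) set). (norm (L2_inner f (gabor_atom g \<alpha> \<beta> m n)))\<^sup>2) \<le> B * L2_norm_sq f))"

end

theory Submission
  imports Defs "HOL-Complex_Analysis.Complex_Analysis" "HOL-Probability.Sinc_Integral"
    "HOL-Real_Asymp.Real_Asymp" "Jordan_Normal_Form.Determinant"
begin

text \<open>
  On the Fourier side the window is the one-sided exponential sum phi, and by Parseval the frame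
  inequality becomes a uniform two-sided estimate, over all offsets d, for a discrete causal filter:
  impulses x k at the times L k + d, with L = 1 / alpha, are filtered by phi and the output is
  sampled at the times b n, with b = beta < L. The filter has an N-dimensional state. Between two
  impulses there is always a sample at which phi is bounded away from 0, so once the state is known
  the impulses can be recovered one after the other, moving forward. It remains to recover the state
  from the samples in some window at bounded distance. For small positive d the samples depend
  analytically on d; as d tends to infinity the exponential with the largest real part dominates, and
  the limiting system is injective because some intervals between consecutive impulses contain two
  samples and the moduli of the exponentials are distinct. Hence the window system is injective for
  some d, stably so for all d nearby, and since L / b is irrational every offset reaches such a d after
  boundedly many impulses.
\<close>

text \<open>Each hypothesis has its own role. Nonvanishing of the transform at every positive
  frequency says that \<open>phi\<close> has no zero on the positive axis, so a compactness bound is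
  available for reading off an impulse. The inequality alpha * beta < 1 is \<open>b < L\<close>:
  samples are denser than impulses. The distinct real parts keep exponentials from having the same
  modulus. The forward recovery of impulses amplifies errors by a fixed factor at each step,
  possibly larger than 1, so it cannot be started in the remote past. It has to be restarted at
  bounded distance from every impulse, and this is why the state is needed. At a particular offset
  the window system may be singular, and no good offset is written down; its existence comes from a
  determinant that is entire in the offset. Sequences are assumed bounded throughout, so that all
  sums converge absolutely. This suits the transforms of compactly supported continuous functions,
  and the passage to all of L2 costs only constant factors.\<close>

abbreviation nn_sum :: "('a \<Rightarrow> ennreal) \<Rightarrow> ennreal" (binder "\<Sum>\<^sup>+" 10) where
  "nn_sum f \<equiv> nn_integral (count_space UNIV) f"

abbreviation nsq :: "complex \<Rightarrow> ennreal" where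
  "nsq z \<equiv> ennreal ((cmod z)\<^sup>2)"

section \<open>A generic left inverse for an analytic family of linear systems\<close>

text \<open>Pulls the column factors \<open>s\<close> of the next lemma out of the determinant: a
  nonzero scaled determinant forces a nonzero unscaled one.\<close>

lemma det_mult_columns:
  fixes f :: "nat \<Rightarrow> nat \<Rightarrow> 'a::comm_ring_1"
  shows "det (mat n n (\<lambda>(p,q). f p q * s q)) = det (mat n n (\<lambda>(p,q). f p q)) * (\<Prod>q<n. s q)"
proof -
  have "signof p * (\<Prod>i=0..<n. mat n n (\<lambda>(p,q). f p q * s q) $$ (i, p i))
      = signof p * (\<Prod>i=0..<n. mat n n (\<lambda>(p,q). f p q) $$ (i, p i)) * (\<Prod>q<n. s q)"
    if p: "p permutes {0..<n}" for p
  proof -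
    have "(\<Prod>i=0..<n. mat n n (\<lambda>(p,q). f p q * s q) $$ (i, p i)) =
        (\<Prod>i=0..<n. mat n n (\<lambda>(p,q). f p q) $$ (i, p i) * s (p i))"
      using permutes_in_image[OF p] by (intro prod.cong) auto
    also have "\<dots> = (\<Prod>i=0..<n. mat n n (\<lambda>(p,q). f p q) $$ (i, p i)) * (\<Prod>i=0..<n. s (p i))"
      by (rule prod.distrib)
    also have "(\<Prod>i=0..<n. s (p i)) = (\<Prod>i=0..<n. s i)"
      using prod.permute[OF p, of s] by (simp add: o_def)
    finally show ?thesis by (simp add: lessThan_atLeast0 mult.assoc)
  qed
  then show ?thesis
    by (simp add: det_def'[of _ n] sum_distrib_right)
qed

text \<open>The determinant of the adjoint of \<open>B\<close> times \<open>A z\<close> is entire in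
  z. Along the reals, after scaling the columns, it tends to the Gram determinant of
  \<open>B\<close>, which is nonzero because \<open>B\<close> is injective. So it does not vanish
  identically and is nonzero at some t in (0, e); inverting the square matrix there yields a left
  inverse of the rectangular one.\<close>

lemma generic_left_inverse:
  fixes A :: "complex \<Rightarrow> 'i \<Rightarrow> nat \<Rightarrow> complex" and B :: "'i \<Rightarrow> nat \<Rightarrow> complex"
    and s :: "real \<Rightarrow> nat \<Rightarrow> complex"
  assumes hol: "\<And>i q. i \<in> R \<Longrightarrow> q < n \<Longrightarrow> (\<lambda>z. A z i q) holomorphic_on UNIV"
    and lim: "\<And>i q. i \<in> R \<Longrightarrow> q < n \<Longrightarrow> ((\<lambda>t. A (of_real t) i q * s t q) \<longlongrightarrow> B i q) at_top"
    and inj: "\<And>u q. (\<And>i. i \<in> R \<Longrightarrow> (\<Sum>q<n. B i q * u q) = 0) \<Longrightarrow> q < n \<Longrightarrow> u q = 0"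
    and R: "finite R"
    and e: "e > 0"
  obtains t E where "0 < t" "t < e"
    "\<And>u p. p < n \<Longrightarrow> u p = (\<Sum>i\<in>R. E p i * (\<Sum>q<n. A (complex_of_real t) i q * u q))"
proof -
  \<comment> \<open>The pairing is with the conjugate of the limit \<open>B\<close>, not of
    \<open>A z\<close>: this keeps the entries holomorphic in z.\<close>
  define G where "G = (\<lambda>z p q. \<Sum>i\<in>R. cnj (B i p) * A z i q)"
  define H where "H = (\<lambda>p q. \<Sum>i\<in>R. cnj (B i p) * B i q)"
  define D where "D = (\<lambda>z. det (mat n n (\<lambda>(p,q). G z p q)))"
  \<comment> \<open>A vector v killed by the Gram matrix satisfies |B v|^2 = 0, so B v = 0 and
    injectivity applies.\<close>
  have nz: "det (mat n n (\<lambda>(p,q). H p q)) \<noteq> 0"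
  proof
    assume "det (mat n n (\<lambda>(p,q). H p q)) = 0"
    then obtain v where v: "v \<in> carrier_vec n" "v \<noteq> 0\<^sub>v n" "mat n n (\<lambda>(p,q). H p q) *\<^sub>v v = 0\<^sub>v n"
      using det_0_iff_vec_prod_zero_field[of "mat n n (\<lambda>(p,q). H p q)" n] by auto
    have 0: "(\<Sum>q<n. H p q * vec_index v q) = 0" if "p < n" for p
      using arg_cong[OF v(3), of "\<lambda>w. vec_index w p"] that v(1)
      by (simp add: scalar_prod_def lessThan_atLeast0)
    have "complex_of_real (\<Sum>i\<in>R. (cmod (\<Sum>q<n. B i q * vec_index v q))\<^sup>2)
        = (\<Sum>i\<in>R. (\<Sum>q<n. B i q * vec_index v q) * cnj (\<Sum>p<n. B i p * vec_index v p))"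
      by (simp only: of_real_sum complex_norm_square)
    also have "\<dots> = (\<Sum>i\<in>R. \<Sum>p<n. \<Sum>q<n. cnj (vec_index v p) * (cnj (B i p) * B i q * vec_index v q))"
      by (simp add: sum_product cnj_sum mult.commute mult.left_commute)
         (subst sum.swap, simp add: mult.commute mult.left_commute)
    also have "\<dots> = (\<Sum>p<n. cnj (vec_index v p) * (\<Sum>q<n. H p q * vec_index v q))"
      unfolding H_def sum_distrib_left sum_distrib_right
      by (subst sum.swap, intro sum.cong refl, subst sum.swap) simp
    also have "\<dots> = 0" using 0 by simp
    finally have "(\<Sum>i\<in>R. (cmod (\<Sum>q<n. B i q * vec_index v q))\<^sup>2) = 0"
      by (simp only: of_real_eq_0_iff)
    then have "\<forall>i\<in>R. (cmod (\<Sum>q<n. B i q * vec_index v q))\<^sup>2 = 0"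
      by (subst (asm) sum_nonneg_eq_0_iff) (use R in auto)
    then have "vec_index v q = 0" if "q < n" for q
      using inj[of "\<lambda>q. vec_index v q" q] that by simp
    with v(1,2) show False by (metis eq_vecI index_zero_vec carrier_vecD)
  qed
  have holD: "D holomorphic_on UNIV"
    unfolding D_def
    apply (subst det_def'[of _ n], simp)
    apply (intro holomorphic_intros)
    subgoal for p i
      using permutes_in_image[of p "{0..<n}" i]
      by (simp add: G_def, intro holomorphic_intros hol) auto
    done
  have limG: "((\<lambda>t. G (of_real t) p q * s t q) \<longlongrightarrow> H p q) at_top" if "q < n" for p q
    unfolding G_def H_def sum_distrib_right mult.assoc
    by (intro tendsto_intros lim that)
  have "((\<lambda>t. det (mat n n (\<lambda>(p,q). G (of_real t) p q * s t q))) \<longlongrightarrow> det (mat n n (\<lambda>(p,q). H p q))) at_top"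
    apply (subst (1 2) det_def'[of _ n], simp, simp)
    apply (intro tendsto_intros)
    subgoal for p i
      using permutes_in_image[of p "{0..<n}" i] limG by simp
    done
  then have "eventually (\<lambda>t. det (mat n n (\<lambda>(p,q). G (of_real t) p q * s t q)) \<noteq> 0) at_top"
    using nz by (rule tendsto_imp_eventually_ne)
  then obtain t0 :: real where "det (mat n n (\<lambda>(p,q). G (of_real t0) p q * s t0 q)) \<noteq> 0"
    using eventually_happens'[OF trivial_limit_at_top_linorder] by blast
  then have D0: "D (of_real t0) \<noteq> 0"
    by (auto simp: D_def det_mult_columns)
  \<comment> \<open>Identity theorem: zeros filling the segment (0, e) would accumulate at
    e/2.\<close>
  have "\<exists>t. 0 < t \<and> t < e \<and> D (complex_of_real t) \<noteq> 0"
  proof (rule ccontr)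
    assume "\<not> ?thesis"
    then have z: "D z = 0" if "z \<in> complex_of_real ` {0<..<e}" for z using that by auto
    have "complex_of_real (e/2) islimpt complex_of_real ` {0<..<e}"
    proof (rule islimptI)
      fix T assume "complex_of_real (e/2) \<in> T" "open T"
      then obtain r where r: "r > 0" "ball (complex_of_real (e/2)) r \<subseteq> T"
        by (meson openE)
      define y where "y = e/2 + min (r/2) (e/4)"
      have "complex_of_real y \<in> ball (complex_of_real (e/2)) r"
        unfolding mem_ball dist_of_real dist_real_def y_def using r(1) e by auto
      moreover have "y \<in> {0<..<e}" "y \<noteq> e/2" using r(1) e by (auto simp: y_def)
      ultimately show "\<exists>y\<in>complex_of_real ` {0<..<e}. y \<in> T \<and> y \<noteq> complex_of_real (e/2)"
        using r(2) by (intro bexI[of _ "complex_of_real y"]) (auto simp del: of_real_divide)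
    qed
    from analytic_continuation[OF holD open_UNIV connected_UNIV _ _ this z, of "of_real t0"] D0
    show False by auto
  qed
  then obtain t where t: "0 < t" "t < e" "D (complex_of_real t) \<noteq> 0" by blast
  define M where "M = mat n n (\<lambda>(p,q). G (of_real t) p q)"
  have M: "M \<in> carrier_mat n n" by (simp add: M_def)
  have "M \<in> Units (ring_mat TYPE(complex) n ())"
    using t(3) by (intro det_non_zero_imp_unit) (auto simp: M_def D_def)
  then obtain P where P: "P \<in> carrier_mat n n" "P * M = 1\<^sub>m n"
    by (auto simp: Units_def ring_mat_def)
  define E where "E = (\<lambda>p i. \<Sum>r<n. P $$ (p,r) * cnj (B i r))"
  have "u p = (\<Sum>i\<in>R. E p i * (\<Sum>q<n. A (complex_of_real t) i q * u q))" if p: "p < n" for u p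
  proof -
    have "u p = vec_index (P * M *\<^sub>v vec n u) p" using P(2) p by simp
    also have "\<dots> = vec_index (P *\<^sub>v (M *\<^sub>v vec n u)) p"
      using assoc_mult_mat_vec[OF P(1) M vec_carrier] by simp
    also have "\<dots> = (\<Sum>r<n. P $$ (p,r) * (\<Sum>q<n. G (of_real t) r q * u q))"
      using P(1) p by (simp add: scalar_prod_def lessThan_atLeast0 M_def)
    also have "\<dots> = (\<Sum>r<n. \<Sum>q<n. \<Sum>i\<in>R. P $$ (p,r) * cnj (B i r) * (A (of_real t) i q * u q))"
      by (simp add: G_def sum_distrib_left sum_distrib_right mult.assoc)
    also have "\<dots> = (\<Sum>r<n. \<Sum>i\<in>R. \<Sum>q<n. P $$ (p,r) * cnj (B i r) * (A (of_real t) i q * u q))"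
      by (intro sum.cong refl sum.swap)
    also have "\<dots> = (\<Sum>i\<in>R. \<Sum>r<n. \<Sum>q<n. P $$ (p,r) * cnj (B i r) * (A (of_real t) i q * u q))"
      by (rule sum.swap)
    also have "\<dots> = (\<Sum>i\<in>R. E p i * (\<Sum>q<n. A (complex_of_real t) i q * u q))"
      by (simp add: E_def sum_product)
    finally show ?thesis .
  qed
  with t(1,2) show ?thesis by (rule that)
qed

section \<open>Linear independence of powers on an infinite set of exponents\<close>

text \<open>By induction on \<open>J\<close>: if finitely many points suffice for \<open>J\<close>,
  one more index leaves at most a line of relations on them, and one further point at which a
  spanning relation fails removes that line.\<close>

lemma finite_witness_of_independence:
  fixes u :: "'j \<Rightarrow> 'x \<Rightarrow> 'a::field"
  assumes "finite J"
    and "\<And>e j. (\<And>x. x \<in> D \<Longrightarrow> (\<Sum>j\<in>J. e j * u j x) = 0) \<Longrightarrow> j \<in> J \<Longrightarrow> e j = 0"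
  shows "\<exists>F\<subseteq>D. finite F \<and> (\<forall>e. (\<forall>x\<in>F. (\<Sum>j\<in>J. e j * u j x) = 0) \<longrightarrow> (\<forall>j\<in>J. e j = 0))"
  using assms
proof (induction J rule: finite_induct)
  case empty
  then show ?case by auto
next
  case (insert i J)
  have sum_upd: "(\<Sum>j\<in>J. (e(i := c)) j * u j x) = (\<Sum>j\<in>J. e j * u j x)" for e c x
    using insert.hyps by (intro sum.cong) auto
  have "\<exists>F\<subseteq>D. finite F \<and> (\<forall>e. (\<forall>x\<in>F. (\<Sum>j\<in>J. e j * u j x) = 0) \<longrightarrow> (\<forall>j\<in>J. e j = 0))"
  proof (rule insert.IH)
    fix e j assume *: "\<And>x. x \<in> D \<Longrightarrow> (\<Sum>j\<in>J. e j * u j x) = 0" "j \<in> J"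
    have "(e(i:=0)) j = 0"
      by (rule insert.prems) (use * insert.hyps sum_upd in auto)
    with * insert.hyps show "e j = 0" by (auto split: if_splits)
  qed
  then obtain F where F0: "F \<subseteq> D" "finite F"
    "\<forall>e. (\<forall>x\<in>F. (\<Sum>j\<in>J. e j * u j x) = 0) \<longrightarrow> (\<forall>j\<in>J. e j = 0)"
    by blast
  have F: "F \<subseteq> D" "finite F"
    "\<And>e j. (\<And>x. x \<in> F \<Longrightarrow> (\<Sum>j\<in>J. e j * u j x) = 0) \<Longrightarrow> j \<in> J \<Longrightarrow> e j = 0"
    using F0 by simp_all
  show ?case
  proof (cases "\<exists>e. (\<forall>x\<in>F. (\<Sum>j\<in>insert i J. e j * u j x) = 0) \<and> e i \<noteq> 0")
    case False
    have "e j = 0" if e: "\<forall>x\<in>F. (\<Sum>j\<in>insert i J. e j * u j x) = 0" and j: "j \<in> insert i J" for e j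
    proof -
      have i: "e i = 0" using e False by blast
      have "e j = 0" if "j \<in> J"
        by (rule F(3)[OF _ that]) (use e i insert.hyps in auto)
      with i j show ?thesis by auto
    qed
    with F(1,2) show ?thesis by blast
  next
    case True
    then obtain e0 where e0: "\<forall>x\<in>F. (\<Sum>j\<in>insert i J. e0 j * u j x) = 0" "e0 i \<noteq> 0" by blast
    then obtain x0 where x0: "x0 \<in> D" "(\<Sum>j\<in>insert i J. e0 j * u j x0) \<noteq> 0"
      using insert.prems[of e0 i] by blast
    have "e j = 0" if e: "\<forall>x\<in>insert x0 F. (\<Sum>j\<in>insert i J. e j * u j x) = 0" and j: "j \<in> insert i J" for e j
    proof -
      \<comment> \<open>Subtracting this multiple of \<open>e0\<close> kills the coefficient at
        \<open>i\<close>, so the difference is a relation over \<open>J\<close> and vanishes. Hence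
        \<open>e\<close> is \<open>c\<close> times \<open>e0\<close>, and the point
        \<open>x0\<close> forces \<open>c = 0\<close>.\<close>
      define c where "c = e i / e0 i"
      define d where "d = (\<lambda>j. e j - c * e0 j)"
      have d_sum: "(\<Sum>j\<in>insert i J. d j * u j x)
          = (\<Sum>j\<in>insert i J. e j * u j x) - c * (\<Sum>j\<in>insert i J. e0 j * u j x)" for x
        by (simp only: d_def sum_distrib_left sum_subtractf[symmetric] left_diff_distrib mult.assoc)
      have di: "d i = 0" using e0(2) by (simp add: d_def c_def)
      have dz: "d k = 0" if "k \<in> insert i J" for k
      proof -
        have "d k = 0" if k: "k \<in> J"
        proof (rule F(3)[OF _ k])
          fix x assume "x \<in> F"
          then have "(\<Sum>j\<in>insert i J. d j * u j x) = 0"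
            using e e0(1) by (simp only: d_sum) simp
          then show "(\<Sum>j\<in>J. d j * u j x) = 0" using di insert.hyps by simp
        qed
        with di that show ?thesis by auto
      qed
      then have "(\<Sum>j\<in>insert i J. d j * u j x0) = 0" by (intro sum.neutral) simp
      then have "c * (\<Sum>j\<in>insert i J. e0 j * u j x0) = 0"
        using e by (simp only: d_sum) simp
      then have "c = 0" using x0(2) by simp
      then show ?thesis using dz[OF j] by (simp add: d_def)
    qed
    then have "\<forall>e. (\<forall>x\<in>insert x0 F. (\<Sum>j\<in>insert i J. e j * u j x) = 0) \<longrightarrow> (\<forall>j\<in>insert i J. e j = 0)"
      by blast
    with F(1,2) x0(1) show ?thesis
      by (intro exI[of _ "insert x0 F"]) auto
  qed
qed

text \<open>Along an infinite set of exponents the base of largest modulus dominates.\<close>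

lemma powers_independent_on_infinite:
  fixes z :: "'j \<Rightarrow> complex"
  assumes J: "finite J" "inj_on (\<lambda>j. cmod (z j)) J" and z: "\<And>j. j \<in> J \<Longrightarrow> z j \<noteq> 0"
    and D: "infinite D" and e: "\<And>n. n \<in> D \<Longrightarrow> (\<Sum>j\<in>J. e j * z j ^ n) = 0" and j: "j \<in> J"
  shows "e j = 0"
proof (rule ccontr)
  assume ej: "e j \<noteq> 0"
  \<comment> \<open>The dominating base has to be sought among those with a nonzero
    coefficient.\<close>
  define J' where "J' = {j\<in>J. e j \<noteq> 0}"
  have J': "finite J'" "J' \<noteq> {}" "J' \<subseteq> J" using J(1) j ej by (auto simp: J'_def)
  have "Max ((\<lambda>j. cmod (z j)) ` J') \<in> (\<lambda>j. cmod (z j)) ` J'"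
    using J' by (intro Max_in) auto
  then obtain i where iM: "i \<in> J'" "Max ((\<lambda>j. cmod (z j)) ` J') = cmod (z i)" by auto
  have i: "cmod (z k) \<le> cmod (z i)" if "k \<in> J'" for k
    using iM Max_ge[OF finite_imageI[OF J'(1)] imageI[OF that], of "\<lambda>j. cmod (z j)"] by simp
  have lt: "cmod (z k) < cmod (z i)" if k: "k \<in> J' - {i}" for k
  proof -
    have "cmod (z k) \<noteq> cmod (z i)"
      using inj_onD[OF J(2), of k i] k iM(1) J'(3) by blast
    then show ?thesis using i[of k] k by simp
  qed
  have iJ: "i \<in> J" "z i \<noteq> 0" "e i \<noteq> 0" using iM(1) z by (auto simp: J'_def)
  have "(\<lambda>n. \<Sum>k\<in>J' - {i}. e k * (z k / z i) ^ n) \<longlonglongrightarrow> (\<Sum>k\<in>J' - {i}. e k * 0)"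
    using lt iJ by (intro tendsto_intros LIMSEQ_power_zero) (simp add: norm_divide)
  then have "eventually (\<lambda>n. cmod (\<Sum>k\<in>J' - {i}. e k * (z k / z i) ^ n) < cmod (e i)) sequentially"
    using iJ(3) by (auto dest!: tendstoD[of _ _ _ "cmod (e i)"])
  then obtain n0 where n0: "\<And>n. n \<ge> n0 \<Longrightarrow> cmod (\<Sum>k\<in>J' - {i}. e k * (z k / z i) ^ n) < cmod (e i)"
    by (auto simp: eventually_sequentially)
  obtain n where n: "n \<in> D" "n \<ge> n0"
    using D by (meson infinite_nat_iff_unbounded_le)
  have "0 = (\<Sum>k\<in>J. e k * z k ^ n) / z i ^ n" using e[OF n(1)] by simp
  also have "(\<Sum>k\<in>J. e k * z k ^ n) = (\<Sum>k\<in>J'. e k * z k ^ n)"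
    using J(1) by (intro sum.mono_neutral_right) (auto simp: J'_def)
  also have "\<dots> / z i ^ n = (\<Sum>k\<in>J'. e k * (z k / z i) ^ n)"
    by (simp add: sum_divide_distrib power_divide)
  also have "\<dots> = e i + (\<Sum>k\<in>J' - {i}. e k * (z k / z i) ^ n)"
    using iM(1) J'(1) iJ(2) by (subst sum.remove[of _ i]) auto
  finally have "cmod (e i) = cmod (\<Sum>k\<in>J' - {i}. e k * (z k / z i) ^ n)"
    by (metis add_eq_0_iff norm_minus_cancel)
  with n0[OF n(2)] show False by simp
qed

section \<open>Sampling a filter with an exponential-sum kernel\<close>

lemma summable_on_int_power_abs:
  fixes q :: real
  assumes "0 \<le> q" "q < 1"
  shows "(\<lambda>n::int. q ^ nat \<bar>n\<bar>) summable_on UNIV"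
proof -
  have g: "(\<lambda>n::nat. q ^ n) summable_on UNIV"
    using assms summable_geometric[of q] by (intro norm_summable_imp_summable_on) simp
  have "(\<lambda>n::int. q ^ nat \<bar>n\<bar>) summable_on {0..}"
    using g by (subst summable_on_reindex_bij_betw[symmetric, of int UNIV])
      (auto simp: bij_betw_def image_def intro: nonneg_int_cases)
  moreover have "(\<lambda>n::int. q ^ nat \<bar>n\<bar>) summable_on {..<0}"
  proof (subst summable_on_reindex_bij_betw[symmetric, of "\<lambda>n. - int n - 1" UNIV])
    show "bij_betw (\<lambda>n. - int n - 1) UNIV {..<0}"
      by (rule bij_betwI[of _ _ _ "\<lambda>m. nat (- m - 1)"]) auto
    have "nat \<bar>- int n - 1\<bar> = Suc n" for n by simp
    then show "(\<lambda>n. q ^ nat \<bar>- int n - 1\<bar>) summable_on UNIV"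
      using summable_on_cmult_right[OF g, of q] by simp
  qed
  ultimately have "(\<lambda>n::int. q ^ nat \<bar>n\<bar>) summable_on ({0..} \<union> {..<0})"
    by (intro summable_on_Un_disjoint) auto
  moreover have "{0..} \<union> {..<0} = (UNIV :: int set)" by auto
  ultimately show ?thesis by simp
qed

text \<open>The point is that \<open>K\<close> does not depend on the centre \<open>a\<close>; the
  uniformity in the offset of the upper bound rests on this. Rounding \<open>a\<close> down to the
  lattice changes each term by at most the factor exp(\<rho> b).\<close>

lemma exp_lattice_sum_bound:
  fixes \<rho> b :: real
  assumes "\<rho> > 0" "b > 0"
  obtains K where "K > 0"
    "\<And>a. (\<lambda>n::int. exp (- \<rho> * \<bar>b * of_int n - a\<bar>)) summable_on UNIV"
    "\<And>a. (\<Sum>\<^sub>\<infinity>n::int. exp (- \<rho> * \<bar>b * of_int n - a\<bar>)) \<le> K"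
proof -
  define q where "q = exp (- \<rho> * b)"
  have q: "0 \<le> q" "q < 1" using assms by (auto simp: q_def)
  define K where "K = exp (\<rho> * b) * (\<Sum>\<^sub>\<infinity>n::int. q ^ nat \<bar>n\<bar>)"
  have bij: "bij_betw (\<lambda>n. n - m) (UNIV::int set) UNIV" for m
    by (rule bij_betwI[of _ _ _ "\<lambda>n. n + m"]) auto
  have s: "(\<lambda>n. exp (\<rho> * b) * q ^ nat \<bar>n - m\<bar>) summable_on UNIV"
      and i: "(\<Sum>\<^sub>\<infinity>n::int. exp (\<rho> * b) * q ^ nat \<bar>n - m\<bar>) = K" for m
    using summable_on_reindex_bij_betw[OF bij, of "\<lambda>n. q ^ nat \<bar>n\<bar>" m]
      infsum_reindex_bij_betw[OF bij, of "\<lambda>n. q ^ nat \<bar>n\<bar>" m] summable_on_int_power_abs[OF q]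
    by (auto simp: K_def infsum_cmult_right intro!: summable_on_cmult_right)
  have le: "exp (- \<rho> * \<bar>b * of_int n - a\<bar>) \<le> exp (\<rho> * b) * q ^ nat \<bar>n - \<lfloor>a / b\<rfloor>\<bar>" for a n
  proof -
    have "b * of_int \<lfloor>a/b\<rfloor> \<le> a" "a \<le> b * of_int \<lfloor>a/b\<rfloor> + b"
      using assms(2) floor_divide_lower[of b a] floor_divide_upper[of b a]
      by (auto simp: algebra_simps)
    then have "b * \<bar>of_int (n - \<lfloor>a/b\<rfloor>)\<bar> - b \<le> \<bar>b * of_int n - a\<bar>"
      using assms(2) by (auto simp: abs_if algebra_simps)
    then have "- \<rho> * \<bar>b * of_int n - a\<bar> \<le> \<rho> * b + (- \<rho> * b) * real (nat \<bar>n - \<lfloor>a/b\<rfloor>\<bar>)"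
      using mult_left_mono[of _ _ \<rho>] assms(1) by (fastforce simp: algebra_simps)
    then have "exp (- \<rho> * \<bar>b * of_int n - a\<bar>)
        \<le> exp (\<rho> * b + (- \<rho> * b) * real (nat \<bar>n - \<lfloor>a/b\<rfloor>\<bar>))"
      by simp
    also have "\<dots> = exp (\<rho> * b) * q ^ nat \<bar>n - \<lfloor>a / b\<rfloor>\<bar>"
      unfolding exp_add q_def by (simp add: exp_of_nat_mult[symmetric] mult.commute)
    finally show ?thesis .
  qed
  have 1: "(\<lambda>n::int. exp (- \<rho> * \<bar>b * of_int n - a\<bar>)) summable_on UNIV" for a
    by (rule summable_on_comparison_test[OF s[of "\<lfloor>a/b\<rfloor>"]]) (use le in auto)
  have 2: "(\<Sum>\<^sub>\<infinity>n::int. exp (- \<rho> * \<bar>b * of_int n - a\<bar>)) \<le> K" for a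
    using infsum_mono[OF 1[of a] s[of "\<lfloor>a/b\<rfloor>"]] le i by auto
  \<comment> \<open>The maximum with 1 makes the bound visibly positive.\<close>
  have 3: "(\<Sum>\<^sub>\<infinity>n::int. exp (- \<rho> * \<bar>b * of_int n - a\<bar>)) \<le> max K 1" for a
    using 2 by (rule order_trans) simp
  show ?thesis by (rule that[OF _ 1 3]) simp
qed

lemma infsum_sum_finite:
  fixes f :: "'j \<Rightarrow> 'a \<Rightarrow> 'b::{topological_comm_monoid_add, t2_space}"
  assumes "finite J" "\<And>j. j \<in> J \<Longrightarrow> f j summable_on A"
  shows "infsum (\<lambda>i. \<Sum>j\<in>J. f j i) A = (\<Sum>j\<in>J. infsum (f j) A)"
proof -
  have "((\<lambda>i. \<Sum>j\<in>J. f j i) has_sum (\<Sum>j\<in>J. infsum (f j) A)) A"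
    using assms
  proof (induction J rule: finite_induct)
    case (insert j J)
    then show ?case by (simp add: has_sum_add)
  qed simp
  then show ?thesis by (rule infsumI)
qed

text \<open>In the application \<open>c j\<close> and \<open>lam j\<close> are -2 pi i a and -2 pi w
  at index \<open>Suc j\<close>, \<open>b\<close> is beta and \<open>L\<close> is 1/alpha. Then
  \<open>phi\<close> is the transform of g on the positive half line.\<close>

locale exp_sampling =
  fixes N :: nat and c lam :: "nat \<Rightarrow> complex" and b L :: real
  assumes N_pos: "N > 0"
    and c_nz: "\<And>j. j < N \<Longrightarrow> c j \<noteq> 0"
    and lam_pos: "\<And>j. j < N \<Longrightarrow> Re (lam j) > 0"
    and lam_inj: "inj_on (\<lambda>j. Re (lam j)) {..<N}"
    and b_pos: "0 < b" and b_L: "b < L"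
    and phi_nz: "\<And>t. t > 0 \<Longrightarrow> (\<Sum>j<N. c j * exp (- lam j * of_real t)) \<noteq> 0"
begin

definition phi :: "real \<Rightarrow> complex" where
  "phi t = (\<Sum>j<N. c j * exp (- lam j * of_real t))"

text \<open>With the value 0 at 0, a sample taken exactly at the time of an impulse does not see it.
  This is why the conditions below comparing impulse and sample times are strict.\<close>

definition phi0 :: "real \<Rightarrow> complex" where
  "phi0 t = (if t > 0 then phi t else 0)"

text \<open>Here x k is the strength of the impulse at time L k + d. The state is taken just before impulse k
  and scaled so that it does not depend on d.\<close>

definition out :: "real \<Rightarrow> (int \<Rightarrow> complex) \<Rightarrow> real \<Rightarrow> complex" where
  "out d x s = (\<Sum>\<^sub>\<infinity>k. phi0 (s - (L * of_int k + d)) * x k)"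

definition state :: "(int \<Rightarrow> complex) \<Rightarrow> nat \<Rightarrow> int \<Rightarrow> complex" where
  "state x j k = (\<Sum>\<^sub>\<infinity>i\<in>{..<k}. exp (- lam j * of_real (L * of_int (k - i))) * x i)"

lemma L_pos: "0 < L" using b_pos b_L by simp

lemma phi0_decay: obtains C \<rho> where "C > 0" "\<rho> > 0" "\<And>t. cmod (phi0 t) \<le> C * exp (- \<rho> * \<bar>t\<bar>)"
proof -
  define \<rho> where "\<rho> = Min ((\<lambda>j. Re (lam j)) ` {..<N})"
  have "\<rho> > 0"
    unfolding \<rho>_def using N_pos lam_pos by (subst Min_gr_iff) auto
  moreover have "\<rho> \<le> Re (lam j)" if "j < N" for j
    using that by (simp add: \<rho>_def)
  ultimately have rho: "\<rho> > 0" "\<And>j. j < N \<Longrightarrow> \<rho> \<le> Re (lam j)" by auto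
  define C where "C = (\<Sum>j<N. cmod (c j))"
  have C: "C > 0" unfolding C_def using N_pos c_nz by (intro sum_pos) auto
  have "cmod (phi0 t) \<le> C * exp (- \<rho> * \<bar>t\<bar>)" for t
  proof (cases "t > 0")
    case True
    have "cmod (phi t) \<le> (\<Sum>j<N. cmod (c j) * exp (- \<rho> * t))"
      unfolding phi_def
      by (rule sum_norm_le) (use True rho in \<open>auto simp: norm_mult intro!: mult_left_mono\<close>)
    then show ?thesis using True by (simp add: phi0_def C_def sum_distrib_right)
  qed (use C in \<open>simp add: phi0_def\<close>)
  with C rho(1) show ?thesis using that by blast
qed

lemma state_summable:
  assumes "bounded (range x)" "j < N"
  shows "(\<lambda>i. exp (- lam j * of_real (L * of_int (k - i))) * x i) summable_on {..<k}"
proof -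
  obtain X where X: "\<And>i. cmod (x i) \<le> X" using assms(1) by (auto simp: bounded_iff)
  obtain K where "\<And>a. (\<lambda>n::int. exp (- Re (lam j) * \<bar>L * of_int n - a\<bar>)) summable_on UNIV"
    using exp_lattice_sum_bound[of "Re (lam j)" L] lam_pos[OF assms(2)] L_pos by blast
  then have s: "(\<lambda>n::int. exp (- Re (lam j) * \<bar>L * of_int n - L * of_int k\<bar>) * X) summable_on {..<k}"
    by (intro summable_on_cmult_left) (rule summable_on_subset, auto)
  have "(\<lambda>i. norm (exp (- lam j * of_real (L * of_int (k - i))) * x i)) summable_on {..<k}"
  proof (rule summable_on_comparison_test[OF s])
    fix i assume "i \<in> {..<k}"
    then have "L * of_int i \<le> L * of_int k" using L_pos by simp
    then show "norm (exp (- lam j * of_real (L * of_int (k - i))) * x i)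
        \<le> exp (- Re (lam j) * \<bar>L * of_int i - L * of_int k\<bar>) * X"
      using X[of i] by (auto simp: norm_mult algebra_simps intro!: mult_left_mono)
  qed auto
  then show ?thesis by (rule abs_summable_summable)
qed

lemma out_summable:
  assumes "bounded (range x)"
  shows "(\<lambda>k. norm (phi0 (s - (L * of_int k + d)) * x k)) summable_on UNIV"
proof -
  obtain X where X: "\<And>i. cmod (x i) \<le> X" using assms(1) by (auto simp: bounded_iff)
  obtain C \<rho> where C: "C > 0" "\<rho> > 0" "\<And>t. cmod (phi0 t) \<le> C * exp (- \<rho> * \<bar>t\<bar>)"
    using phi0_decay by blast
  obtain K where "\<And>a. (\<lambda>n::int. exp (- \<rho> * \<bar>L * of_int n - a\<bar>)) summable_on UNIV"
    using exp_lattice_sum_bound[of \<rho> L] C L_pos by blast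
  then have s: "(\<lambda>n::int. C * exp (- \<rho> * \<bar>L * of_int n - (s - d)\<bar>) * X) summable_on UNIV"
    by (intro summable_on_cmult_left summable_on_cmult_right)
  show ?thesis
  proof (rule summable_on_comparison_test[OF s])
    fix k :: int
    have "cmod (phi0 (s - (L * of_int k + d))) \<le> C * exp (- \<rho> * \<bar>L * of_int k - (s - d)\<bar>)"
      using C(3)[of "s - (L * of_int k + d)"] by (simp add: abs_minus_commute algebra_simps)
    then show "norm (phi0 (s - (L * of_int k + d)) * x k)
        \<le> C * exp (- \<rho> * \<bar>L * of_int k - (s - d)\<bar>) * X"
      unfolding norm_mult using X[of k] C(1) by (intro mult_mono) auto
  qed auto
qed

lemma state_Suc:
  assumes "bounded (range x)" "j < N"
  shows "state x j (k + 1) = exp (- lam j * of_real L) * (state x j k + x k)"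
proof -
  let ?f = "\<lambda>k i. exp (- lam j * of_real (L * of_int (k - i))) * x i"
  have *: "?f (k + 1) i = exp (- lam j * of_real L) * ?f k i" for i
    by (simp add: exp_add[symmetric] algebra_simps)
  have "{..<k+1} = {..<k} \<union> {k}" by auto
  then have "state x j (k + 1) = infsum (?f (k + 1)) ({..<k} \<union> {k})" by (simp add: state_def)
  also have "\<dots> = infsum (?f (k + 1)) {..<k} + infsum (?f (k + 1)) {k}"
    using state_summable[OF assms, of "k+1"]
    by (intro infsum_Un_disjoint) (auto intro: summable_on_subset)
  also have "infsum (?f (k + 1)) {..<k} = exp (- lam j * of_real L) * state x j k"
    unfolding * state_def by (rule infsum_cmult_right) (use state_summable[OF assms] in blast)
  finally show ?thesis by (simp add: algebra_simps)
qed

text \<open>The exponentials are multiplicative in time, so N numbers carry the whole effect of the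
  impulses before \<open>k\<close>; the assumption on \<open>s\<close> says that all of these have
  already occurred. The set \<open>I\<close> may be larger than the set of impulses seen by
  \<open>s\<close>, because \<open>phi0\<close> annihilates the excess.\<close>

lemma out_eq:
  assumes x: "bounded (range x)" and s: "L * of_int (k - 1) + d < s"
    and I: "finite I" "\<And>i. i \<ge> k \<Longrightarrow> L * of_int i + d < s \<Longrightarrow> i \<in> I" "I \<subseteq> {k..}"
  shows "out d x s = (\<Sum>j<N. c j * exp (- lam j * of_real (s - (L * of_int k + d))) * state x j k)
     + (\<Sum>i\<in>I. phi0 (s - (L * of_int i + d)) * x i)"
proof -
  let ?f = "\<lambda>i. phi0 (s - (L * of_int i + d)) * x i"
  let ?g = "\<lambda>j i. exp (- lam j * of_real (L * of_int (k - i))) * x i"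
  have sf: "?f summable_on A" for A
    using abs_summable_summable[OF out_summable[OF x]] by (rule summable_on_subset) auto
  have "{..<k} \<union> {k..} = UNIV" by auto
  then have "out d x s = infsum ?f ({..<k} \<union> {k..})"
    by (simp add: out_def)
  also have "\<dots> = infsum ?f {..<k} + infsum ?f {k..}"
    by (intro infsum_Un_disjoint sf) auto
  also have "infsum ?f {k..} = infsum ?f I"
    by (rule infsum_cong_neutral) (use I in \<open>auto simp: phi0_def\<close>)
  also have "infsum ?f I = sum ?f I" using I by simp
  also have "infsum ?f {..<k} = infsum (\<lambda>i. \<Sum>j<N. c j * exp (- lam j * of_real (s - (L * of_int k + d))) * ?g j i) {..<k}"
  proof (rule infsum_cong)
    fix i assume "i \<in> {..<k}"
    then have "real_of_int i \<le> real_of_int (k - 1)" by simp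
    then have "L * of_int i \<le> L * of_int (k - 1)" using L_pos by (intro mult_left_mono) auto
    then have pos: "s - (L * of_int i + d) > 0" using s by linarith
    have "exp (- lam j * of_real (s - (L * of_int i + d)))
      = exp (- lam j * of_real (s - (L * of_int k + d))) * exp (- lam j * of_real (L * of_int (k - i)))" for j
      by (simp add: exp_add[symmetric] algebra_simps)
    then show "?f i = (\<Sum>j<N. c j * exp (- lam j * of_real (s - (L * of_int k + d))) * ?g j i)"
      using pos by (simp only: phi0_def phi_def if_True sum_distrib_right mult.assoc)
  qed
  also have "\<dots> = (\<Sum>j<N. infsum (\<lambda>i. c j * exp (- lam j * of_real (s - (L * of_int k + d))) * ?g j i) {..<k})"
    using state_summable[OF x] by (intro infsum_sum_finite summable_on_cmult_right) auto
  also have "\<dots> = (\<Sum>j<N. c j * exp (- lam j * of_real (s - (L * of_int k + d))) * state x j k)"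
    unfolding state_def
    by (intro sum.cong refl infsum_cmult_right) (use state_summable[OF x] in blast)
  finally show ?thesis .
qed

text \<open>Renumbering the impulses by \<open>m\<close> and moving the time origin by
  \<open>r\<close> reduces every impulse to impulse 0, and a recurrent offset to one near the good
  offset.\<close>

lemma out_shift: "out d x s = out (d + L * of_int m - r) (\<lambda>k. x (k + m)) (s - r)"
proof -
  have bij: "bij_betw (\<lambda>k. k + m) (UNIV::int set) UNIV"
    by (rule bij_betwI[of _ _ _ "\<lambda>n. n - m"]) auto
  show ?thesis
    unfolding out_def
    by (subst infsum_reindex_bij_betw[OF bij, symmetric]) (simp add: algebra_simps)
qed

lemma state_shift: "state x j (k + m) = state (\<lambda>k. x (k + m)) j k"
proof -
  have bij: "bij_betw (\<lambda>i. i + m) {..<k} {..<k+m}"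
    by (rule bij_betwI[of _ _ _ "\<lambda>n. n - m"]) auto
  show ?thesis
    unfolding state_def
    by (subst infsum_reindex_bij_betw[OF bij, symmetric]) simp
qed


section \<open>Injectivity of the limiting window system\<close>

text \<open>These are the n for which samples n and n+1 see the same impulses. If there were only
  finitely many, from some point on each interval between consecutive samples would contain its own
  impulse, so impulses would be at least as dense as samples, against \<open>b < L\<close>.\<close>

lemma infinite_double_samples:
  "infinite {n::nat. \<forall>k::nat. \<not> (b * n \<le> L * k \<and> L * k < b * (real n + 1))}"
proof
  assume "finite {n::nat. \<forall>k::nat. \<not> (b * n \<le> L * k \<and> L * k < b * (real n + 1))}"
  then obtain n0 where n0: "\<And>n. n \<in> {n::nat. \<forall>k::nat. \<not> (b * n \<le> L * k \<and> L * k < b * (real n + 1))} \<Longrightarrow> n < n0"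
    unfolding finite_nat_set_iff_bounded by blast
  have "\<exists>k::nat. b * (n0 + m) \<le> L * k \<and> L * k < b * (real (n0 + m) + 1)" for m :: nat
    using n0[of "n0 + m"] unfolding mem_Collect_eq by (meson not_add_less1)
  then obtain \<kappa> :: "nat \<Rightarrow> nat" where
    \<kappa>: "\<And>m. b * (n0 + m) \<le> L * \<kappa> m" "\<And>m. L * \<kappa> m < b * (real (n0 + m) + 1)"
    by metis
  have "\<kappa> m < \<kappa> (Suc m)" for m
  proof -
    have "L * \<kappa> m < L * \<kappa> (Suc m)"
      using \<kappa>(2)[of m] \<kappa>(1)[of "Suc m"] by (simp add: algebra_simps)
    then show ?thesis using L_pos by simp
  qed
  then have "strict_mono \<kappa>" by (simp add: strict_mono_Suc_iff)
  then have "m \<le> \<kappa> m" for m by (rule strict_mono_imp_increasing)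
  then have "L * m < b * (real (n0 + m) + 1)" for m
    using \<kappa>(2)[of m] L_pos by (smt (verit) mult_left_mono of_nat_mono)
  then have *: "(L - b) * m < b * (n0 + 1)" for m :: nat
    by (simp add: algebra_simps)
  obtain m :: nat where "b * (n0 + 1) / (L - b) < m" using reals_Archimedean2 by blast
  then show False using *[of m] b_L by (simp add: field_simps)
qed

text \<open>Multiplying equation n by exp(lam j1 b n) makes the response to each impulse constant in
  n once it has set in. Differencing at an n from the preceding lemma then removes all impulses and
  leaves a relation between powers of distinct moduli. After that, sample 0 gives the component
  \<open>j1\<close>, and the impulses follow in order.\<close>

lemma limit_system_injective:
  assumes j1: "j1 < N" 
  obtains M K :: nat where "\<And>k::nat. k < K \<longleftrightarrow> L * k < b * M"
    "\<And>d x. (\<And>n. n \<le> M \<Longrightarrow> (\<Sum>j<N. c j * exp (- lam j * of_real (b * n)) * d j)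
         + (\<Sum>k<K. (if L * k < b * n then c j1 * exp (- lam j1 * of_real (b * n - L * k)) else 0) * x k) = 0)
       \<Longrightarrow> (\<forall>j<N. d j = 0) \<and> (\<forall>k<K. x k = 0)"
proof -
  define D where "D = {n::nat. \<forall>k::nat. \<not> (b * n \<le> L * k \<and> L * k < b * (real n + 1))}"
  \<comment> \<open>The ratio per sampling step to the exponential \<open>j1\<close>. The moduli are
    distinct, and \<open>z j1 = 1\<close>, so differencing removes the component \<open>j1\<close>
    too.\<close>
  define z where "z = (\<lambda>j. exp ((lam j1 - lam j) * of_real b))"
  define J where "J = {..<N} - {j1}"
  have z_norm: "cmod (z j) = exp ((Re (lam j1) - Re (lam j)) * b)" for j
    by (simp add: z_def)
  have inj: "inj_on (\<lambda>j. cmod (z j)) {..<N}"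
    using lam_inj b_pos by (auto simp: inj_on_def z_norm)
  have z1: "z j1 = 1" by (simp add: z_def)
  have z_ne1: "z j \<noteq> 1" if "j \<in> J" for j
    using inj_onD[OF inj, of j j1] that j1 z1 by (auto simp: J_def)
  \<comment> \<open>The window must be finite, so finitely many members of \<open>D\<close> are
    selected that already separate the exponentials.\<close>
  have "\<exists>F\<subseteq>D. finite F \<and> (\<forall>e. (\<forall>n\<in>F. (\<Sum>j\<in>J. e j * z j ^ n) = 0) \<longrightarrow> (\<forall>j\<in>J. e j = 0))"
  proof (rule finite_witness_of_independence)
    show "finite J" by (simp add: J_def)
    show "e j = 0" if "\<And>n. n \<in> D \<Longrightarrow> (\<Sum>j\<in>J. e j * z j ^ n) = 0" "j \<in> J" for e j
      using powers_independent_on_infinite[of J z D e j] that infinite_double_samples inj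
      by (auto simp: J_def D_def z_def inj_on_diff)
  qed
  then obtain F where F: "F \<subseteq> D" "finite F"
    "\<And>e. (\<forall>n\<in>F. (\<Sum>j\<in>J. e j * z j ^ n) = 0) \<Longrightarrow> (\<forall>j\<in>J. e j = 0)"
    by blast
  \<comment> \<open>The strict inequality keeps sample n+1 inside the window along with n.\<close>
  obtain M where M: "\<And>n. n \<in> F \<Longrightarrow> n < M"
    using F(2) by (metis finite_nat_set_iff_bounded)
  define K where "K = nat \<lceil>b * M / L\<rceil>"
  have K: "k < K \<longleftrightarrow> L * k < b * M" for k :: nat
  proof -
    have "k < K \<longleftrightarrow> int k < \<lceil>b * M / L\<rceil>" by (simp add: K_def zless_nat_eq_int_zless)
    also have "\<dots> \<longleftrightarrow> real k < b * M / L" by (simp add: less_ceiling_iff)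
    also have "\<dots> \<longleftrightarrow> L * k < b * M" using L_pos by (simp add: field_simps)
    finally show ?thesis .
  qed
  show ?thesis
  proof (rule that[OF K])
    fix d x
    assume eq: "\<And>n. n \<le> M \<Longrightarrow> (\<Sum>j<N. c j * exp (- lam j * of_real (b * n)) * d j)
         + (\<Sum>k<K. (if L * k < b * n then c j1 * exp (- lam j1 * of_real (b * n - L * k)) else 0) * x k) = 0"
    \<comment> \<open>Up to the factor \<open>c j1\<close> this is the part of the rescaled sample n
      caused by impulses; it depends on n only through which impulses precede the sample.\<close>
    define S where "S = (\<lambda>n::nat. \<Sum>k<K. (if L * k < b * n then exp (lam j1 * of_real (L * k)) * x k else 0))"
    have eq': "(\<Sum>j<N. c j * d j * z j ^ n) + c j1 * S n = 0" if n: "n \<le> M" for n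
    proof -
      let ?E = "exp (lam j1 * of_real (b * n))"
      have z_pow: "?E * exp (- lam j * of_real (b * n)) = z j ^ n" for j
        unfolding z_def exp_of_nat_mult[symmetric] exp_add[symmetric] by (simp add: algebra_simps)
      have 1: "?E * (c j * exp (- lam j * of_real (b * n)) * d j) = c j * d j * z j ^ n" for j
        unfolding z_pow[symmetric] by (simp only: mult_ac)
      have shift: "?E * exp (- lam j1 * of_real (b * n - L * k)) = exp (lam j1 * of_real (L * k))" for k :: nat
        unfolding exp_add[symmetric] by (simp add: algebra_simps)
      have 2: "?E * ((if L * k < b * n then c j1 * exp (- lam j1 * of_real (b * n - L * k)) else 0) * x k)
          = c j1 * (if L * k < b * n then exp (lam j1 * of_real (L * k)) * x k else 0)" for k
        unfolding shift[symmetric] by (simp only: mult_ac split: if_split) simp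
      have "0 = ?E * ((\<Sum>j<N. c j * exp (- lam j * of_real (b * n)) * d j)
         + (\<Sum>k<K. (if L * k < b * n then c j1 * exp (- lam j1 * of_real (b * n - L * k)) else 0) * x k))"
        using eq[OF n] by simp
      also have "\<dots> = (\<Sum>j<N. c j * d j * z j ^ n) + c j1 * S n"
        unfolding distrib_left sum_distrib_left 1 2 S_def ..
      finally show ?thesis by simp
    qed
    have S_eq: "S (Suc n) = S n" if "n \<in> D" for n
    proof -
      have "L * k < b * Suc n \<longleftrightarrow> L * k < b * n" for k :: nat
      proof -
        have "\<not> (b * n \<le> L * k \<and> L * k < b * (real n + 1))" using that unfolding D_def by blast
        moreover have "b * n \<le> b * (real n + 1)" using b_pos by simp
        moreover have "b * Suc n = b * (real n + 1)" by (simp add: algebra_simps)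
        ultimately show ?thesis by (smt (verit))
      qed
      then show ?thesis by (simp add: S_def)
    qed
    \<comment> \<open>The differenced equations are a relation with these coefficients, so each of
      them vanishes; \<open>z j\<close> differs from 1 for \<open>j\<close> in
      \<open>J\<close>.\<close>
    have "\<forall>j\<in>J. c j * d j * (z j - 1) = 0"
    proof (rule F(3), rule ballI)
      fix n assume n: "n \<in> F"
      then have "n \<in> D" "n \<le> M" "Suc n \<le> M" using F(1) M[OF n] by auto
      then have "(\<Sum>j<N. c j * d j * z j ^ Suc n) - (\<Sum>j<N. c j * d j * z j ^ n) = 0"
        using eq'[of n] eq'[of "Suc n"] S_eq by (simp add: algebra_simps add_eq_0_iff2)
      then have "(\<Sum>j<N. c j * d j * (z j - 1) * z j ^ n) = 0"
        by (simp add: sum_subtractf[symmetric] algebra_simps)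
      then show "(\<Sum>j\<in>J. c j * d j * (z j - 1) * z j ^ n) = 0"
        unfolding J_def using j1 z1 by (subst (asm) sum.remove[of _ j1]) auto
    qed
    then have dJ: "d j = 0" if "j \<in> J" for j
      using that z_ne1 c_nz by (auto simp: J_def)
    have "(\<Sum>j<N. c j * d j * z j ^ n) = c j1 * d j1" for n
    proof -
      have "(\<Sum>j<N. c j * d j * z j ^ n) = c j1 * d j1 * z j1 ^ n + (\<Sum>j\<in>J. c j * d j * z j ^ n)"
        unfolding J_def using j1 by (subst sum.remove[of _ j1]) auto
      also have "(\<Sum>j\<in>J. c j * d j * z j ^ n) = 0" by (intro sum.neutral) (simp add: dJ)
      finally show ?thesis using z1 by simp
    qed
    then have dS: "d j1 + S n = 0" if "n \<le> M" for n
      using eq'[OF that] c_nz[OF j1] by (simp add: distrib_left[symmetric])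
    have "S 0 = 0" using L_pos by (simp add: S_def mult_less_0_iff)
    then have dj1: "d j1 = 0" using dS[of 0] by simp
    have "x k = 0" if "k < K" for k
      using that
    proof (induction k rule: less_induct)
      case (less k)
      \<comment> \<open>The first sample strictly after impulse \<open>k\<close>. Since
        \<open>b < L\<close> it precedes impulse k+1, so the only unknown left in it is
        \<open>x k\<close>.\<close>
      define n where "n = nat (\<lfloor>L * k / b\<rfloor> + 1)"
      have nn: "0 \<le> \<lfloor>L * k / b\<rfloor>" using L_pos b_pos by simp
      have n: "real n = of_int \<lfloor>L * k / b\<rfloor> + 1" using nn by (simp add: n_def)
      have lo: "L * k < b * n" and up: "b * n \<le> L * k + b"
        using b_pos floor_divide_lower[of b "L * k"] floor_divide_upper[of b "L * k"]
        by (auto simp: n algebra_simps)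
      have "b * n \<le> b * M + b - b"
      proof -
        have "of_int \<lfloor>L * k / b\<rfloor> < real M"
        proof (rule le_less_trans[OF of_int_floor_le])
          show "L * k / b < real M"
            using K[of k] less.prems b_pos by (simp add: divide_less_eq mult.commute)
        qed
        then have "\<lfloor>L * k / b\<rfloor> < int M" by linarith
        then have "n \<le> M" by (simp add: n_def)
        then show ?thesis using b_pos by simp
      qed
      then have nM: "n \<le> M" using b_pos by simp
      have gt: "\<not> L * k' < b * n" if "k < k'" for k' :: nat
      proof -
        have "L * (k + 1) \<le> L * k'" using that L_pos by (intro mult_left_mono) auto
        then show ?thesis using up b_L by (simp add: algebra_simps)
      qed
      have "S n = (\<Sum>k'<K. if k' = k then exp (lam j1 * of_real (L * k)) * x k else 0)"
        unfolding S_def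
      proof (intro sum.cong refl)
        fix k' assume "k' \<in> {..<K}"
        then have "x k' = 0" if "k' < k" using less.IH[OF that] by simp
        then show "(if L * k' < b * n then exp (lam j1 * of_real (L * k')) * x k' else 0)
            = (if k' = k then exp (lam j1 * of_real (L * k)) * x k else 0)"
          using gt[of k'] lo by (cases k' k rule: linorder_cases) auto
      qed
      also have "\<dots> = exp (lam j1 * of_real (L * k)) * x k" using less.prems by simp
      finally show "x k = 0" using dS[OF nM] dj1 by simp
    qed
    then show "(\<forall>j<N. d j = 0) \<and> (\<forall>k<K. x k = 0)"
      using dJ dj1 by (auto simp: J_def)
  qed
qed


lemma dominant_index: "\<exists>j1<N. \<forall>j<N. j \<noteq> j1 \<longrightarrow> Re (lam j) < Re (lam j1)"
proof -
  have "Max ((\<lambda>j. Re (lam j)) ` {..<N}) \<in> (\<lambda>j. Re (lam j)) ` {..<N}"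
    using N_pos by (intro Max_in) auto
  then obtain j1 where j1: "j1 < N" "Max ((\<lambda>j. Re (lam j)) ` {..<N}) = Re (lam j1)" by auto
  have "Re (lam j) < Re (lam j1)" if "j < N" "j \<noteq> j1" for j
  proof -
    have "Re (lam j) \<le> Re (lam j1)"
      unfolding j1(2)[symmetric] using that by (intro Max_ge) auto
    moreover have "Re (lam j) \<noteq> Re (lam j1)"
      using inj_onD[OF lam_inj, of j j1] that j1(1) by auto
    ultimately show ?thesis by simp
  qed
  with j1(1) show ?thesis by blast
qed

section \<open>The window system as a function of the offset, and its stable inversion\<close>

text \<open>Rows are samples; the columns are the N state components followed by the impulses. Which
  impulses a sample sees is decided at offset 0, without reference to \<open>z\<close>, and this
  makes the entries entire in \<open>z\<close>.\<close>

definition window_mat :: "complex \<Rightarrow> nat \<Rightarrow> nat \<Rightarrow> complex" where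
  "window_mat z n q = (if q < N then c q * exp (- lam q * (of_real (b * n) - z))
     else if L * (q - N) < b * n
       then (\<Sum>j<N. c j * exp (- lam j * (of_real (b * n - L * (q - N)) - z))) else 0)"

lemma sum_split_index:
  fixes f :: "nat \<Rightarrow> 'a::comm_monoid_add"
  shows "(\<Sum>q<N+K. f q) = (\<Sum>q<N. f q) + (\<Sum>k<K. f (N + k))"
  by (induction K) (auto simp: add.assoc)

text \<open>For small positive offsets the order of impulses and samples does not change, so the samples
  are entire functions of the offset; as the offset tends to infinity along the reals, the
  exponential with the largest real part dominates.\<close>

lemma window_left_inverse:
  obtains M K :: nat and e t0 :: real and E :: "nat \<Rightarrow> nat \<Rightarrow> complex"
  where "0 < t0" "t0 < e" "e \<le> L"
    "\<And>n k d. n \<le> M \<Longrightarrow> 0 < d \<Longrightarrow> d < e \<Longrightarrow> L * real k + d < b * n \<longleftrightarrow> L * real k < b * n"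
    "\<And>k::nat. k < K \<longleftrightarrow> L * k < b * M"
    "\<And>u p. p < N + K \<Longrightarrow> u p = (\<Sum>n\<le>M. E p n * (\<Sum>q<N+K. window_mat t0 n q * u q))"
proof -
  obtain j1 where j1: "j1 < N" "\<And>j. j < N \<Longrightarrow> j \<noteq> j1 \<Longrightarrow> Re (lam j) < Re (lam j1)"
    using dominant_index by blast
  show ?thesis
  proof (rule limit_system_injective[OF j1(1)])
    fix M K :: nat assume K: "\<And>k::nat. k < K \<longleftrightarrow> L * k < b * M"
      and inj: "\<And>d x. (\<And>n. n \<le> M \<Longrightarrow> (\<Sum>j<N. c j * exp (- lam j * of_real (b * n)) * d j)
           + (\<Sum>k<K. (if L * k < b * n then c j1 * exp (- lam j1 * of_real (b * n - L * k)) else 0) * x k) = 0)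
         \<Longrightarrow> (\<forall>j<N. d j = 0) \<and> (\<forall>k<K. x k = 0)"
    \<comment> \<open>The positive gaps between an impulse at offset 0 and a later sample. Offsets
      below the smallest gap do not change the order; \<open>L\<close> is inserted so that the set
      is nonempty and offsets stay below \<open>L\<close>.\<close>
    define T where "T = insert L ((\<lambda>(n,k). b * real n - L * real k) ` {(n,k). n \<le> M \<and> k < K \<and> L * real k < b * real n})"
    have finT: "finite T"
    proof -
      have "finite {(n,k). n \<le> M \<and> k < K \<and> L * real k < b * real n}"
        by (rule finite_subset[of _ "{..M} \<times> {..<K}"]) auto
      then show ?thesis by (simp add: T_def)
    qed
    define e where "e = Min T"
    have e: "e > 0" "e \<le> L"
      unfolding e_def using finT L_pos by (auto simp: T_def)
    have order: "L * real k + d < b * n \<longleftrightarrow> L * real k < b * n" if "n \<le> M" "0 < d" "d < e" for n k d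
    proof
      assume *: "L * real k < b * n"
      also have "b * n \<le> b * M" using that b_pos by simp
      finally have "k < K" by (simp add: K)
      then have "b * n - L * k \<in> T" using * that(1) by (auto simp: T_def)
      then have "e \<le> b * n - L * k" unfolding e_def using finT by simp
      then show "L * real k + d < b * n" using that by simp
    qed (use that in auto)
    define B where "B = (\<lambda>n q. if q < N then c q * exp (- lam q * of_real (b * n))
       else if L * (q - N) < b * n then c j1 * exp (- lam j1 * of_real (b * real n - L * (q - N))) else 0)"
    \<comment> \<open>The state columns become independent of t, and the impulse columns are divided
      by the growth of their dominant exponential.\<close>
    define s where "s = (\<lambda>t q. if q < N then exp (- lam q * of_real t) else exp (- lam j1 * complex_of_real t))"
    show ?thesis
    proof (rule generic_left_inverse[of "{..M}" "N+K" window_mat s B e])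
      show "(\<lambda>z. window_mat z n q) holomorphic_on UNIV" for n q
        unfolding window_mat_def by (cases "q < N"; cases "L * (q - N) < b * n") (auto intro!: holomorphic_intros)
      show "((\<lambda>t. window_mat (of_real t) n q * s t q) \<longlongrightarrow> B n q) at_top" for n q
      proof (cases "q < N")
        case True
        have "window_mat (of_real t) n q * s t q = B n q" for t
        proof -
          have "exp (- lam q * (of_real (b * n) - of_real t)) * exp (- lam q * of_real t)
              = exp (- lam q * of_real (b * n))"
            unfolding exp_add[symmetric] by (simp add: algebra_simps)
          then show ?thesis
            using True by (simp only: window_mat_def s_def B_def if_True mult.assoc)
        qed
        then show ?thesis by simp
      next
        case False
        show ?thesis
        proof (cases "L * (q - N) < b * n")
          case True
          let ?r = "b * n - L * (q - N)"
          have eq: "window_mat (of_real t) n q * s t q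
            = (\<Sum>j<N. c j * exp (- lam j * of_real ?r) * exp ((lam j - lam j1) * of_real t))" for t
          proof -
            have "exp (- lam j * (of_real ?r - of_real t)) * exp (- lam j1 * of_real t)
              = exp (- lam j * of_real ?r) * exp ((lam j - lam j1) * of_real t)" for j
              unfolding exp_add[symmetric] by (simp add: algebra_simps)
            then show ?thesis
              using False True by (simp add: window_mat_def s_def sum_distrib_right mult.assoc)
          qed
          have "((\<lambda>t. exp ((lam j - lam j1) * complex_of_real t)) \<longlongrightarrow> (if j = j1 then 1 else 0)) at_top"
            if "j < N" for j
          proof (cases "j = j1")
            case False
            then have r: "Re (lam j - lam j1) < 0" using j1(2)[OF that] by simp
            have "((\<lambda>t. exp (Re (lam j - lam j1) * t)) \<longlongrightarrow> 0) at_top"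
              using r by real_asymp
            then have "((\<lambda>t. norm (exp ((lam j - lam j1) * complex_of_real t))) \<longlongrightarrow> 0) at_top"
              by simp
            from tendsto_norm_zero_cancel[OF this] False show ?thesis by simp
          qed simp
          then have "((\<lambda>t. window_mat (of_real t) n q * s t q) \<longlongrightarrow>
            (\<Sum>j<N. c j * exp (- lam j * of_real ?r) * (if j = j1 then 1 else 0))) at_top"
            unfolding eq by (intro tendsto_intros) auto
          also have "(\<Sum>j<N. c j * exp (- lam j * of_real ?r) * (if j = j1 then 1 else 0))
             = (\<Sum>j<N. if j = j1 then c j * exp (- lam j * of_real ?r) else 0)"
            by (intro sum.cong) auto
          also have "\<dots> = B n q" using True False j1(1) by (simp add: B_def)
          finally show ?thesis .
        qed (use False in \<open>simp add: window_mat_def B_def\<close>)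
      qed
      show "u q = 0" if "\<And>n. n \<in> {..M} \<Longrightarrow> (\<Sum>q<N+K. B n q * u q) = 0" "q < N + K" for u q
      proof -
        have "(\<forall>j<N. u j = 0) \<and> (\<forall>k<K. u (N + k) = 0)"
        proof (rule inj)
          fix n assume "n \<le> M"
          then show "(\<Sum>j<N. c j * exp (- lam j * of_real (b * n)) * u j)
           + (\<Sum>k<K. (if L * k < b * n then c j1 * exp (- lam j1 * of_real (b * n - L * k)) else 0) * u (N + k)) = 0"
            using that(1)[of n] by (simp add: sum_split_index B_def cong: if_cong)
        qed
        moreover have "q < N \<or> (\<exists>k<K. q = N + k)" using that(2) by presburger
        ultimately show ?thesis by blast
      qed
      show "finite {..M}" "e > 0" using e by auto
      fix t0 E assume "0 < t0" "t0 < e"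
        "\<And>u p. p < N + K \<Longrightarrow> u p = (\<Sum>n\<in>{..M}. E p n * (\<Sum>q<N+K. window_mat (complex_of_real t0) n q * u q))"
      with e(2) order K show thesis by (intro that[of t0 e M K E])
    qed
  qed
qed

text \<open>Stability by perturbation: for offsets near \<open>t0\<close> the matrix changes so
  little compared with the left inverse that the error is absorbed into half of the unknown's norm.
  This gives one constant for a whole interval of offsets, which an inverse at the single offset
  \<open>t0\<close> would not.\<close>

lemma good_window:
  obtains t0 r C :: real and M :: nat where "r > 0" "C \<ge> 0" "\<And>d. \<bar>d - t0\<bar> < r \<Longrightarrow> 0 < d \<and> d < L"
    "\<And>d x j. \<bar>d - t0\<bar> < r \<Longrightarrow> bounded (range x) \<Longrightarrow>
       (\<Sum>j<N. cmod (state x j 0)) \<le> C * (\<Sum>n\<le>M. cmod (out d x (b * n)))"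
proof (rule window_left_inverse)
  fix M K :: nat and e t0 :: real and E :: "nat \<Rightarrow> nat \<Rightarrow> complex"
  assume t0: "0 < t0" "t0 < e" "e \<le> L"
    and order: "\<And>n k d. n \<le> M \<Longrightarrow> 0 < d \<Longrightarrow> d < e \<Longrightarrow> L * real k + d < b * n \<longleftrightarrow> L * real k < b * n"
    and K: "\<And>k::nat. k < K \<longleftrightarrow> L * k < b * M"
    and E: "\<And>u p. p < N + K \<Longrightarrow> u p = (\<Sum>n\<le>M. E p n * (\<Sum>q<N+K. window_mat t0 n q * u q))"
  \<comment> \<open>The unknown vector: the state before impulse 0, then the impulses inside the
    window.\<close>
  define u where "u = (\<lambda>x q. if q < N then state x q 0 else x (int (q - N)))"
  have out: "out d x (b * n) = (\<Sum>q<N+K. window_mat d n q * u x q)"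
    if "0 < d" "d < e" "bounded (range x)" "n \<le> M" for d x n
  proof -
    have "out d x (b * n) = (\<Sum>j<N. c j * exp (- lam j * of_real (b * n - (L * of_int 0 + d))) * state x j 0)
      + (\<Sum>i\<in>int ` {..<K}. phi0 (b * n - (L * of_int i + d)) * x i)"
    proof (rule out_eq)
      have "0 \<le> b * n" using b_pos by simp
      then show "L * of_int (0 - 1) + d < b * n" using that t0 by simp
      fix i :: int assume i: "0 \<le> i" "L * of_int i + d < b * n"
      have "b * n \<le> b * M" using that b_pos by simp
      then have "L * real (nat i) < b * M" using i that by simp
      then have "nat i < K" by (simp add: K)
      then show "i \<in> int ` {..<K}" using i(1) by (intro image_eqI[of _ _ "nat i"]) auto
    qed (use that in auto)
    also have "(\<Sum>i\<in>int ` {..<K}. phi0 (b * n - (L * of_int i + d)) * x i)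
      = (\<Sum>k<K. phi0 (b * n - (L * real k + d)) * x (int k))"
      by (subst sum.reindex) auto
    also have "\<dots> = (\<Sum>k<K. window_mat d n (N + k) * u x (N + k))"
    proof (intro sum.cong refl)
      fix k
      show "phi0 (b * n - (L * real k + d)) * x (int k) = window_mat d n (N + k) * u x (N + k)"
        using order[OF that(4,1,2), of k]
        by (auto simp: phi0_def phi_def window_mat_def u_def algebra_simps)
    qed
    finally show ?thesis by (simp add: sum_split_index window_mat_def u_def)
  qed
  define C0 where "C0 = (\<Sum>p<N+K. \<Sum>n\<le>M. cmod (E p n))"
  have C0: "C0 \<ge> 0" unfolding C0_def by (intro sum_nonneg) auto
  \<comment> \<open>Chosen so that \<open>C0 * \<eta>\<close> is at most 1/2, which allows the term
    with \<open>W\<close> to be moved to the left-hand side.\<close>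
  define \<eta> where "\<eta> = 1 / (2 * (C0 + 1) )"
  have \<eta>: "\<eta> > 0" "C0 * \<eta> \<le> 1/2" using C0 by (auto simp: \<eta>_def field_simps)
  have "\<forall>n\<in>{..M}. \<forall>q\<in>{..<N+K}. eventually (\<lambda>d::real. cmod (window_mat d n q - window_mat t0 n q) < \<eta>) (nhds t0)"
  proof (intro ballI)
    fix n q
    have "isCont (\<lambda>d. window_mat (complex_of_real d) n q) t0"
      unfolding window_mat_def by (cases "q < N"; cases "L * (q - N) < b * n") (auto intro!: continuous_intros)
    then have "((\<lambda>d. window_mat (complex_of_real d) n q) \<longlongrightarrow> window_mat t0 n q) (nhds t0)"
      by (simp add: continuous_at tendsto_nhds_iff)
    from tendstoD[OF this \<eta>(1)]
    show "eventually (\<lambda>d::real. cmod (window_mat d n q - window_mat t0 n q) < \<eta>) (nhds t0)"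
      by (simp add: dist_norm)
  qed
  then have "eventually (\<lambda>d::real. \<forall>n\<in>{..M}. \<forall>q\<in>{..<N+K}. cmod (window_mat d n q - window_mat t0 n q) < \<eta>) (nhds t0)"
    by (intro eventually_ball_finite ballI) auto
  then obtain r0 where r0: "r0 > 0" "\<And>d n q. \<bar>d - t0\<bar> < r0 \<Longrightarrow> n \<le> M \<Longrightarrow> q < N + K \<Longrightarrow> cmod (window_mat d n q - window_mat t0 n q) < \<eta>"
    unfolding eventually_nhds_metric dist_real_def by auto
  define r where "r = min r0 (min t0 (e - t0))"
  show ?thesis
  proof (rule that[of r "2 * C0" t0 M])
    show "r > 0" using r0(1) t0 by (simp add: r_def)
    show "2 * C0 \<ge> 0" using C0 by simp
    show "0 < d \<and> d < L" if "\<bar>d - t0\<bar> < r" for d using that t0 by (auto simp: r_def)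
    fix d x assume d: "\<bar>d - t0\<bar> < r" and x: "bounded (range (x :: int \<Rightarrow> complex))"
    have d': "0 < d" "d < e" "\<bar>d - t0\<bar> < r0" using d by (auto simp: r_def)
    define W where "W = (\<Sum>q<N+K. cmod (u x q))"
    define S where "S = (\<Sum>n\<le>M. cmod (out d x (b * n)))"
    have W0: "W \<ge> 0" "S \<ge> 0" unfolding W_def S_def by (auto intro: sum_nonneg)
    have row: "cmod (\<Sum>q<N+K. window_mat t0 n q * u x q) \<le> S + \<eta> * W" if n: "n \<le> M" for n
    proof -
      let ?R = "\<Sum>q<N+K. (window_mat d n q - window_mat t0 n q) * u x q"
      have eq: "(\<Sum>q<N+K. window_mat t0 n q * u x q) = out d x (b * n) - ?R"
        by (simp add: out[OF d'(1,2) x n] left_diff_distrib sum_subtractf)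
      have "cmod ?R \<le> (\<Sum>q<N+K. \<eta> * cmod (u x q))"
      proof (rule sum_norm_le)
        fix q assume "q \<in> {..<N+K}"
        then have "cmod (window_mat d n q - window_mat t0 n q) \<le> \<eta>"
          using r0(2)[OF d'(3) n, of q] by simp
        then show "cmod ((window_mat d n q - window_mat t0 n q) * u x q) \<le> \<eta> * cmod (u x q)"
          unfolding norm_mult by (rule mult_right_mono) simp
      qed
      then have "cmod ?R \<le> \<eta> * W" by (simp add: W_def sum_distrib_left)
      moreover have "cmod (out d x (b * n)) \<le> S"
        unfolding S_def using n by (intro member_le_sum) auto
      ultimately show ?thesis
        unfolding eq using norm_triangle_ineq4[of "out d x (b * n)" ?R] by linarith
    qed
    have "W = (\<Sum>q<N+K. cmod (u x q))" by (fact W_def)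
    also have "\<dots> \<le> (\<Sum>p<N+K. \<Sum>n\<le>M. cmod (E p n) * (S + \<eta> * W))"
    proof (rule sum_mono)
      fix p assume "p \<in> {..<N+K}"
      then have "cmod (u x p) = cmod (\<Sum>n\<le>M. E p n * (\<Sum>q<N+K. window_mat t0 n q * u x q))"
        using E[of p "u x"] by simp
      also have "\<dots> \<le> (\<Sum>n\<le>M. cmod (E p n) * (S + \<eta> * W))"
        by (rule sum_norm_le) (simp add: norm_mult mult_left_mono row)
      finally show "cmod (u x p) \<le> (\<Sum>n\<le>M. cmod (E p n) * (S + \<eta> * W))" .
    qed
    also have "\<dots> = C0 * (S + \<eta> * W)" by (simp add: C0_def sum_distrib_right)
    also have "\<dots> = C0 * S + (C0 * \<eta>) * W" by (simp add: algebra_simps)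
    also have "\<dots> \<le> C0 * S + 1/2 * W" using \<eta>(2) W0 by (intro add_left_mono mult_right_mono) auto
    finally have "W \<le> 2 * C0 * S" by simp
    moreover have "(\<Sum>j<N. cmod (state x j 0)) = (\<Sum>q<N. cmod (u x q))" by (simp add: u_def)
    moreover have "\<dots> \<le> W" unfolding W_def by (intro sum_mono2) auto
    ultimately show "(\<Sum>j<N. cmod (state x j 0)) \<le> 2 * C0 * (\<Sum>n\<le>M. cmod (out d x (b * n)))"
      by (simp add: S_def)
  qed
qed

end

section \<open>Recurrence of offsets and lattice point counts\<close>

text \<open>By Kronecker's theorem finitely many multiples of L/b approximate every point of a fine
  grid modulo 1, and \<open>Q\<close> is the largest multiplier used. The search goes backwards, to
  \<open>k \<le> 0\<close>, because the impulses are afterwards recovered moving forward from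
  \<open>k\<close> to 0.\<close>

lemma irrational_recurrence:
  fixes b L t0 r :: real
  assumes irr: "L / b \<notin> \<rat>" and b: "b > 0" and r: "r > 0"
  shows "\<exists>Q::nat. \<forall>d. \<exists>k n::int. - int Q \<le> k \<and> k \<le> 0 \<and> \<bar>d + L * k - b * n - t0\<bar> < r"
proof -
  \<comment> \<open>One \<epsilon> for the approximation, one for the grid mesh, and a factor
    \<open>b\<close> for returning from fractional parts to times: together
    \<open>r\<close>.\<close>
  define \<epsilon> where "\<epsilon> = r / (2 * b)"
  have \<epsilon>: "\<epsilon> > 0" using b r by (simp add: \<epsilon>_def)
  obtain m :: nat where m: "m > 0" "1 / m < \<epsilon>"
    using \<epsilon> by (metis gr_zeroI inverse_eq_divide real_arch_inverse)
  have "\<exists>k::nat. \<bar>frac (real k * (L / b)) - real i / m\<bar> < \<epsilon>" if "i \<le> m" for i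
    by (rule Kronecker_approx_1_explicit[OF irr _ _ \<epsilon>, of "real i / m"]) (use that m in auto)
  then obtain \<kappa> :: "nat \<Rightarrow> nat" where \<kappa>: "\<And>i. i \<le> m \<Longrightarrow> \<bar>frac (real (\<kappa> i) * (L / b)) - real i / m\<bar> < \<epsilon>"
    by metis
  define Q where "Q = Max (\<kappa> ` {..m})"
  have "\<exists>k n::int. - int Q \<le> k \<and> k \<le> 0 \<and> \<bar>d + L * k - b * n - t0\<bar> < r" for d
  proof -
    \<comment> \<open>The target modulo 1: \<open>d - b * n\<close> minus a multiple of
      \<open>L\<close> is near \<open>t0\<close> exactly when that multiple of L/b is near
      \<open>\<alpha>\<close> modulo 1, measured in units of \<open>b\<close>.\<close>
    define \<alpha> where "\<alpha> = frac ((d - t0) / b)"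
    have \<alpha>: "0 \<le> \<alpha>" "\<alpha> < 1" by (auto simp: \<alpha>_def frac_lt_1)
    define i where "i = nat \<lfloor>\<alpha> * m\<rfloor>"
    have i: "real i \<le> \<alpha> * m" "\<alpha> * m < real i + 1" using \<alpha> m by (auto simp: i_def)
    have "\<alpha> * m \<le> 1 * real m" using \<alpha> by (intro mult_right_mono) auto
    then have im: "i \<le> m" using i(1) by simp
    have "real i / m - \<alpha> = (real i - \<alpha> * m) / m" using m by (simp add: field_simps)
    then have "\<bar>real i / m - \<alpha>\<bar> = \<bar>real i - \<alpha> * m\<bar> / m" by simp
    also have "\<dots> \<le> 1 / m" using i by (intro divide_right_mono) auto
    finally have "\<bar>real i / m - \<alpha>\<bar> \<le> 1 / m" .
    then have "\<bar>frac (real (\<kappa> i) * (L / b)) - \<alpha>\<bar> < 2 * \<epsilon>" using \<kappa>[OF im] m(2) by linarith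
    then have "b * \<bar>frac (real (\<kappa> i) * (L / b)) - \<alpha>\<bar> < b * (2 * \<epsilon>)" using b by simp
    then have *: "\<bar>b * (frac (real (\<kappa> i) * (L / b)) - \<alpha>)\<bar> < r" using b by (simp add: abs_mult \<epsilon>_def)
    define n where "n = \<lfloor>(d - t0) / b\<rfloor> - \<lfloor>real (\<kappa> i) * (L / b)\<rfloor>"
    have "b * (frac (real (\<kappa> i) * (L / b)) - \<alpha>) = - (d + L * of_int (- int (\<kappa> i)) - b * of_int n - t0)"
      using b by (simp add: \<alpha>_def frac_def n_def field_simps)
    with * have "\<bar>d + L * of_int (- int (\<kappa> i)) - b * of_int n - t0\<bar> < r" by (metis abs_minus_cancel)
    moreover have "\<kappa> i \<le> Q" unfolding Q_def using im by (intro Max_ge) auto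
    ultimately show ?thesis by (intro exI[of _ "- int (\<kappa> i)"] exI[of _ n]) auto
  qed
  then show ?thesis by blast
qed

lemma lattice_ball_subset:
  fixes b a R :: real
  assumes "b > 0"
  shows "{n::int. \<bar>b * n - a\<bar> \<le> R} \<subseteq> {\<lceil>(a - R) / b\<rceil>..\<lfloor>(a + R) / b\<rfloor>}"
proof
  fix n :: int assume "n \<in> {n::int. \<bar>b * n - a\<bar> \<le> R}"
  then have "\<bar>b * n - a\<bar> \<le> R" by simp
  then have "a - R \<le> b * n" "b * n \<le> a + R" by linarith+
  then have "(a - R) / b \<le> n" "n \<le> (a + R) / b"
    using assms by (simp_all add: pos_divide_le_eq pos_le_divide_eq mult.commute)
  then show "n \<in> {\<lceil>(a - R) / b\<rceil>..\<lfloor>(a + R) / b\<rfloor>}" by (simp add: ceiling_le_iff le_floor_iff)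
qed

lemma lattice_ball_finite: "b > 0 \<Longrightarrow> finite {n::int. \<bar>b * n - a\<bar> \<le> (R::real)}"
  by (rule finite_subset[OF lattice_ball_subset]) auto

lemma lattice_ball_card:
  fixes b a R :: real
  assumes "b > 0" "R \<ge> 0"
  shows "card {n::int. \<bar>b * n - a\<bar> \<le> R} \<le> 2 * R / b + 1"
proof -
  have "card {n::int. \<bar>b * n - a\<bar> \<le> R} \<le> card {\<lceil>(a - R) / b\<rceil>..\<lfloor>(a + R) / b\<rfloor>}"
    by (rule card_mono[OF _ lattice_ball_subset[OF assms(1)]]) simp
  then have "real (card {n::int. \<bar>b * n - a\<bar> \<le> R}) \<le> real (nat (\<lfloor>(a + R) / b\<rfloor> + 1 - \<lceil>(a - R) / b\<rceil>))"
    by simp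
  also have "\<dots> \<le> max 0 ((a + R) / b + 1 - (a - R) / b)"
  proof -
    have "real_of_int \<lfloor>(a + R) / b\<rfloor> \<le> (a + R) / b" "(a - R) / b \<le> real_of_int \<lceil>(a - R) / b\<rceil>" by auto
    then have "real_of_int (\<lfloor>(a + R) / b\<rfloor> + 1 - \<lceil>(a - R) / b\<rceil>) \<le> (a + R) / b + 1 - (a - R) / b"
      unfolding of_int_diff of_int_add by linarith
    then show ?thesis by linarith
  qed
  also have "(a + R) / b + 1 - (a - R) / b = 2 * R / b + 1" by (simp add: add_divide_distrib diff_divide_distrib)
  also have "max 0 (2 * R / b + 1) = 2 * R / b + 1" using assms by simp
  finally show ?thesis .
qed

context exp_sampling begin

section \<open>Forward recovery of the impulses with uniform constants\<close>

text \<open>Since \<open>b < L\<close> this compact interval lies inside the positive axis, where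
  \<open>phi\<close> has no zero.\<close>

lemma phi_lower_bound: "\<exists>m>0. \<forall>t\<in>{L-b..L}. m \<le> cmod (phi t)"
proof -
  have "continuous_on {L-b..L} (\<lambda>t. cmod (phi t))"
    unfolding phi_def by (intro continuous_intros)
  then obtain t1 where t1: "t1 \<in> {L-b..L}" "\<forall>t\<in>{L-b..L}. cmod (phi t1) \<le> cmod (phi t)"
    using continuous_attains_inf[of "{L-b..L}" "\<lambda>t. cmod (phi t)"] b_pos by auto
  have "cmod (phi t1) > 0" using t1(1) b_L phi_nz[of t1] by (simp add: phi_def)
  with t1(2) show ?thesis by blast
qed

text \<open>The last sample before the next impulse sees the current impulse after a delay in
  (L - b, L], where phi is bounded away from zero.\<close>

lemma forward_step:
  assumes m: "m > 0" "\<forall>t\<in>{L-b..L}. m \<le> cmod (phi t)" and x: "bounded (range x)"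
    and S: "\<And>n::int. L * i + d + (L - b) < b * n \<Longrightarrow> b * n \<le> L * of_int (i + 1) + d \<Longrightarrow> cmod (out d x (b * n)) \<le> S"
  shows "m * cmod (x i) \<le> S + (\<Sum>j<N. cmod (c j)) * (\<Sum>j<N. cmod (state x j i))"
proof -
  \<comment> \<open>The last sample not later than impulse i+1. Coincidence with that impulse is
    harmless, because \<open>phi0\<close> vanishes at 0.\<close>
  define n where "n = \<lfloor>(L * of_int (i + 1) + d) / b\<rfloor>"
  define s where "s = b * n"
  have n: "s \<le> L * of_int (i + 1) + d" "L * i + d + (L - b) < s"
    using b_pos floor_divide_lower[of b "L * of_int (i + 1) + d"] floor_divide_upper[of b "L * of_int (i + 1) + d"]
    by (auto simp: s_def n_def algebra_simps)
  define t where "t = s - (L * of_int i + d)"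
  have t: "t \<in> {L-b..L}" "t > 0" using n b_L by (auto simp: t_def algebra_simps)
  let ?Y = "\<Sum>j<N. c j * exp (- lam j * of_real t) * state x j i"
  have "out d x s = ?Y + (\<Sum>i'\<in>{i}. phi0 (s - (L * of_int i' + d)) * x i')"
    unfolding t_def
  proof (rule out_eq[OF x])
    show "L * of_int (i - 1) + d < s" using n b_L b_pos by (simp add: algebra_simps)
    fix i' assume i': "i \<le> i'" "L * of_int i' + d < s"
    then have "L * of_int i' < L * of_int (i + 1)" using n by simp
    then have "i' < i + 1" using L_pos by simp
    with i' show "i' \<in> {i}" by simp
  qed auto
  then have eq: "out d x s = ?Y + phi t * x i" using t(2) by (simp add: phi0_def t_def)
  have "cmod ?Y \<le> (\<Sum>j<N. cmod (c j) * (\<Sum>j<N. cmod (state x j i)))"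
  proof (rule sum_norm_le)
    fix j assume j: "j \<in> {..<N}"
    have "cmod (exp (- lam j * of_real t)) \<le> 1" using lam_pos[of j] j t(2) by simp
    moreover have "cmod (state x j i) \<le> (\<Sum>j<N. cmod (state x j i))"
      using j by (intro member_le_sum) auto
    ultimately have "cmod (exp (- lam j * of_real t)) * cmod (state x j i) \<le> 1 * (\<Sum>j<N. cmod (state x j i))"
      by (intro mult_mono) auto
    then show "cmod (c j * exp (- lam j * of_real t) * state x j i) \<le> cmod (c j) * (\<Sum>j<N. cmod (state x j i))"
      unfolding norm_mult mult.assoc by (intro mult_left_mono) auto
  qed
  also have "\<dots> = (\<Sum>j<N. cmod (c j)) * (\<Sum>j<N. cmod (state x j i))" by (simp add: sum_distrib_right)
  finally have Y: "cmod ?Y \<le> (\<Sum>j<N. cmod (c j)) * (\<Sum>j<N. cmod (state x j i))" .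
  have "m * cmod (x i) \<le> cmod (phi t * x i)"
    unfolding norm_mult using m(2) t(1) by (intro mult_right_mono) auto
  also have "phi t * x i = out d x s - ?Y" using eq by simp
  also have "cmod \<dots> \<le> cmod (out d x s) + cmod ?Y" by (rule norm_triangle_ineq4)
  finally show ?thesis using Y S[of n] n unfolding s_def by linarith
qed

lemma state_sum_Suc:
  assumes "bounded (range x)"
  shows "(\<Sum>j<N. cmod (state x j (i + 1))) \<le> (\<Sum>j<N. cmod (state x j i)) + N * cmod (x i)"
proof -
  have "(\<Sum>j<N. cmod (state x j (i + 1))) \<le> (\<Sum>j<N. cmod (state x j i) + cmod (x i))"
  proof (rule sum_mono)
    fix j assume j: "j \<in> {..<N}"
    have e: "cmod (exp (- lam j * of_real L)) \<le> 1" using lam_pos[of j] j L_pos by simp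
    have "cmod (state x j (i + 1)) = cmod (exp (- lam j * of_real L)) * cmod (state x j i + x i)"
      using state_Suc[OF assms, of j i] j by (simp add: norm_mult)
    also have "\<dots> \<le> 1 * (cmod (state x j i) + cmod (x i))"
      using e by (intro mult_mono norm_triangle_ineq) auto
    finally show "cmod (state x j (i + 1)) \<le> cmod (state x j i) + cmod (x i)" by simp
  qed
  then show ?thesis by (simp add: sum.distrib)
qed

text \<open>Some impulse \<open>k\<close>, at most \<open>Q\<close> places before impulse 0, has a
  good offset, so its state is controlled by nearby samples. From there one alternates: the state
  bounds the impulse, the impulse bounds the next state. As \<open>Q\<close> is the same for all
  offsets, the constant accumulated is too.\<close>

lemma local_bound:
  assumes irr: "L / b \<notin> \<rat>"
  shows "\<exists>C R. C > 0 \<and> R > 0 \<and> (\<forall>d x. bounded (range x) \<longrightarrow>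
     cmod (x 0) \<le> C * (\<Sum>n\<in>{n::int. \<bar>b * n - d\<bar> \<le> R}. cmod (out d x (b * n))))"
proof (rule good_window)
  fix t0 r C :: real and M :: nat
  assume r: "r > 0" and C: "C \<ge> 0" and win: "\<And>d. \<bar>d - t0\<bar> < r \<Longrightarrow> 0 < d \<and> d < L"
    and good: "\<And>d x j. \<bar>d - t0\<bar> < r \<Longrightarrow> bounded (range x) \<Longrightarrow>
       (\<Sum>j<N. cmod (state x j 0)) \<le> C * (\<Sum>n\<le>M. cmod (out d x (b * n)))"
  obtain Q :: nat where Q: "\<And>d. \<exists>k n::int. - int Q \<le> k \<and> k \<le> 0 \<and> \<bar>d + L * k - b * n - t0\<bar> < r"
    using irrational_recurrence[OF irr b_pos r] by blast
  obtain m where m: "m > 0" "\<forall>t\<in>{L-b..L}. m \<le> cmod (phi t)" using phi_lower_bound by blast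
  \<comment> \<open>Room for \<open>Q\<close> impulse periods and one further offset shift
    backwards, for the window of length \<open>b * M\<close>, and for one period after impulse
    0.\<close>
  define R where "R = L * (Q + 1) + b * M + L"
  have R: "R > 0" using L_pos b_pos by (simp add: R_def add_pos_nonneg add_pos_pos)
  define cm where "cm = (\<Sum>j<N. cmod (c j))"
  have cm: "cm \<ge> 0" unfolding cm_def by (intro sum_nonneg) auto
  \<comment> \<open>\<open>a l\<close> bounds the state after \<open>l\<close> steps in units of the
    local sample sum: a bound v for the state bounds the impulse by (1 + cm v)/m, and the state then
    grows by at most N times that.\<close>
  define a where "a = rec_nat C (\<lambda>l v. v + N * ((1 + cm * v) / m))"
  have a_simps: "a 0 = C" "\<And>l. a (Suc l) = a l + N * ((1 + cm * a l) / m)" by (auto simp: a_def)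
  have a0: "0 \<le> a l" for l using C cm m by (induction l) (auto simp: a_simps)
  have "a l \<le> a (Suc l)" for l using a0[of l] cm m by (simp add: a_simps)
  then have a_mono: "mono a" by (rule incseq_SucI)
  define C' where "C' = (1 + cm * a Q) / m"
  have C': "C' > 0" unfolding C'_def using a0[of Q] cm m by (intro divide_pos_pos add_pos_nonneg) auto
  have "cmod (x 0) \<le> C' * (\<Sum>n\<in>{n::int. \<bar>b * n - d\<bar> \<le> R}. cmod (out d x (b * n)))"
    if x: "bounded (range x)" for d x
  proof -
    define Z where "Z = {n::int. \<bar>b * n - d\<bar> \<le> R}"
    have Z: "finite Z" unfolding Z_def by (rule lattice_ball_finite[OF b_pos])
    define S where "S = (\<Sum>n\<in>Z. cmod (out d x (b * n)))"
    have S0: "0 \<le> S" unfolding S_def by (intro sum_nonneg) auto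
    have S: "cmod (out d x (b * n)) \<le> S" if "\<bar>b * n - d\<bar> \<le> R" for n :: int
      unfolding S_def using that Z by (intro member_le_sum) (auto simp: Z_def)
    obtain k n0 :: int where k: "- int Q \<le> k" "k \<le> 0" "\<bar>d + L * k - b * n0 - t0\<bar> < r"
      using Q by blast
    \<comment> \<open>The offset seen when impulse \<open>k\<close> is renumbered to 0 and sample
      \<open>n0\<close> becomes sample 0; it lies in the good interval.\<close>
    define d' where "d' = d + L * k - b * n0"
    define x' where "x' = (\<lambda>i. x (i + k))"
    have x': "bounded (range x')" using x by (rule bounded_subset) (auto simp: x'_def)
    have d': "0 < d'" "d' < L" using win[of d'] k(3) by (auto simp: d'_def)
    have LQ: "L * of_int (- k) \<le> L * Q" using k L_pos by (intro mult_left_mono) auto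
    have "(\<Sum>n\<le>M. cmod (out d' x' (b * n))) = (\<Sum>n\<le>M. cmod (out d x (b * of_int (int n + n0))))"
    proof (intro sum.cong refl)
      fix n
      show "cmod (out d' x' (b * real n)) = cmod (out d x (b * of_int (int n + n0)))"
        using out_shift[of d x "b * of_int (int n + n0)" k "b * n0"]
        by (simp add: d'_def x'_def algebra_simps)
    qed
    also have "\<dots> = (\<Sum>n\<in>(\<lambda>n. int n + n0) ` {..M}. cmod (out d x (b * n)))"
      by (subst sum.reindex) (auto simp: inj_on_def)
    also have "\<dots> \<le> S"
      unfolding S_def
    proof (rule sum_mono2[OF Z])
      show "(\<lambda>n. int n + n0) ` {..M} \<subseteq> Z"
      proof (rule image_subsetI)
        fix n assume "n \<in> {..M}"
        then have "b * n \<le> b * M" "0 \<le> b * n" using b_pos by auto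
        moreover have "b * of_int (int n + n0) - d = b * n - L * of_int (- k) - d'"
          by (simp add: d'_def algebra_simps)
        moreover have "0 \<le> L * of_int (- k)" using k L_pos by (intro mult_nonneg_nonneg) auto
        ultimately have "\<bar>b * of_int (int n + n0) - d\<bar> \<le> R"
          using d' LQ by (simp add: R_def algebra_simps abs_if)
        then show "int n + n0 \<in> Z" by (simp add: Z_def)
      qed
    qed auto
    finally have "C * (\<Sum>n\<le>M. cmod (out d' x' (b * n))) \<le> C * S"
      using C by (intro mult_left_mono)
    moreover have "(\<Sum>j<N. cmod (state x' j 0)) = (\<Sum>j<N. cmod (state x j k))"
      using state_shift[of x _ 0 k] by (simp add: x'_def)
    moreover have "(\<Sum>j<N. cmod (state x' j 0)) \<le> C * (\<Sum>n\<le>M. cmod (out d' x' (b * n)))"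
      by (rule good) (use k x' in \<open>auto simp: d'_def\<close>)
    ultimately have start: "(\<Sum>j<N. cmod (state x j k)) \<le> a 0 * S" by (simp add: a_simps)
    have step: "m * cmod (x i) \<le> S + cm * (\<Sum>j<N. cmod (state x j i))" if i: "k \<le> i" "i \<le> 0" for i
      unfolding cm_def
    proof (rule forward_step[OF m x])
      fix n :: int assume n: "L * i + d + (L - b) < b * n" "b * n \<le> L * of_int (i + 1) + d"
      have "L * of_int (- i) \<le> L * of_int (- k)" "0 \<le> L * of_int (- i)"
        using i L_pos by (auto intro!: mult_left_mono mult_nonneg_nonneg simp del: of_int_minus)
      then have "\<bar>b * n - d\<bar> \<le> R"
      proof -
        have "0 \<le> b * M" "0 \<le> L * real Q" using b_pos L_pos by auto
        moreover have "R = L * Q + L + b * M + L" by (simp add: R_def algebra_simps)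
        moreover have "L * of_int i = - (L * of_int (- i))" "L * of_int (i + 1) = L - L * of_int (- i)"
          by (simp_all add: algebra_simps)
        ultimately show ?thesis
          using n LQ b_L L_pos \<open>L * of_int (- i) \<le> L * of_int (- k)\<close> \<open>0 \<le> L * of_int (- i)\<close> by linarith
      qed
      then show "cmod (out d x (b * n)) \<le> S" by (rule S)
    qed
    have ind: "(\<Sum>j<N. cmod (state x j (k + int l))) \<le> a l * S" if "int l \<le> - k" for l
      using that
    proof (induction l)
      case 0
      then show ?case using start by simp
    next
      case (Suc l)
      let ?i = "k + int l"
      have IH: "(\<Sum>j<N. cmod (state x j ?i)) \<le> a l * S" using Suc by simp
      have "m * cmod (x ?i) \<le> S + cm * (a l * S)"
        using step[of ?i] Suc.prems mult_left_mono[OF IH cm] by linarith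
      then have "cmod (x ?i) \<le> (1 + cm * a l) / m * S" using m by (simp add: field_simps)
      then have "N * cmod (x ?i) \<le> N * ((1 + cm * a l) / m * S)" by (intro mult_left_mono) auto
      then have "(\<Sum>j<N. cmod (state x j (?i + 1))) \<le> a l * S + N * ((1 + cm * a l) / m * S)"
        using state_sum_Suc[OF x, of ?i] IH by linarith
      also have "\<dots> = a (Suc l) * S" by (simp add: a_simps algebra_simps)
      finally show ?case by (simp add: algebra_simps)
    qed
    have "(\<Sum>j<N. cmod (state x j 0)) \<le> a (nat (- k)) * S" using ind[of "nat (- k)"] k by simp
    also have "\<dots> \<le> a Q * S" using k S0 by (intro mult_right_mono monoD[OF a_mono]) auto
    finally have "m * cmod (x 0) \<le> S + cm * (a Q * S)"
      using step[of 0] k mult_left_mono[OF _ cm] by fastforce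
    then show ?thesis using m by (simp add: C'_def S_def Z_def field_simps)
  qed
  with C' R show ?thesis by blast
qed

end

section \<open>Global sampling inequalities\<close>

lemma nn_integral_count_space_infsum:
  fixes f :: "'a \<Rightarrow> real"
  assumes "f summable_on A" "\<And>x. x \<in> A \<Longrightarrow> f x \<ge> 0"
  shows "(\<integral>\<^sup>+x. ennreal (f x) \<partial>count_space A) = ennreal (infsum f A)"
proof -
  have "(\<lambda>x. norm (f x)) summable_on A"
    using assms by (subst summable_on_cong[of A _ f]) auto
  then have abs: "Infinite_Set_Sum.abs_summable_on f A" by (simp add: abs_summable_equivalent[symmetric])
  show ?thesis
    using nn_integral_conv_infsetsum[OF abs assms(2)] infsetsum_infsum[OF abs] by simp
qed

context exp_sampling begin

text \<open>The local bound is moved to every impulse, squared with Cauchy-Schwarz, and summed. A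
  ball contains at most 2R/b + 1 samples and a sample lies in at most 2R/L + 1 balls; these are the
  factors in \<open>C1\<close> and \<open>C2\<close>.\<close>

lemma sampling_lower_bound:
  assumes irr: "L / b \<notin> \<rat>"
  shows "\<exists>C>0. \<forall>d x. bounded (range x) \<longrightarrow>
     (\<Sum>\<^sup>+k. nsq (x k))
       \<le> ennreal C * (\<Sum>\<^sup>+n::int. nsq (out d x (b * of_int n)))"
proof -
  obtain C R where C: "C > 0" and R: "R > 0" and loc: "\<And>d x. bounded (range x) \<Longrightarrow>
     cmod (x 0) \<le> C * (\<Sum>n\<in>{n::int. \<bar>b * n - d\<bar> \<le> R}. cmod (out d x (b * n)))"
    using local_bound[OF irr] by blast
  define C1 where "C1 = C\<^sup>2 * (2 * R / b + 1)"
  define C2 where "C2 = C1 * (2 * R / L + 1)"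
  have C1: "C1 > 0" unfolding C1_def using C R b_pos by (intro mult_pos_pos add_pos_pos) auto
  have C2: "C2 > 0" unfolding C2_def using C1 R L_pos by (intro mult_pos_pos add_pos_pos) auto
  have "(\<Sum>\<^sup>+k. nsq (x k))
       \<le> ennreal C2 * (\<Sum>\<^sup>+n::int. nsq (out d x (b * of_int n)))"
    if x: "bounded (range x)" for d x
  proof -
    let ?y = "\<lambda>n::int. (cmod (out d x (b * of_int n)))\<^sup>2"
    let ?Z = "\<lambda>k::int. {n::int. \<bar>b * n - (d + L * k)\<bar> \<le> R}"
    have pt: "(cmod (x k))\<^sup>2 \<le> C1 * (\<Sum>n\<in>?Z k. ?y n)" for k
    proof -
      have xk: "bounded (range (\<lambda>i. x (i + k)))" using x by (rule bounded_subset) auto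
      have "out (d + L * k) (\<lambda>i. x (i + k)) s = out d x s" for s
        using out_shift[of d x s k 0] by simp
      then have "cmod (x k) \<le> C * (\<Sum>n\<in>?Z k. cmod (out d x (b * n)))"
        using loc[OF xk, of "d + L * k"] by simp
      then have "(cmod (x k))\<^sup>2 \<le> C\<^sup>2 * (\<Sum>n\<in>?Z k. cmod (out d x (b * n)))\<^sup>2"
        unfolding power_mult_distrib[symmetric] by (intro power_mono) auto
      also have "\<dots> \<le> C\<^sup>2 * ((\<Sum>n\<in>?Z k. ?y n) * card (?Z k))"
        using sum_squared_le_sum_of_squares[of "\<lambda>n. cmod (out d x (b * n))" "?Z k"]
        by (intro mult_left_mono) auto
      also have "\<dots> \<le> C\<^sup>2 * ((\<Sum>n\<in>?Z k. ?y n) * (2 * R / b + 1))"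
        using lattice_ball_card[OF b_pos, of R "d + L * k"] R
        by (intro mult_left_mono sum_nonneg) auto
      finally show ?thesis by (simp add: C1_def mult.commute mult.left_commute)
    qed
    have "(\<Sum>\<^sup>+k. nsq (x k))
        \<le> (\<Sum>\<^sup>+k. (\<Sum>\<^sup>+n. ennreal (C1 * ?y n) * indicator (?Z k) n))"
    proof (rule nn_integral_mono)
      fix k
      have "(\<Sum>\<^sup>+n. ennreal (C1 * ?y n) * indicator (?Z k) n)
          = (\<integral>\<^sup>+n. ennreal (C1 * ?y n) \<partial>count_space (?Z k))"
        by (simp add: nn_integral_count_space_indicator)
      also have "\<dots> = ennreal (C1 * (\<Sum>n\<in>?Z k. ?y n))"
        using C1 lattice_ball_finite[OF b_pos] by (subst nn_integral_count_space_finite) (auto simp: sum_distrib_left)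
      finally show "nsq (x k) \<le> (\<Sum>\<^sup>+n. ennreal (C1 * ?y n) * indicator (?Z k) n)"
        using pt[of k] by (simp add: ennreal_leI)
    qed
    also have "\<dots> = (\<Sum>\<^sup>+n. (\<Sum>\<^sup>+k. ennreal (C1 * ?y n) * indicator (?Z k) n))"
      by (rule nn_integral_count_space_nn_integral) auto
    also have "\<dots> \<le> (\<Sum>\<^sup>+n. ennreal C2 * ennreal (?y n))"
    proof (rule nn_integral_mono)
      fix n :: int
      let ?K = "{k::int. \<bar>L * k - (b * n - d)\<bar> \<le> R}"
      have "(\<Sum>\<^sup>+k. ennreal (C1 * ?y n) * indicator (?Z k) n)
          = (\<Sum>\<^sup>+k. ennreal (C1 * ?y n) * indicator ?K k)"
        by (intro nn_integral_cong) (auto split: split_indicator)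
      also have "\<dots> = ennreal (C1 * ?y n) * card ?K"
        using lattice_ball_finite[OF L_pos]
        by (simp add: nn_integral_cmult_indicator)
      also have "\<dots> \<le> ennreal (C1 * ?y n) * ennreal (2 * R / L + 1)"
        using lattice_ball_card[OF L_pos, of R "b * n - d"] R
        by (intro mult_left_mono) (auto simp: ennreal_of_nat_eq_real_of_nat ennreal_leI)
      also have "\<dots> = ennreal C2 * ennreal (?y n)"
        using C1 R L_pos by (simp add: C2_def ennreal_mult[symmetric] mult_ac del: ennreal_plus)
      finally show "(\<Sum>\<^sup>+k. ennreal (C1 * ?y n) * indicator (?Z k) n) \<le> ennreal C2 * ennreal (?y n)" .
    qed
    also have "\<dots> = ennreal C2 * (\<Sum>\<^sup>+n. ennreal (?y n))"
      by (rule nn_integral_cmult) simp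
    finally show ?thesis .
  qed
  with C2 show ?thesis by blast
qed

text \<open>Schur's test, with the exponentially decaying majorant of phi0 as the weight.\<close>

lemma sampling_upper_bound:
  "\<exists>C>0. \<forall>d x. bounded (range x) \<longrightarrow>
     (\<Sum>\<^sup>+n::int. nsq (out d x (b * of_int n)))
       \<le> ennreal C * (\<Sum>\<^sup>+k. nsq (x k))"
proof (rule phi0_decay)
  fix C \<rho> :: real assume C: "C > 0" and rho: "\<rho> > 0" and dec: "\<And>t. cmod (phi0 t) \<le> C * exp (- \<rho> * \<bar>t\<bar>)"
  define w where "w = (\<lambda>d n k. C * exp (- \<rho> * \<bar>b * real_of_int n - (L * of_int k + d)\<bar>))"
  have w0: "0 \<le> w d n k" for d n k using C by (simp add: w_def)
  show ?thesis
  proof (rule exp_lattice_sum_bound[OF rho L_pos], rule exp_lattice_sum_bound[OF rho b_pos])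
    fix K1 K2
    assume K1: "K1 > 0" "\<And>a. (\<lambda>n::int. exp (- \<rho> * \<bar>L * of_int n - a\<bar>)) summable_on UNIV"
      "\<And>a. (\<Sum>\<^sub>\<infinity>n::int. exp (- \<rho> * \<bar>L * of_int n - a\<bar>)) \<le> K1"
      and K2: "K2 > 0" "\<And>a. (\<lambda>n::int. exp (- \<rho> * \<bar>b * of_int n - a\<bar>)) summable_on UNIV"
      "\<And>a. (\<Sum>\<^sub>\<infinity>n::int. exp (- \<rho> * \<bar>b * of_int n - a\<bar>)) \<le> K2"
    have row: "(\<Sum>\<^sup>+k. ennreal (w d n k)) \<le> ennreal (C * K1)" for d n
    proof -
      have eq: "w d n k = C * exp (- \<rho> * \<bar>L * of_int k - (b * of_int n - d)\<bar>)" for k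
        by (simp add: w_def abs_minus_commute algebra_simps)
      show ?thesis
        unfolding eq using C K1
        by (subst nn_integral_count_space_infsum)
           (auto simp: infsum_cmult_right' intro!: summable_on_cmult_right ennreal_leI mult_left_mono)
    qed
    have col: "(\<Sum>\<^sup>+n. ennreal (w d n k)) \<le> ennreal (C * K2)" for d k
      unfolding w_def using C K2
      by (subst nn_integral_count_space_infsum)
         (auto simp: infsum_cmult_right' intro!: summable_on_cmult_right ennreal_leI mult_left_mono)
    have "(\<Sum>\<^sup>+n::int. nsq (out d x (b * of_int n)))
       \<le> ennreal (C * K1 * (C * K2)) * (\<Sum>\<^sup>+k. nsq (x k))"
      if x: "bounded (range x)" for d x
    proof -
      have pt: "nsq (out d x (b * of_int n))
          \<le> ennreal (C * K1) * (\<Sum>\<^sup>+k. ennreal (w d n k) * nsq (x k))" for n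
      proof -
        have sm: "(\<lambda>k. norm (phi0 (b * of_int n - (L * of_int k + d)) * x k)) summable_on UNIV"
          by (rule out_summable[OF x])
        have "ennreal (cmod (out d x (b * of_int n)))
            \<le> ennreal (\<Sum>\<^sub>\<infinity>k. norm (phi0 (b * of_int n - (L * of_int k + d)) * x k))"
          unfolding out_def by (intro ennreal_leI norm_infsum_bound sm)
        also have "\<dots> = (\<Sum>\<^sup>+k. ennreal (norm (phi0 (b * of_int n - (L * of_int k + d)) * x k)))"
          by (rule nn_integral_count_space_infsum[symmetric, OF sm]) simp
        \<comment> \<open>The weight is split into two square roots, so that Cauchy-Schwarz yields
          the row sum times the weighted energy.\<close>
        also have "\<dots> \<le> (\<Sum>\<^sup>+k. ennreal (sqrt (w d n k)) * ennreal (sqrt (w d n k) * cmod (x k)))"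
        proof (rule nn_integral_mono)
          fix k
          have "norm (phi0 (b * of_int n - (L * of_int k + d)) * x k) \<le> w d n k * cmod (x k)"
            unfolding norm_mult w_def by (intro mult_right_mono dec) simp
          also have "\<dots> = sqrt (w d n k) * (sqrt (w d n k) * cmod (x k))"
            using w0 by (simp add: mult.assoc[symmetric])
          finally show "ennreal (norm (phi0 (b * of_int n - (L * of_int k + d)) * x k))
              \<le> ennreal (sqrt (w d n k)) * ennreal (sqrt (w d n k) * cmod (x k))"
            using w0 by (simp add: ennreal_mult[symmetric] ennreal_leI)
        qed
        finally have "(ennreal (cmod (out d x (b * of_int n))))\<^sup>2
          \<le> (\<Sum>\<^sup>+k. ennreal (sqrt (w d n k)) * ennreal (sqrt (w d n k) * cmod (x k)))\<^sup>2"
          by (rule power_mono) simp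
        also have "\<dots> \<le> (\<Sum>\<^sup>+k. (ennreal (sqrt (w d n k)))\<^sup>2)
            * (\<Sum>\<^sup>+k. (ennreal (sqrt (w d n k) * cmod (x k)))\<^sup>2)"
          by (rule Cauchy_Schwarz_nn_integral) auto
        also have "\<dots> = (\<Sum>\<^sup>+k. ennreal (w d n k))
            * (\<Sum>\<^sup>+k. ennreal (w d n k) * nsq (x k))"
          using w0 by (simp add: ennreal_power power_mult_distrib ennreal_mult)
        also have "\<dots> \<le> ennreal (C * K1) * (\<Sum>\<^sup>+k. ennreal (w d n k) * nsq (x k))"
          by (intro mult_right_mono row) simp
        finally show ?thesis by (simp add: ennreal_power)
      qed
      have "(\<Sum>\<^sup>+n::int. nsq (out d x (b * of_int n)))
        \<le> (\<Sum>\<^sup>+n. ennreal (C * K1) * (\<Sum>\<^sup>+k. ennreal (w d n k) * nsq (x k)))"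
        by (intro nn_integral_mono pt)
      also have "\<dots> = ennreal (C * K1) * (\<Sum>\<^sup>+n. (\<Sum>\<^sup>+k. ennreal (w d n k) * nsq (x k)))"
        by (rule nn_integral_cmult) simp
      also have "(\<Sum>\<^sup>+n. (\<Sum>\<^sup>+k. ennreal (w d n k) * nsq (x k)))
        = (\<Sum>\<^sup>+k. (\<Sum>\<^sup>+n. ennreal (w d n k) * nsq (x k)))"
        by (rule nn_integral_count_space_nn_integral) auto
      also have "\<dots> \<le> (\<Sum>\<^sup>+k. ennreal (C * K2) * nsq (x k))"
        by (intro nn_integral_mono, subst nn_integral_multc) (auto intro!: mult_right_mono col)
      also have "\<dots> = ennreal (C * K2) * (\<Sum>\<^sup>+k. nsq (x k))"
        by (rule nn_integral_cmult) simp
      finally show ?thesis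
        using C K1(1) K2(1) by (simp add: ennreal_mult mult.assoc mult_left_mono)
    qed
    moreover have "C * K1 * (C * K2) > 0" using C K1 K2 by simp
    ultimately show ?thesis by blast
  qed
qed

end

section \<open>Parseval's identity for bounded, almost everywhere continuous functions\<close>

definition unit_measure :: "real measure" where "unit_measure = restrict_space lborel {0..1}"

definition fourier_coeff :: "(real \<Rightarrow> complex) \<Rightarrow> int \<Rightarrow> complex" where
  "fourier_coeff H m = (LINT s|unit_measure. H s * cis (- 2 * pi * of_int m * s))"

interpretation unit_measure: finite_measure unit_measure
  by standard (simp add: unit_measure_def emeasure_restrict_space)

lemma measure_unit_measure [simp]: "measure unit_measure {0..1} = 1"
  by (simp add: unit_measure_def measure_restrict_space space_restrict_space)

lemma space_unit_measure [simp]: "space unit_measure = {0..1}"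
  by (simp add: unit_measure_def space_restrict_space)

lemma measurable_unit_measure:
  "f \<in> borel_measurable borel \<Longrightarrow> f \<in> borel_measurable unit_measure"
  unfolding unit_measure_def by (intro measurable_restrict_space1) simp

lemma measurable_cis [measurable]: "cis \<in> borel_measurable borel"
  by (intro borel_measurable_continuous_onI continuous_intros)

lemma measurable_cnj [measurable]: "cnj \<in> borel_measurable borel"
  by (intro borel_measurable_continuous_onI continuous_intros)

lemma integrable_unit_measure:
  fixes f :: "real \<Rightarrow> 'a::{banach, second_countable_topology}"
  assumes "f \<in> borel_measurable borel" "\<And>s. norm (f s) \<le> B"
  shows "integrable unit_measure f"
  using assms by (intro unit_measure.integrable_const_bound[where B = B] measurable_unit_measure) auto

lemma integral_cis_unit: "(LINT s|unit_measure. cis (2 * pi * of_int m * s)) = (if m = 0 then 1 else 0)"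
proof (cases "m = 0")
  case True
  then show ?thesis by (simp add: cis_zero)
next
  case False
  have "(LINT s|unit_measure. cis (2 * pi * of_int m * s)) = (LINT s:{0..1}|lborel. cis (2 * pi * of_int m * s))"
    unfolding unit_measure_def by (subst integral_restrict_space) (auto simp: set_lebesgue_integral_def)
  also have "\<dots> = integral {0..1} (\<lambda>s. cis (2 * pi * of_int m * s))"
    by (intro set_borel_integral_eq_integral(2) borel_integrable_atLeastAtMost') (auto intro!: continuous_intros)
  also have "\<dots> = 0"
  proof (rule integral_unique)
    let ?F = "\<lambda>s. cis (2 * pi * of_int m * s) / (\<i> * (2 * pi * of_int m))"
    have "((\<lambda>s. cis (2 * pi * of_int m * s)) has_integral (?F 1 - ?F 0)) {0..1}"
    proof (rule fundamental_theorem_of_calculus)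
      fix s :: real
      let ?k = "\<i> * (2 * pi * of_int m) :: complex"
      have "((\<lambda>z. exp (?k * z)) has_field_derivative exp (?k * of_real s) * ?k) (at (of_real s))"
        by (auto intro!: derivative_eq_intros)
      from DERIV_cdivide[OF this, of ?k]
      have "((\<lambda>z. exp (?k * z) / ?k) has_field_derivative exp (?k * of_real s)) (at (of_real s))"
        using False by simp
      from has_vector_derivative_real_field[OF this, of "{0..1}"]
      show "(?F has_vector_derivative cis (2 * pi * of_int m * s)) (at s within {0..1})"
        by (simp add: cis_conv_exp mult.assoc)
    qed simp
    moreover have "cis (2 * pi * of_int m) = 1"
      using cis_multiple_2pi[of "of_int m"] by (simp add: mult_ac)
    ultimately show "((\<lambda>s. cis (2 * pi * of_int m * s)) has_integral 0) {0..1}" by (simp add: cis_zero)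
  qed
  finally show ?thesis using False by simp
qed

locale bounded_unit =
  fixes H :: "real \<Rightarrow> complex" and B :: real
  assumes H_meas [measurable]: "H \<in> borel_measurable borel" and H_bound: "\<And>s. cmod (H s) \<le> B"
begin

lemma B_nonneg: "0 \<le> B" using H_bound[of 0] norm_ge_zero order_trans by blast

lemma integrable_HT: "integrable unit_measure (\<lambda>s. H s * cis (r * s))"
  by (rule integrable_unit_measure[where B = B]) (use H_bound in \<open>auto simp: norm_mult\<close>)

lemma integrable_HH: "integrable unit_measure (\<lambda>s. (cmod (H s))\<^sup>2)"
  by (rule integrable_unit_measure[where B = "B\<^sup>2"]) (use H_bound in \<open>auto intro!: power_mono\<close>)

definition energy :: real where "energy = (LINT s|unit_measure. (cmod (H s))\<^sup>2)"

text \<open>Nonnegativity of the squared distance from \<open>H\<close> to its finite Fourier sum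
  \<open>T\<close>.\<close>

lemma bessel:
  assumes A: "finite A"
  shows "(\<Sum>m\<in>A. (cmod (fourier_coeff H m))\<^sup>2) \<le> energy"
proof -
  define c where "c = fourier_coeff H"
  define T where "T = (\<lambda>s. \<Sum>m\<in>A. c m * cis (2 * pi * of_int m * s))"
  have Tm [measurable]: "T \<in> borel_measurable borel" unfolding T_def by measurable
  have Tb: "cmod (T s) \<le> (\<Sum>m\<in>A. cmod (c m))" for s
    unfolding T_def by (rule sum_norm_le) (simp add: norm_mult)
  define BT where "BT = (\<Sum>m\<in>A. cmod (c m))"
  have iHT: "integrable unit_measure (\<lambda>s. H s * cnj (T s))"
    by (rule integrable_unit_measure[where B = "B * BT"])
       (use H_bound Tb B_nonneg in \<open>auto simp: norm_mult BT_def intro!: mult_mono\<close>)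
  have iTT: "integrable unit_measure (\<lambda>s. T s * cnj (T s))"
    by (rule integrable_unit_measure[where B = "BT * BT"])
       (use Tb in \<open>auto simp: norm_mult BT_def intro!: mult_mono sum_nonneg\<close>)
  have iHH: "integrable unit_measure (\<lambda>s. H s * cnj (H s))"
    by (rule integrable_unit_measure[where B = "B * B"])
       (use H_bound B_nonneg in \<open>auto simp: norm_mult intro!: mult_mono\<close>)
  have HT: "(LINT s|unit_measure. H s * cnj (T s)) = (\<Sum>m\<in>A. c m * cnj (c m))"
  proof -
    have "H s * cnj (T s) = (\<Sum>m\<in>A. cnj (c m) * (H s * cis ((- 2 * pi * of_int m) * s)))" for s
      by (simp add: T_def sum_distrib_left mult_ac cis_cnj)
    then have "(LINT s|unit_measure. H s * cnj (T s))
       = (\<Sum>m\<in>A. LINT s|unit_measure. cnj (c m) * (H s * cis ((- 2 * pi * of_int m) * s)))"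
      by (simp only:) (intro Bochner_Integration.integral_sum integrable_mult_right integrable_HT)
    also have "\<dots> = (\<Sum>m\<in>A. cnj (c m) * (LINT s|unit_measure. H s * cis ((- 2 * pi * of_int m) * s)))"
      by (simp only: integral_mult_right_zero)
    also have "\<dots> = (\<Sum>m\<in>A. c m * cnj (c m))"
      by (simp add: c_def fourier_coeff_def mult.commute)
    finally show ?thesis .
  qed
  have TT: "(LINT s|unit_measure. T s * cnj (T s)) = (\<Sum>m\<in>A. c m * cnj (c m))"
  proof -
    have i: "integrable unit_measure (\<lambda>s. (c m * cnj (c l)) * cis (2 * pi * of_int (m - l) * s))" for m l
      by (intro integrable_mult_right integrable_unit_measure[where B = 1]) auto
    have "T s * cnj (T s) = (\<Sum>m\<in>A. \<Sum>l\<in>A. (c m * cnj (c l)) * cis (2 * pi * of_int (m - l) * s))" for s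
    proof -
      have "cis (2 * pi * of_int m * s) * cnj (cis (2 * pi * of_int l * s)) = cis (2 * pi * of_int (m - l) * s)" for m l
        by (simp add: cis_cnj cis_mult algebra_simps)
      then show ?thesis
        unfolding T_def cnj_sum sum_product complex_cnj_mult
        by (intro sum.cong refl) (simp add: mult_ac)
    qed
    then have "(LINT s|unit_measure. T s * cnj (T s))
       = (LINT s|unit_measure. (\<Sum>m\<in>A. \<Sum>l\<in>A. (c m * cnj (c l)) * cis (2 * pi * of_int (m - l) * s)))"
      by (simp only:)
    also have "\<dots> = (\<Sum>m\<in>A. \<Sum>l\<in>A. LINT s|unit_measure. (c m * cnj (c l)) * cis (2 * pi * of_int (m - l) * s))"
      using i by (subst Bochner_Integration.integral_sum, intro Bochner_Integration.integrable_sum, blast,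
          intro sum.cong refl Bochner_Integration.integral_sum)
    also have "\<dots> = (\<Sum>m\<in>A. \<Sum>l\<in>A. if l = m then c m * cnj (c m) else 0)"
      by (intro sum.cong refl) (auto simp: integral_cis_unit simp del: of_int_diff)
    also have "\<dots> = (\<Sum>m\<in>A. c m * cnj (c m))" using A by simp
    finally show ?thesis .
  qed
  have nn: "0 \<le> (LINT s|unit_measure. (cmod (H s - T s))\<^sup>2)" by (intro Bochner_Integration.integral_nonneg) simp
  have "complex_of_real (LINT s|unit_measure. (cmod (H s - T s))\<^sup>2) = (LINT s|unit_measure. complex_of_real ((cmod (H s - T s))\<^sup>2))"
    by (simp only: integral_complex_of_real)
  also have "\<dots> = (LINT s|unit_measure. H s * cnj (H s) - H s * cnj (T s) - cnj (H s * cnj (T s)) + T s * cnj (T s))"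
    by (intro Bochner_Integration.integral_cong refl) (simp only: complex_norm_square, simp add: algebra_simps)
  also have "\<dots> = (LINT s|unit_measure. H s * cnj (H s)) - (LINT s|unit_measure. H s * cnj (T s))
      - cnj (LINT s|unit_measure. H s * cnj (T s)) + (LINT s|unit_measure. T s * cnj (T s))"
    using iHT iTT iHH by (simp del: complex_cnj_mult)
  also have "\<dots> = complex_of_real (energy - (\<Sum>m\<in>A. (cmod (c m))\<^sup>2))"
  proof -
    have "(LINT s|unit_measure. H s * cnj (H s)) = complex_of_real energy"
      unfolding energy_def complex_norm_square[symmetric] by (simp only: integral_complex_of_real)
    then show ?thesis unfolding HT TT by (simp add: complex_norm_square[symmetric] del: of_real_power)
  qed
  finally have "(LINT s|unit_measure. (cmod (H s - T s))\<^sup>2) = energy - (\<Sum>m\<in>A. (cmod (c m))\<^sup>2)"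
    by (simp only: of_real_eq_iff)
  with nn show ?thesis by (simp add: c_def)
qed

end

section \<open>The Fejer kernel and Parseval's identity by averaging\<close>

text \<open>Written as a squared modulus, so that positivity is immediate;
  \<open>fejer_expand\<close> recovers the trigonometric polynomial.\<close>

definition fejer :: "nat \<Rightarrow> real \<Rightarrow> real" where
  "fejer n \<theta> = (cmod (\<Sum>j<n. cis (2 * pi * real j * \<theta>)))\<^sup>2 / n"

lemma fejer_nonneg: "0 \<le> fejer n \<theta>" by (simp add: fejer_def)

lemma measurable_fejer [measurable]: "fejer n \<in> borel_measurable borel"
  unfolding fejer_def by measurable

lemma fejer_expand:
  "complex_of_real (fejer n \<theta>) = (\<Sum>j<n. \<Sum>l<n. cis (2 * pi * of_int (int j - int l) * \<theta>)) / of_nat n"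
proof -
  have "complex_of_real (fejer n \<theta>)
     = (\<Sum>j<n. cis (2 * pi * real j * \<theta>)) * cnj (\<Sum>j<n. cis (2 * pi * real j * \<theta>)) / of_nat n"
    unfolding fejer_def of_real_divide complex_norm_square by simp
  also have "(\<Sum>j<n. cis (2 * pi * real j * \<theta>)) * cnj (\<Sum>j<n. cis (2 * pi * real j * \<theta>))
      = (\<Sum>j<n. \<Sum>l<n. cis (2 * pi * of_int (int j - int l) * \<theta>))"
    unfolding cnj_sum sum_product
    by (intro sum.cong refl) (simp add: cis_cnj cis_mult algebra_simps)
  finally show ?thesis .
qed

lemma fejer_le: "fejer n \<theta> \<le> n"
proof (cases "n = 0")
  case False
  have "cmod (\<Sum>j<n. cis (2 * pi * real j * \<theta>)) \<le> (\<Sum>j<n. 1)" by (rule sum_norm_le) simp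
  then have "(cmod (\<Sum>j<n. cis (2 * pi * real j * \<theta>)))\<^sup>2 \<le> (real n)\<^sup>2" by (intro power_mono) auto
  then show ?thesis using False by (simp add: fejer_def field_simps power2_eq_square)
qed (simp add: fejer_def)

lemma fejer_integral:
  assumes "n > 0"
  shows "(LINT s|unit_measure. fejer n (s - t)) = 1"
proof -
  have cis_eq: "cis (2 * pi * of_int m * (s - t)) = cis (- 2 * pi * of_int m * t) * cis (2 * pi * of_int m * s)" for m s
    by (simp add: cis_mult algebra_simps)
  have i: "integrable unit_measure (\<lambda>s. cis (- 2 * pi * of_int m * t) * cis (2 * pi * of_int m * s))" for m
    by (intro integrable_mult_right integrable_unit_measure[where B = 1]) auto
  have "complex_of_real (LINT s|unit_measure. fejer n (s - t)) = (LINT s|unit_measure. complex_of_real (fejer n (s - t)))"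
    by simp
  also have "\<dots> = (LINT s|unit_measure. (\<Sum>j<n. \<Sum>l<n. cis (- 2 * pi * of_int (int j - int l) * t) * cis (2 * pi * of_int (int j - int l) * s)) / of_nat n)"
    unfolding fejer_expand cis_eq ..
  also have "\<dots> = (\<Sum>j<n. \<Sum>l<n. cis (- 2 * pi * of_int (int j - int l) * t) * (if int j - int l = 0 then 1 else 0)) / of_nat n"
    unfolding integral_divide_zero
    using i by (simp only: Bochner_Integration.integral_sum Bochner_Integration.integrable_sum integral_mult_right_zero integral_cis_unit)
  also have "(\<Sum>j<n. \<Sum>l<n. cis (- 2 * pi * of_int (int j - int l) * t) * (if int j - int l = 0 then 1 else 0))
     = (\<Sum>j<n. \<Sum>l<n. if l = j then 1 else 0 :: complex)"
    by (intro sum.cong refl) (auto simp: cis_zero)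
  also have "\<dots> / of_nat n = 1" using assms by simp
  finally show ?thesis by (simp only: of_real_eq_1_iff)
qed

text \<open>The geometric sum has modulus at most 2 / |1 - exp(2 pi i \<theta>)|. The upper limit on
  \<theta> is needed because the kernel has period 1 and peaks again at 1 and -1, while differences
  of points of the unit interval fill [-1, 1].\<close>

lemma fejer_decay:
  assumes "0 < \<delta>" "\<delta> < 1/2"
  shows "\<exists>\<kappa>>0. \<forall>\<theta> n. n > 0 \<longrightarrow> \<delta> \<le> \<bar>\<theta>\<bar> \<longrightarrow> \<bar>\<theta>\<bar> \<le> 1 - \<delta> \<longrightarrow> fejer n \<theta> \<le> \<kappa> / n"
proof -
  have "continuous_on {\<delta>..1-\<delta>} (\<lambda>\<theta>. cmod (1 - cis (2 * pi * \<theta>)))" by (intro continuous_intros)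
  then obtain \<theta>0 where th0: "\<theta>0 \<in> {\<delta>..1-\<delta>}" "\<forall>\<theta>\<in>{\<delta>..1-\<delta>}. cmod (1 - cis (2 * pi * \<theta>0)) \<le> cmod (1 - cis (2 * pi * \<theta>))"
    using continuous_attains_inf[of "{\<delta>..1-\<delta>}" "\<lambda>\<theta>. cmod (1 - cis (2 * pi * \<theta>))"] assms by auto
  define q where "q = cmod (1 - cis (2 * pi * \<theta>0))"
  have "cis (2 * pi * \<theta>0) \<noteq> 1"
  proof
    assume "cis (2 * pi * \<theta>0) = 1"
    then have "cos (2 * pi * \<theta>0) = 1" by (metis Re_complex_of_real cis.simps(1) of_real_1)
    then obtain k :: int where "2 * pi * \<theta>0 = of_int k * 2 * pi" by (auto simp: cos_one_2pi_int)
    then have "\<theta>0 = of_int k" by (simp add: field_simps)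
    then have "0 < k" "k < 1" using th0(1) assms by auto
    then show False by simp
  qed
  then have q: "q > 0" by (simp add: q_def)
  have "fejer n \<theta> \<le> (4 / q\<^sup>2) / n" if n: "n > 0" and th: "\<delta> \<le> \<bar>\<theta>\<bar>" "\<bar>\<theta>\<bar> \<le> 1 - \<delta>" for n \<theta>
  proof -
    have "q \<le> cmod (1 - cis (2 * pi * \<bar>\<theta>\<bar>))" using th0(2) th by (simp add: q_def)
    also have "\<dots> = cmod (1 - cis (2 * pi * \<theta>))"
    proof (cases "\<theta> \<ge> 0")
      case False
      then have "1 - cis (2 * pi * \<bar>\<theta>\<bar>) = cnj (1 - cis (2 * pi * \<theta>))" by (simp add: cis_cnj)
      then show ?thesis by (simp only: complex_mod_cnj)
    qed simp
    finally have ql: "q \<le> cmod (1 - cis (2 * pi * \<theta>))" .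
    define S where "S = (\<Sum>j<n. cis (2 * pi * real j * \<theta>))"
    have "S = (\<Sum>j<n. cis (2 * pi * \<theta>) ^ j)"
      unfolding S_def by (intro sum.cong refl) (simp only: Complex.DeMoivre, simp add: mult_ac)
    then have "(1 - cis (2 * pi * \<theta>)) * S = 1 - cis (2 * pi * \<theta>) ^ n"
      by (simp add: one_diff_power_eq)
    then have "cmod (1 - cis (2 * pi * \<theta>)) * cmod S = cmod (1 - cis (2 * pi * \<theta>) ^ n)"
      by (metis norm_mult)
    also have "\<dots> \<le> 1 + 1"
      by (rule order_trans[OF norm_triangle_ineq4]) (simp add: norm_power)
    finally have "q * cmod S \<le> 2" using ql mult_right_mono[OF ql, of "cmod S"] by simp
    then have "(q * cmod S)\<^sup>2 \<le> 2\<^sup>2" using q by (intro power_mono) auto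
    then have "(cmod S)\<^sup>2 \<le> 4 / q\<^sup>2" using q by (simp add: power_mult_distrib field_simps)
    then show ?thesis unfolding fejer_def S_def[symmetric] by (intro divide_right_mono) auto
  qed
  moreover have "4 / q\<^sup>2 > 0" using q by simp
  ultimately show ?thesis by blast
qed

context bounded_unit begin

lemma diff_sq_bound: "(cmod (H s - H t))\<^sup>2 \<le> 4 * B\<^sup>2"
proof -
  have "cmod (H s - H t) \<le> 2 * B"
    using norm_triangle_ineq4[of "H s" "H t"] H_bound[of s] H_bound[of t] by linarith
  then have "(cmod (H s - H t))\<^sup>2 \<le> (2 * B)\<^sup>2" by (intro power_mono) auto
  then show ?thesis by (simp add: power_mult_distrib)
qed

text \<open>The contribution of frequency \<open>m\<close> to \<open>fejer_energy\<close>, before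
  averaging over the pairs of exponents with difference \<open>m\<close>.\<close>

definition oscillation :: "int \<Rightarrow> real \<Rightarrow> complex" where
  "oscillation m t = (LINT s|unit_measure. cis (2 * pi * of_int m * (s - t)) * of_real ((cmod (H s - H t))\<^sup>2))"

text \<open>Expanding |H s - H t|^2 separates the variables: every term is a function of t times an
  integral over s. The later integration over t therefore needs only one-dimensional
  integrals.\<close>

lemma oscillation_eq:
  "oscillation m t = cis (- 2 * pi * of_int m * t) * (LINT s|unit_measure. cis (2 * pi * of_int m * s) * of_real ((cmod (H s))\<^sup>2))
     + (if m = 0 then of_real ((cmod (H t))\<^sup>2) else 0)
     - fourier_coeff H (- m) * (cnj (H t) * cis (- 2 * pi * of_int m * t))
     - cnj (fourier_coeff H m) * (H t * cis (- 2 * pi * of_int m * t))"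
proof -
  let ?e = "\<lambda>s. cis (2 * pi * of_int m * s)" and ?e' = "cis (- 2 * pi * of_int m * t)"
  have ex: "cis (2 * pi * of_int m * (s - t)) * of_real ((cmod (H s - H t))\<^sup>2)
    = ?e' * (?e s * of_real ((cmod (H s))\<^sup>2)) + (?e' * of_real ((cmod (H t))\<^sup>2)) * ?e s
     - (?e' * cnj (H t)) * (H s * ?e s) - (?e' * H t) * (cnj (H s) * ?e s)" for s
  proof -
    have "cis (2 * pi * of_int m * (s - t)) = ?e' * ?e s" by (simp add: cis_mult algebra_simps)
    then show ?thesis unfolding complex_norm_square by (simp only: complex_cnj_diff) (simp add: algebra_simps)
  qed
  have i1: "integrable unit_measure (\<lambda>s. ?e s * of_real ((cmod (H s))\<^sup>2))"
    by (rule integrable_unit_measure[where B = "B\<^sup>2"])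
       (use H_bound in \<open>auto simp: norm_mult norm_power intro!: power_mono\<close>)
  have i2: "integrable unit_measure ?e" by (rule integrable_unit_measure[where B = 1]) auto
  have i3: "integrable unit_measure (\<lambda>s. H s * ?e s)" by (rule integrable_HT)
  have i4: "integrable unit_measure (\<lambda>s. cnj (H s) * ?e s)"
    by (rule integrable_unit_measure[where B = B]) (use H_bound in \<open>auto simp: norm_mult\<close>)
  have c1: "(LINT s|unit_measure. H s * ?e s) = fourier_coeff H (- m)" by (simp add: fourier_coeff_def)
  have c2: "(LINT s|unit_measure. cnj (H s) * ?e s) = cnj (fourier_coeff H m)"
    unfolding fourier_coeff_def
    by (subst Bochner_Integration.integral_cnj[symmetric], intro Bochner_Integration.integral_cong refl) (simp add: cis_cnj)
  have "oscillation m t = ?e' * (LINT s|unit_measure. ?e s * of_real ((cmod (H s))\<^sup>2)) + (?e' * of_real ((cmod (H t))\<^sup>2)) * (LINT s|unit_measure. ?e s)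
     - (?e' * cnj (H t)) * (LINT s|unit_measure. H s * ?e s) - (?e' * H t) * (LINT s|unit_measure. cnj (H s) * ?e s)"
    unfolding oscillation_def ex
    using i1 i2 i3 i4 by (simp only: Bochner_Integration.integral_diff Bochner_Integration.integral_add
       integral_mult_right_zero integrable_mult_right Bochner_Integration.integrable_diff Bochner_Integration.integrable_add)
  then show ?thesis
    unfolding c1 c2 integral_cis_unit by (cases "m = 0") (simp_all add: mult_ac)
qed

lemma oscillation_integral:
  shows "integrable unit_measure (oscillation m)"
    and "(LINT t|unit_measure. oscillation m t) = (if m = 0 then 2 * of_real energy else 0)
      - of_real ((cmod (fourier_coeff H (- m)))\<^sup>2) - of_real ((cmod (fourier_coeff H m))\<^sup>2)"
proof -
  let ?e' = "\<lambda>t. cis (- 2 * pi * of_int m * t)"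
  define P where "P = (LINT s|unit_measure. cis (2 * pi * of_int m * s) * of_real ((cmod (H s))\<^sup>2))"
  have i1: "integrable unit_measure ?e'" by (rule integrable_unit_measure[where B = 1]) auto
  have i2: "integrable unit_measure (\<lambda>t. if m = 0 then complex_of_real ((cmod (H t))\<^sup>2) else 0)"
    by (rule integrable_unit_measure[where B = "B\<^sup>2"])
       (use H_bound in \<open>auto simp: norm_power intro!: power_mono\<close>)
  have i3: "integrable unit_measure (\<lambda>t. H t * ?e' t)" by (rule integrable_HT)
  have i4: "integrable unit_measure (\<lambda>t. cnj (H t) * ?e' t)"
    by (rule integrable_unit_measure[where B = B]) (use H_bound in \<open>auto simp: norm_mult\<close>)
  have osc: "oscillation m = (\<lambda>t. P * ?e' t + (if m = 0 then of_real ((cmod (H t))\<^sup>2) else 0)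
     - fourier_coeff H (- m) * (cnj (H t) * ?e' t) - cnj (fourier_coeff H m) * (H t * ?e' t))"
    by (rule ext) (simp add: oscillation_eq P_def mult.commute)
  show "integrable unit_measure (oscillation m)"
    unfolding osc by (intro Bochner_Integration.integrable_diff Bochner_Integration.integrable_add integrable_mult_right i1 i2 i3 i4)
  have c1: "(LINT t|unit_measure. ?e' t) = (if m = 0 then 1 else 0)"
    using integral_cis_unit[of "- m"] by simp
  have c2: "(LINT t|unit_measure. (if m = 0 then complex_of_real ((cmod (H t))\<^sup>2) else 0)) = (if m = 0 then of_real energy else 0)"
    by (simp add: energy_def del: of_real_power)
  have c3: "(LINT t|unit_measure. cnj (H t) * ?e' t) = cnj (fourier_coeff H (- m))"
    unfolding fourier_coeff_def
    by (subst Bochner_Integration.integral_cnj[symmetric], intro Bochner_Integration.integral_cong refl) (simp add: cis_cnj)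
  have c4: "(LINT t|unit_measure. H t * ?e' t) = fourier_coeff H m" by (simp add: fourier_coeff_def)
  have P0: "m = 0 \<Longrightarrow> P = of_real energy" by (simp add: P_def energy_def cis_zero del: of_real_power)
  have "(LINT t|unit_measure. oscillation m t) = P * (LINT t|unit_measure. ?e' t)
     + (LINT t|unit_measure. (if m = 0 then complex_of_real ((cmod (H t))\<^sup>2) else 0))
     - fourier_coeff H (- m) * (LINT t|unit_measure. cnj (H t) * ?e' t)
     - cnj (fourier_coeff H m) * (LINT t|unit_measure. H t * ?e' t)"
    unfolding osc
    using i1 i2 i3 i4 by (simp only: Bochner_Integration.integral_diff Bochner_Integration.integral_add
       integral_mult_right_zero integrable_mult_right Bochner_Integration.integrable_diff Bochner_Integration.integrable_add)
  then show "(LINT t|unit_measure. oscillation m t) = (if m = 0 then 2 * of_real energy else 0)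
      - of_real ((cmod (fourier_coeff H (- m)))\<^sup>2) - of_real ((cmod (fourier_coeff H m))\<^sup>2)"
    unfolding c1 c2 c3 c4 unfolding complex_norm_square using P0 by (simp add: mult_ac)
qed

text \<open>Expanding the square turns the integral of the following quantity over t into twice the energy
  minus twice a Cesaro mean of the squared Fourier coefficients.\<close>

definition fejer_energy :: "nat \<Rightarrow> real \<Rightarrow> real" where
  "fejer_energy n t = (LINT s|unit_measure. fejer n (s - t) * (cmod (H s - H t))\<^sup>2)"

lemma integrable_fejer_sq: "integrable unit_measure (\<lambda>s. fejer n (s - t) * (cmod (H s - H t))\<^sup>2)"
  by (rule integrable_unit_measure[where B = "real n * (4 * B\<^sup>2)"])
     (auto simp: abs_mult fejer_nonneg intro!: mult_mono fejer_le diff_sq_bound)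

lemma fejer_energy_oscillation:
  "complex_of_real (fejer_energy n t) = (\<Sum>j<n. \<Sum>l<n. oscillation (int j - int l) t) / of_nat n"
proof -
  have i: "integrable unit_measure (\<lambda>s. cis (2 * pi * of_int m * (s - t)) * complex_of_real ((cmod (H s - H t))\<^sup>2))" for m
    by (rule integrable_unit_measure[where B = "4 * B\<^sup>2"]) (auto simp: norm_mult norm_power diff_sq_bound)
  have "complex_of_real (fejer_energy n t)
     = (LINT s|unit_measure. complex_of_real (fejer n (s - t)) * complex_of_real ((cmod (H s - H t))\<^sup>2))"
    unfolding fejer_energy_def by (simp only: of_real_mult[symmetric] integral_complex_of_real)
  also have "\<dots> = (LINT s|unit_measure. (\<Sum>j<n. \<Sum>l<n. cis (2 * pi * of_int (int j - int l) * (s - t)) * complex_of_real ((cmod (H s - H t))\<^sup>2)) / of_nat n)"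
    unfolding fejer_expand by (simp only: sum_distrib_right times_divide_eq_left)
  also have "\<dots> = (\<Sum>j<n. \<Sum>l<n. oscillation (int j - int l) t) / of_nat n"
    unfolding integral_divide_zero oscillation_def
    using i by (simp only: Bochner_Integration.integral_sum Bochner_Integration.integrable_sum)
  finally show ?thesis .
qed

lemma fejer_energy_integral:
  assumes "n > 0"
  shows "(LINT t|unit_measure. fejer_energy n t) =
    2 * energy - (\<Sum>j<n. \<Sum>l<n. (cmod (fourier_coeff H (- (int j - int l))))\<^sup>2 + (cmod (fourier_coeff H (int j - int l)))\<^sup>2) / n"
proof -
  have "complex_of_real (LINT t|unit_measure. fejer_energy n t)
      = (LINT t|unit_measure. (\<Sum>j<n. \<Sum>l<n. oscillation (int j - int l) t) / of_nat n)"
    by (simp only: integral_complex_of_real[symmetric] fejer_energy_oscillation)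
  also have "\<dots> = (\<Sum>j<n. \<Sum>l<n. (if int j - int l = 0 then 2 * of_real energy else 0)
      - of_real ((cmod (fourier_coeff H (- (int j - int l))))\<^sup>2) - of_real ((cmod (fourier_coeff H (int j - int l)))\<^sup>2)) / of_nat n"
    unfolding integral_divide_zero
    using oscillation_integral(1)
    by (simp only: Bochner_Integration.integral_sum Bochner_Integration.integrable_sum oscillation_integral(2))
  also have "\<dots> = ((\<Sum>j<n. \<Sum>l<n. (if l = j then 2 * of_real energy else 0))
     - (\<Sum>j<n. \<Sum>l<n. of_real ((cmod (fourier_coeff H (- (int j - int l))))\<^sup>2 + (cmod (fourier_coeff H (int j - int l)))\<^sup>2))) / of_nat n"
    unfolding sum_subtractf[symmetric]
    by (intro arg_cong2[where f = "(/)"] sum.cong refl) auto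
  also have "\<dots> = complex_of_real (2 * energy - (\<Sum>j<n. \<Sum>l<n. (cmod (fourier_coeff H (- (int j - int l))))\<^sup>2 + (cmod (fourier_coeff H (int j - int l)))\<^sup>2) / n)"
    using assms by (simp add: diff_divide_distrib del: of_real_power of_real_add)
  finally show ?thesis by (simp only: of_real_eq_iff)
qed

lemma measurable_fejer_energy: "fejer_energy n \<in> borel_measurable unit_measure"
proof -
  have "fejer_energy n = (\<lambda>t. Re ((\<Sum>j<n. \<Sum>l<n. oscillation (int j - int l) t) / of_nat n))"
    by (rule ext) (metis fejer_energy_oscillation Re_complex_of_real)
  moreover have "(\<lambda>t. Re ((\<Sum>j<n. \<Sum>l<n. oscillation (int j - int l) t) / of_nat n)) \<in> borel_measurable unit_measure"
    using oscillation_integral(1)[THEN borel_measurable_integrable] by measurable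
  ultimately show ?thesis by (simp only:)
qed

lemma fejer_energy_bounds: "0 \<le> fejer_energy n t" "n > 0 \<Longrightarrow> fejer_energy n t \<le> 4 * B\<^sup>2"
proof -
  show "0 \<le> fejer_energy n t" unfolding fejer_energy_def by (intro Bochner_Integration.integral_nonneg) (simp add: fejer_nonneg)
  have i: "integrable unit_measure (\<lambda>s. fejer n (s - t))"
    by (rule integrable_unit_measure[where B = n]) (auto simp: fejer_nonneg fejer_le)
  assume n: "n > 0"
  have "fejer_energy n t \<le> (LINT s|unit_measure. fejer n (s - t) * (4 * B\<^sup>2))"
    unfolding fejer_energy_def
    by (intro integral_mono integrable_fejer_sq integrable_mult_left i mult_left_mono diff_sq_bound fejer_nonneg)
  also have "\<dots> = 4 * B\<^sup>2" using fejer_integral[OF n, of t] by simp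
  finally show "fejer_energy n t \<le> 4 * B\<^sup>2" .
qed

text \<open>Approximate identity argument: near t the factor |H s - H t|^2 is small by continuity
  and the kernel has integral 1; elsewhere the kernel is O(1/n) and \<open>H\<close> is
  bounded.\<close>

lemma fejer_energy_tendsto_0:
  assumes t: "0 < t" "t < 1" and cont: "isCont H t"
  shows "(\<lambda>n. fejer_energy n t) \<longlonglongrightarrow> 0"
proof (rule LIMSEQ_I)
  fix \<epsilon> :: real assume eps: "\<epsilon> > 0"
  have "isCont (\<lambda>s. (cmod (H s - H t))\<^sup>2) t" using cont by (intro continuous_intros)
  then obtain \<delta>0 where d0: "\<delta>0 > 0" "\<And>s. \<bar>s - t\<bar> < \<delta>0 \<Longrightarrow> (cmod (H s - H t))\<^sup>2 < \<epsilon> / 2"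
    using eps unfolding continuous_at_eps_delta by (force simp: dist_real_def dest: spec[of _ "\<epsilon>/2"])
  \<comment> \<open>The bounds by \<open>t\<close> and \<open>1 - t\<close> keep |s - t| at most 1 -
    \<delta>, away from the periodic copies of the peak; 1/3 ensures \<delta> < 1/2.\<close>
  define \<delta> where "\<delta> = min (min \<delta>0 (1/3)) (min t (1 - t))"
  have d: "0 < \<delta>" "\<delta> < 1/2" "\<delta> \<le> \<delta>0" "\<delta> \<le> t" "\<delta> \<le> 1 - t" using d0(1) t by (auto simp: \<delta>_def min_def)
  obtain \<kappa> where k: "\<kappa> > 0" "\<And>\<theta> n. n > 0 \<Longrightarrow> \<delta> \<le> \<bar>\<theta>\<bar> \<Longrightarrow> \<bar>\<theta>\<bar> \<le> 1 - \<delta> \<Longrightarrow> fejer n \<theta> \<le> \<kappa> / n"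
    using fejer_decay[OF d(1,2)] by blast
  obtain n0 :: nat where n0: "n0 > 0" "8 * B\<^sup>2 * \<kappa> / \<epsilon> < n0"
    using reals_Archimedean2[of "max 0 (8 * B\<^sup>2 * \<kappa> / \<epsilon>)"] by (auto simp: less_eq_real_def) 
  have "fejer_energy n t < \<epsilon>" if n: "n \<ge> n0" for n
  proof -
    have npos: "n > 0" using n n0 by simp
    have i: "integrable unit_measure (\<lambda>s. fejer n (s - t))"
      by (rule integrable_unit_measure[where B = n]) (auto simp: fejer_nonneg fejer_le)
    have "fejer_energy n t \<le> (LINT s|unit_measure. fejer n (s - t) * (\<epsilon> / 2) + \<kappa> / n * (4 * B\<^sup>2))"
      unfolding fejer_energy_def
    proof (intro integral_mono integrable_fejer_sq Bochner_Integration.integrable_add integrable_mult_left i)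
      fix s assume "s \<in> space unit_measure"
      then have s: "0 \<le> s" "s \<le> 1" by auto
      show "fejer n (s - t) * (cmod (H s - H t))\<^sup>2 \<le> fejer n (s - t) * (\<epsilon> / 2) + \<kappa> / n * (4 * B\<^sup>2)"
      proof (cases "\<bar>s - t\<bar> < \<delta>")
        case True
        then have "fejer n (s - t) * (cmod (H s - H t))\<^sup>2 \<le> fejer n (s - t) * (\<epsilon> / 2)"
          using d0(2)[of s] d by (intro mult_left_mono fejer_nonneg) auto
        moreover have "0 \<le> \<kappa> / n * (4 * B\<^sup>2)" using k(1) by simp
        ultimately show ?thesis by linarith
      next
        case False
        then have "fejer n (s - t) \<le> \<kappa> / n" using k(2)[OF npos, of "s - t"] s d t by (auto simp: abs_if)
        then have "fejer n (s - t) * (cmod (H s - H t))\<^sup>2 \<le> \<kappa> / n * (4 * B\<^sup>2)"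
          using k(1) by (intro mult_mono diff_sq_bound) auto
        moreover have "0 \<le> fejer n (s - t) * (\<epsilon> / 2)" using eps fejer_nonneg by simp
        ultimately show ?thesis by linarith
      qed
    qed simp
    also have "\<dots> = \<epsilon> / 2 + \<kappa> / n * (4 * B\<^sup>2)"
      using i fejer_integral[OF npos, of t] by simp
    also have "\<kappa> / n * (4 * B\<^sup>2) < \<epsilon> / 2"
    proof -
      have "8 * B\<^sup>2 * \<kappa> / \<epsilon> < n" using n0(2) n by simp
      then show ?thesis using eps npos by (simp add: field_simps)
    qed
    finally show ?thesis by simp
  qed
  then show "\<exists>n0. \<forall>n\<ge>n0. norm (fejer_energy n t - 0) < \<epsilon>"
    using fejer_energy_bounds(1) by (intro exI[of _ n0]) auto
qed

text \<open>Bessel gives one inequality. For the other, the integral of \<open>fejer_energy\<close>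
  is at least twice the energy minus twice the coefficient sum, and it tends to 0 by dominated
  convergence; almost everywhere continuity suffices for that.\<close>

lemma parseval:
  assumes cont: "AE t in unit_measure. 0 < t \<and> t < 1 \<and> isCont H t"
  shows "((\<lambda>m. (cmod (fourier_coeff H m))\<^sup>2) has_sum energy) UNIV"
proof -
  let ?c = "\<lambda>m. (cmod (fourier_coeff H m))\<^sup>2"
  have sm: "?c summable_on UNIV"
    by (rule nonneg_bdd_above_summable_on) (auto intro!: bdd_aboveI[of _ energy] bessel)
  have le: "infsum ?c UNIV \<le> energy" by (rule infsum_le_finite_sums[OF sm]) (simp add: bessel)
  have "(\<lambda>n. LINT t|unit_measure. fejer_energy (Suc n) t) \<longlonglongrightarrow> (LINT t|unit_measure. 0)"
  proof (rule integral_dominated_convergence[where w = "\<lambda>_. 4 * B\<^sup>2"])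
    show "AE t in unit_measure. (\<lambda>n. fejer_energy (Suc n) t) \<longlonglongrightarrow> 0"
      using cont by eventually_elim (use fejer_energy_tendsto_0 LIMSEQ_Suc in blast)
    show "AE t in unit_measure. norm (fejer_energy (Suc n) t) \<le> 4 * B\<^sup>2" for n
      using fejer_energy_bounds by (intro AE_I2) simp
  qed (use measurable_fejer_energy in auto)
  then have lim: "(\<lambda>n. LINT t|unit_measure. fejer_energy (Suc n) t) \<longlonglongrightarrow> 0" by simp
  have "2 * energy - 2 * infsum ?c UNIV \<le> (LINT t|unit_measure. fejer_energy (Suc n) t)" for n
  proof -
    \<comment> \<open>For fixed j the frequencies j - l are distinct, so a row is at most the full
      sum; division by \<open>Suc n\<close> offsets the number of rows.\<close>
    have row: "(\<Sum>l<Suc n. ?c (f l)) \<le> infsum ?c UNIV" if "inj_on f {..<Suc n}" for f :: "nat \<Rightarrow> int"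
    proof -
      have "(\<Sum>l<Suc n. ?c (f l)) = (\<Sum>m\<in>f ` {..<Suc n}. ?c m)"
        using that by (subst sum.reindex) auto
      also have "\<dots> \<le> infsum ?c UNIV" by (intro finite_sum_le_infsum sm) auto
      finally show ?thesis .
    qed
    have "(\<Sum>j<Suc n. \<Sum>l<Suc n. ?c (- (int j - int l)) + ?c (int j - int l)) \<le> (\<Sum>j<Suc n. infsum ?c UNIV + infsum ?c UNIV)"
      unfolding sum.distrib by (intro add_mono sum_mono row) (auto simp: inj_on_def)
    then have "(\<Sum>j<Suc n. \<Sum>l<Suc n. ?c (- (int j - int l)) + ?c (int j - int l)) / Suc n \<le> 2 * infsum ?c UNIV"
      by (simp add: pos_divide_le_eq mult.commute del: sum.lessThan_Suc)
    then show ?thesis unfolding fejer_energy_integral[of "Suc n", OF zero_less_Suc] by linarith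
  qed
  then have "2 * energy - 2 * infsum ?c UNIV \<le> 0"
    by (intro tendsto_lowerbound[OF lim]) (auto intro: always_eventually)
  with le sm show ?thesis by (simp add: has_sum_iff)
qed

end

section \<open>Folding over a lattice and the Plancherel identity\<close>

lemma AE_lborel_countable:
  fixes X :: "real set"
  assumes "countable X" shows "AE s in lborel. s \<notin> X"
  using emeasure_lborel_countable[OF assms] assms
  by (intro AE_I'[of X]) (auto simp: null_sets_def sets.countable)

text \<open>An affine substitution from the unit interval; the phase produced by the left endpoint
  \<open>a\<close> disappears in the modulus, and the two endpoints join the exceptional countable
  set.\<close>

lemma parseval_interval:
  fixes h :: "real \<Rightarrow> complex"
  assumes l: "l > 0" and hm [measurable]: "h \<in> borel_measurable borel" and hb: "\<And>s. cmod (h s) \<le> B"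
    and X: "countable X" and cont: "\<And>s. a < s \<Longrightarrow> s < a + l \<Longrightarrow> s \<notin> X \<Longrightarrow> isCont h s"
  shows "(\<Sum>\<^sup>+m::int. nsq (LINT s|lborel. indicator {a..a+l} s *\<^sub>R (h s * cis (- 2 * pi * of_int m * s / l))))
    = ennreal l * (\<integral>\<^sup>+s. indicator {a..a+l} s * nsq (h s) \<partial>lborel)"
proof -
  define H where "H = (\<lambda>u. h (a + l * u))"
  have Hm [measurable]: "H \<in> borel_measurable borel" unfolding H_def by measurable
  interpret bounded_unit H B by standard (auto simp: H_def hb)
  have "AE u in lborel. u \<notin> {0, 1} \<union> (\<lambda>s. (s - a) / l) ` X"
    using X by (intro AE_lborel_countable) auto
  then have "AE u in unit_measure. 0 < u \<and> u < 1 \<and> isCont H u"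
    unfolding unit_measure_def
  proof (subst AE_restrict_space_iff, simp, eventually_elim)
    fix u assume u: "u \<notin> {0, 1} \<union> (\<lambda>s. (s - a) / l) ` X"
    show "u \<in> {0..1} \<longrightarrow> 0 < u \<and> u < 1 \<and> isCont H u"
    proof
      assume "u \<in> {0..1}"
      with u have u01: "0 < u" "u < 1" by auto
      have "a + l * u \<notin> X"
      proof
        assume "a + l * u \<in> X"
        then have "(a + l * u - a) / l \<in> (\<lambda>s. (s - a) / l) ` X" by blast
        then show False using u l by simp
      qed
      then have "isCont h (a + l * u)" using u01 l by (intro cont) auto
      moreover have "isCont (\<lambda>u. a + l * u) u" by (intro continuous_intros)
      ultimately have "isCont H u" unfolding H_def by (rule isCont_o2[rotated])
      with u01 show "0 < u \<and> u < 1 \<and> isCont H u" by simp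
    qed
  qed
  then have sums: "((\<lambda>m. (cmod (fourier_coeff H m))\<^sup>2) has_sum energy) UNIV" by (rule parseval)
  have "a + l * u \<in> {a..a+l} \<longleftrightarrow> u \<in> {0..1}" for u
    using l by (auto simp: zero_le_mult_iff mult_le_cancel_left1)
  then have ind: "indicator {a..a+l} (a + l * u) = (indicator {0..1} u :: real)"
    and ind': "indicator {a..a+l} (a + l * u) = (indicator {0..1} u :: ennreal)" for u
    by (simp_all only: indicator_def)
  have coeff: "(LINT s|lborel. indicator {a..a+l} s *\<^sub>R (h s * cis (- 2 * pi * of_int m * s / l)))
      = l *\<^sub>R (cis (- 2 * pi * of_int m * a / l) * fourier_coeff H m)" for m
  proof -
    have "(LINT s|lborel. indicator {a..a+l} s *\<^sub>R (h s * cis (- 2 * pi * of_int m * s / l)))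
       = \<bar>l\<bar> *\<^sub>R (LINT u|lborel. indicator {a..a+l} (a + l * u) *\<^sub>R (h (a + l * u) * cis (- 2 * pi * of_int m * (a + l * u) / l)))"
      using l by (intro lborel_integral_real_affine) simp
    also have "(\<lambda>u. indicator {a..a+l} (a + l * u) *\<^sub>R (h (a + l * u) * cis (- 2 * pi * of_int m * (a + l * u) / l)))
       = (\<lambda>u. cis (- 2 * pi * of_int m * a / l) * (indicator {0..1} u *\<^sub>R (H u * cis (- 2 * pi * of_int m * u))))"
    proof
      fix u
      have "- 2 * pi * of_int m * (a + l * u) / l = (- 2 * pi * of_int m * a / l) + (- 2 * pi * of_int m * u)"
        using l by (simp add: field_simps)
      then have "cis (- 2 * pi * of_int m * (a + l * u) / l) = cis (- 2 * pi * of_int m * a / l) * cis (- 2 * pi * of_int m * u)"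
        by (simp only: cis_mult)
      then show "indicator {a..a+l} (a + l * u) *\<^sub>R (h (a + l * u) * cis (- 2 * pi * of_int m * (a + l * u) / l))
        = cis (- 2 * pi * of_int m * a / l) * (indicator {0..1} u *\<^sub>R (H u * cis (- 2 * pi * of_int m * u)))"
        unfolding ind H_def by (simp add: indicator_def)
    qed
    also have "(LINT u|lborel. cis (- 2 * pi * of_int m * a / l) * (indicator {0..1} u *\<^sub>R (H u * cis (- 2 * pi * of_int m * u))))
       = cis (- 2 * pi * of_int m * a / l) * fourier_coeff H m"
      unfolding integral_mult_right_zero fourier_coeff_def unit_measure_def
      by (subst integral_restrict_space) auto
    finally show ?thesis using l by simp
  qed
  have energy_eq: "ennreal l * ennreal energy = (\<integral>\<^sup>+s. indicator {a..a+l} s * nsq (h s) \<partial>lborel)"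
  proof -
    have "(\<integral>\<^sup>+s. indicator {a..a+l} s * nsq (h s) \<partial>lborel)
      = ennreal \<bar>l\<bar> * (\<integral>\<^sup>+u. indicator {a..a+l} (a + l * u) * nsq (h (a + l * u)) \<partial>lborel)"
      using l by (intro nn_integral_real_affine) auto
    also have "\<dots> = ennreal l * (\<integral>\<^sup>+u. nsq (H u) * indicator {0..1} u \<partial>lborel)"
      using l unfolding ind' by (simp add: H_def mult.commute)
    also have "(\<integral>\<^sup>+u. nsq (H u) * indicator {0..1} u \<partial>lborel) = (\<integral>\<^sup>+u. nsq (H u) \<partial>unit_measure)"
      unfolding unit_measure_def by (subst nn_integral_restrict_space) auto
    also have "\<dots> = ennreal energy"
      unfolding energy_def by (rule nn_integral_eq_integral[OF integrable_HH]) simp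
    finally show ?thesis ..
  qed
  have "(\<Sum>\<^sup>+m::int. nsq (LINT s|lborel. indicator {a..a+l} s *\<^sub>R (h s * cis (- 2 * pi * of_int m * s / l))))
     = (\<Sum>\<^sup>+m. ennreal (l\<^sup>2) * nsq (fourier_coeff H m))"
    unfolding coeff by (simp add: norm_mult power_mult_distrib ennreal_mult)
  also have "\<dots> = ennreal (l\<^sup>2) * (\<Sum>\<^sup>+m. nsq (fourier_coeff H m))"
    by (rule nn_integral_cmult) simp
  also have "(\<Sum>\<^sup>+m. nsq (fourier_coeff H m)) = ennreal energy"
    using sums by (subst nn_integral_count_space_infsum) (auto simp: has_sum_iff)
  also have "ennreal (l\<^sup>2) * ennreal energy = ennreal l * (ennreal l * ennreal energy)"
    using l by (simp add: power2_eq_square ennreal_mult mult.assoc)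
  finally show ?thesis unfolding energy_eq .
qed

lemma lattice_cell_iff:
  fixes L s :: real assumes "L > 0"
  shows "L * of_int k \<le> s \<and> s < L * of_int (k + 1) \<longleftrightarrow> k = \<lfloor>s / L\<rfloor>"
proof -
  have "k = \<lfloor>s / L\<rfloor> \<longleftrightarrow> of_int k \<le> s / L \<and> s / L < of_int k + 1"
    using floor_eq_iff[of "s / L" k] by auto
  then show ?thesis using assms by (simp add: pos_le_divide_eq pos_divide_less_eq mult.commute)
qed

text \<open>Tonelli over half-open cells, which partition the line exactly. Passing to the closed
  cell alters a null set and matches the form used by \<open>parseval_interval\<close>.\<close>

lemma nn_integral_fold:
  fixes G :: "real \<Rightarrow> ennreal"
  assumes L: "L > 0" and G [measurable]: "G \<in> borel_measurable borel"
  shows "(\<integral>\<^sup>+s. G s \<partial>lborel)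
     = (\<integral>\<^sup>+s. indicator {0..L} s * (\<Sum>\<^sup>+k::int. G (s + L * of_int k)) \<partial>lborel)"
proof -
  let ?I = "\<lambda>k::int. {L * of_int k..<L * of_int (k + 1)}"
  have "(\<integral>\<^sup>+s. G s \<partial>lborel) = (\<integral>\<^sup>+s. (\<Sum>\<^sup>+k. G s * indicator (?I k) s) \<partial>lborel)"
  proof (rule nn_integral_cong)
    fix s
    have "(\<Sum>\<^sup>+k. G s * indicator (?I k) s) = (\<Sum>\<^sup>+k. G s * indicator {\<lfloor>s / L\<rfloor>} k)"
      using lattice_cell_iff[OF L, of _ s] by (intro nn_integral_cong) (auto simp: indicator_def)
    also have "\<dots> = G s" by (simp add: nn_integral_cmult_indicator)
    finally show "G s = (\<Sum>\<^sup>+k. G s * indicator (?I k) s)" ..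
  qed
  also have "\<dots> = (\<Sum>\<^sup>+k. (\<integral>\<^sup>+s. G s * indicator (?I k) s \<partial>lborel))"
    by (rule nn_integral_count_space_nn_integral) auto
  also have "\<dots> = (\<Sum>\<^sup>+k. (\<integral>\<^sup>+s. indicator {0..<L} s * G (s + L * of_int k) \<partial>lborel))"
  proof (rule nn_integral_cong)
    fix k :: int
    have "(\<integral>\<^sup>+s. G s * indicator (?I k) s \<partial>lborel)
        = ennreal \<bar>1\<bar> * (\<integral>\<^sup>+s. G (L * of_int k + 1 * s) * indicator (?I k) (L * of_int k + 1 * s) \<partial>lborel)"
      by (intro nn_integral_real_affine) auto
    also have "\<dots> = (\<integral>\<^sup>+s. indicator {0..<L} s * G (s + L * of_int k) \<partial>lborel)"
      by (simp, intro nn_integral_cong) (auto simp: indicator_def algebra_simps)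
    finally show "(\<integral>\<^sup>+s. G s * indicator (?I k) s \<partial>lborel) = (\<integral>\<^sup>+s. indicator {0..<L} s * G (s + L * of_int k) \<partial>lborel)" .
  qed
  also have "\<dots> = (\<integral>\<^sup>+s. (\<Sum>\<^sup>+k. indicator {0..<L} s * G (s + L * of_int k)) \<partial>lborel)"
    by (rule nn_integral_count_space_nn_integral[symmetric]) auto
  also have "\<dots> = (\<integral>\<^sup>+s. indicator {0..<L} s * (\<Sum>\<^sup>+k. G (s + L * of_int k)) \<partial>lborel)"
    by (intro nn_integral_cong nn_integral_cmult) simp
  also have "\<dots> = (\<integral>\<^sup>+s. indicator {0..L} s * (\<Sum>\<^sup>+k. G (s + L * of_int k)) \<partial>lborel)"
  proof (rule nn_integral_cong_AE)
    have "AE s in lborel. s \<notin> {L}" by (rule AE_lborel_countable) simp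
    then show "AE s in lborel. indicator {0..<L} s * (\<Sum>\<^sup>+k. G (s + L * of_int k))
        = indicator {0..L} s * (\<Sum>\<^sup>+k. G (s + L * of_int k))"
      by eventually_elim (auto simp: indicator_def)
  qed
  finally show ?thesis .
qed

section \<open>The Fourier transform of integrable functions\<close>

definition fourier :: "(real \<Rightarrow> complex) \<Rightarrow> real \<Rightarrow> complex" where
  "fourier h s = (LINT t|lborel. h t * cis (- 2 * pi * t * s))"

lemma fourier_bound: "cmod (fourier h s) \<le> (LINT t|lborel. cmod (h t))"
  unfolding fourier_def by (rule order_trans[OF integral_norm_bound]) (simp add: norm_mult)

lemma isCont_fourier:
  assumes h: "integrable lborel h"
  shows "isCont (fourier h) s"
proof (rule continuous_at_sequentiallyI)
  fix u assume u: "u \<longlonglongrightarrow> s"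
  show "(\<lambda>n. fourier h (u n)) \<longlonglongrightarrow> fourier h s"
    unfolding fourier_def
  proof (rule integral_dominated_convergence[where w = "\<lambda>t. cmod (h t)"])
    show "AE t in lborel. (\<lambda>n. h t * cis (- 2 * pi * t * u n)) \<longlonglongrightarrow> h t * cis (- 2 * pi * t * s)"
      using u by (intro AE_I2 tendsto_intros tendsto_cis)
  qed (use h in \<open>auto simp: norm_mult\<close>)
qed

text \<open>Parseval's identity on [-R, R] for the modulations of h, averaged over the modulation.\<close>

lemma plancherel_compact_support:
  assumes cont: "continuous_on UNIV h" and supp: "\<And>t. \<bar>t\<bar> > R \<Longrightarrow> h t = 0" and R: "R > 0"
  shows "(\<integral>\<^sup>+s. nsq (fourier h s) \<partial>lborel) = (\<integral>\<^sup>+t. nsq (h t) \<partial>lborel)"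
    and "integrable lborel h"
proof -
  have hm [measurable]: "h \<in> borel_measurable borel" using cont by (rule borel_measurable_continuous_onI)
  have "set_integrable lborel {-R..R} h"
    by (rule borel_integrable_atLeastAtMost') (rule continuous_on_subset[OF cont], simp)
  moreover have "(\<lambda>t. indicator {-R..R} t *\<^sub>R h t) = h" using supp by (auto simp: indicator_def fun_eq_iff)
  ultimately show int: "integrable lborel h" by (simp add: set_integrable_def)
  have "bounded (h ` {-R..R})"
    by (intro compact_imp_bounded compact_continuous_image continuous_on_subset[OF cont]) auto
  then obtain B where "\<forall>z\<in>h ` {-R..R}. cmod z \<le> B" unfolding bounded_iff by blast
  then have B: "\<And>t. t \<in> {-R..R} \<Longrightarrow> cmod (h t) \<le> B" by blast
  have hb: "cmod (h t) \<le> max B 0" for t 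
  proof (cases "\<bar>t\<bar> > R")
    case False
    then have "t \<in> {-R..R}" by auto
    from B[OF this] show ?thesis by simp
  qed (simp add: supp)
  \<comment> \<open>The length of an interval containing the support: the transform on a translate
    of the lattice of spacing 1/l consists of the Fourier coefficients of a modulation of
    \<open>h\<close>.\<close>
  define l where "l = 2 * R"
  have l: "l > 0" using R by (simp add: l_def)
  have iv: "{-R..-R+l} = {-R..R}" by (simp add: l_def)
  have cell: "(\<Sum>\<^sup>+m::int. nsq (fourier h (\<theta> + 1 / l * of_int m)))
     = ennreal l * (\<integral>\<^sup>+t. nsq (h t) \<partial>lborel)" for \<theta>
  proof -
    define h' where "h' = (\<lambda>t. h t * cis (- 2 * pi * \<theta> * t))"
    have h': "continuous_on UNIV h'" unfolding h'_def by (intro continuous_intros cont)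
    have "(\<Sum>\<^sup>+m::int. nsq (LINT s|lborel. indicator {-R..-R+l} s *\<^sub>R (h' s * cis (- 2 * pi * of_int m * s / l))))
      = ennreal l * (\<integral>\<^sup>+s. indicator {-R..-R+l} s * nsq (h' s) \<partial>lborel)"
    proof (rule parseval_interval[OF l, where X = "{}" and B = "max B 0"])
      show "h' \<in> borel_measurable borel" using h' by (rule borel_measurable_continuous_onI)
      show "cmod (h' s) \<le> max B 0" for s using hb[of s] by (simp add: h'_def norm_mult)
      show "isCont h' s" for s using h' by (simp add: continuous_on_eq_continuous_at)
    qed simp
    moreover have "(LINT s|lborel. indicator {-R..-R+l} s *\<^sub>R (h' s * cis (- 2 * pi * of_int m * s / l))) = fourier h (\<theta> + 1 / l * of_int m)" for m
      unfolding fourier_def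
    proof (intro Bochner_Integration.integral_cong refl)
      fix s
      have "cis (- 2 * pi * \<theta> * s) * cis (- 2 * pi * of_int m * s / l) = cis (- 2 * pi * s * (\<theta> + 1 / l * of_int m))"
        unfolding cis_mult by (simp add: algebra_simps)
      then show "indicator {-R..-R+l} s *\<^sub>R (h' s * cis (- 2 * pi * of_int m * s / l)) = h s * cis (- 2 * pi * s * (\<theta> + 1 / l * of_int m))"
        using supp[of s] unfolding iv h'_def by (auto simp: indicator_def mult.assoc)
    qed
    moreover have "indicator {-R..-R+l} s * nsq (h' s) = nsq (h s)" for s
      using supp[of s] unfolding iv h'_def by (auto simp: indicator_def norm_mult)
    ultimately show ?thesis by simp
  qed
  have Fm: "fourier h \<in> borel_measurable borel"
    by (intro borel_measurable_continuous_onI) (simp add: continuous_on_eq_continuous_at isCont_fourier int)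
  \<comment> \<open>Folding modulo 1/l: the inner sum equals l times the energy for every \<theta>,
    and the cell has length 1/l.\<close>
  have "(\<integral>\<^sup>+s. nsq (fourier h s) \<partial>lborel)
     = (\<integral>\<^sup>+\<theta>. indicator {0..1 / l} \<theta> * (\<Sum>\<^sup>+m::int. nsq (fourier h (\<theta> + 1 / l * of_int m))) \<partial>lborel)"
    using l Fm by (intro nn_integral_fold) auto
  also have "\<dots> = (\<integral>\<^sup>+\<theta>. indicator {0..1 / l} \<theta> * (ennreal l * (\<integral>\<^sup>+t. nsq (h t) \<partial>lborel)) \<partial>lborel)"
    unfolding cell ..
  also have "\<dots> = (ennreal l * (\<integral>\<^sup>+t. nsq (h t) \<partial>lborel)) * ennreal (1 / l)"
    using l by (subst mult.commute) (simp add: nn_integral_cmult_indicator)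
  also have "\<dots> = (ennreal l * ennreal (1 / l)) * (\<integral>\<^sup>+t. nsq (h t) \<partial>lborel)"
    by (simp only: mult_ac)
  also have "ennreal l * ennreal (1 / l) = 1" using l by (simp add: ennreal_mult[symmetric] del: ennreal_1 flip: ennreal_1)
  finally show "(\<integral>\<^sup>+s. nsq (fourier h s) \<partial>lborel) = (\<integral>\<^sup>+t. nsq (h t) \<partial>lborel)" by simp
qed

section \<open>Frame bounds on the Fourier side\<close>

lemma filterlim_symmetric_int_intervals:
  "filterlim (\<lambda>n. {- int n..<int n}) (finite_subsets_at_top UNIV) sequentially"
  unfolding filterlim_finite_subsets_at_top
proof (intro allI impI)
  fix X :: "int set" assume "finite X \<and> X \<subseteq> UNIV"
  then have "bdd_above (abs ` X)" by auto
  then obtain M where M: "\<And>x. x \<in> X \<Longrightarrow> \<bar>x\<bar> \<le> M" by (auto simp: bdd_above_def)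
  show "\<forall>\<^sub>F n in sequentially. finite {- int n..<int n} \<and> X \<subseteq> {- int n..<int n} \<and> {- int n..<int n} \<subseteq> UNIV"
    using eventually_gt_at_top[of "nat M"]
  proof eventually_elim
    case (elim n)
    have "x \<in> {- int n..<int n}" if "x \<in> X" for x using M[OF that] elim by auto
    then show ?case by auto
  qed
qed

text \<open>Replaces an unordered sum by a sequential limit, as measurability of limits and
  dominated convergence require.\<close>

lemma symmetric_partial_sums:
  fixes f :: "int \<Rightarrow> 'a::{topological_comm_monoid_add, t2_space}"
  assumes "f summable_on UNIV"
  shows "(\<lambda>n. \<Sum>k\<in>{- int n..<int n}. f k) \<longlonglongrightarrow> infsum f UNIV"
  using filterlim_compose[OF _ filterlim_symmetric_int_intervals] has_sum_infsum[OF assms]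
  unfolding has_sum_def by blast

lemma measurable_nn_integral_int:
  fixes f :: "'a \<Rightarrow> int \<Rightarrow> ennreal"
  assumes "\<And>n. (\<lambda>s. f s n) \<in> borel_measurable M"
  shows "(\<lambda>s. \<integral>\<^sup>+n. f s n \<partial>count_space UNIV) \<in> borel_measurable M"
proof -
  interpret sigma_finite_measure "count_space (UNIV :: int set)"
    by (rule sigma_finite_measure_count_space)
  have "(\<lambda>(s, n). f s n) \<in> borel_measurable (M \<Otimes>\<^sub>M count_space UNIV)"
    unfolding case_prod_beta'
    by (rule measurable_compose_countable'[where f = "\<lambda>n x. f (fst x) n" and g = snd and I = UNIV])
       (auto intro: measurable_compose[OF measurable_fst assms])
  then show ?thesis by (rule borel_measurable_nn_integral)
qed

section \<open>Periodization and its Fourier coefficients\<close>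

locale periodizable =
  fixes \<psi> :: "real \<Rightarrow> complex" and L M :: real
  assumes L: "L > 0" and meas [measurable]: "\<psi> \<in> borel_measurable borel"
    and summable: "\<And>s. (\<lambda>k. norm (\<psi> (s + L * of_int k))) summable_on (UNIV :: int set)"
    and bound: "\<And>s. (\<Sum>\<^sub>\<infinity>k::int. norm (\<psi> (s + L * of_int k))) \<le> M"
begin

definition periodization :: "real \<Rightarrow> complex" where
  "periodization s = (\<Sum>\<^sub>\<infinity>k::int. \<psi> (s + L * of_int k))"

definition partial :: "nat \<Rightarrow> real \<Rightarrow> complex" where
  "partial n s = (\<Sum>k\<in>{- int n..<int n}. \<psi> (s + L * of_int k))"

lemma partial_tendsto: "(\<lambda>n. partial n s) \<longlonglongrightarrow> periodization s"
  unfolding partial_def periodization_def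
  by (rule symmetric_partial_sums[OF abs_summable_summable[OF summable]])

lemma partial_bound: "cmod (partial n s) \<le> M"
proof -
  have "cmod (partial n s) \<le> (\<Sum>k\<in>{- int n..<int n}. cmod (\<psi> (s + L * of_int k)))"
    unfolding partial_def by (rule norm_sum)
  also have "\<dots> \<le> (\<Sum>\<^sub>\<infinity>k::int. norm (\<psi> (s + L * of_int k)))"
    by (intro finite_sum_le_infsum summable) auto
  finally show ?thesis using bound[of s] by linarith
qed

lemma periodization_bound: "cmod (periodization s) \<le> M"
  unfolding periodization_def using norm_infsum_bound[OF summable[of s]] bound[of s] by linarith

lemma measurable_partial [measurable]: "partial n \<in> borel_measurable borel"
  unfolding partial_def by measurable

lemma measurable_periodization [measurable]: "periodization \<in> borel_measurable borel"
  by (rule borel_measurable_LIMSEQ_metric[OF measurable_partial partial_tendsto])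

lemma integrable_psi: "integrable lborel \<psi>"
proof (rule integrableI_bounded)
  have "(\<integral>\<^sup>+s. ennreal (norm (\<psi> s)) \<partial>lborel)
     = (\<integral>\<^sup>+s. indicator {0..L} s * (\<Sum>\<^sup>+k::int. ennreal (norm (\<psi> (s + L * of_int k)))) \<partial>lborel)"
    by (rule nn_integral_fold[OF L]) measurable
  also have "\<dots> \<le> (\<integral>\<^sup>+s. ennreal M * indicator {0..L} s \<partial>lborel)"
    using nn_integral_count_space_infsum[OF summable] bound
    by (intro nn_integral_mono) (auto simp: indicator_def ennreal_leI)
  also have "\<dots> = ennreal M * ennreal L" using L by (simp add: nn_integral_cmult_indicator)
  also have "\<dots> < \<infinity>" by (simp add: ennreal_mult_less_top)
  finally show "(\<integral>\<^sup>+s. ennreal (norm (\<psi> s)) \<partial>lborel) < \<infinity>" .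
qed simp

text \<open>The complex counterpart of \<open>nn_integral_fold\<close>. Finitely many cells are
  folded by translation; the limit is dominated by |\<psi>| on the unfolded side and by the constant
  \<open>M\<close> on one cell on the folded side.\<close>

lemma integral_fold:
  assumes e [measurable]: "e \<in> borel_measurable borel" and e1: "\<And>s. cmod (e s) \<le> 1"
    and per: "\<And>s k. e (s + L * of_int (k::int)) = e s"
  shows "(LINT s|lborel. \<psi> s * e s) = (LINT s|lborel. indicator {0..L} s *\<^sub>R (periodization s * e s))"
proof -
  let ?I = "\<lambda>k::int. {L * of_int k..<L * of_int (k + 1)}"
  let ?g = "\<lambda>n s. \<Sum>k\<in>{- int n..<int n}. indicator (?I k) s *\<^sub>R (\<psi> s * e s)"
  have M0: "M \<ge> 0" using periodization_bound[of 0] norm_ge_zero order_trans by blast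
  have int: "integrable lborel (\<lambda>s. \<psi> s * e s)"
    by (rule Bochner_Integration.integrable_bound[OF integrable_psi])
       (auto simp: norm_mult intro!: mult_right_le_one_le e1)
  have g_eq: "?g n s = (if \<lfloor>s / L\<rfloor> \<in> {- int n..<int n} then \<psi> s * e s else 0)" for n s
  proof -
    have "?g n s = (\<Sum>k\<in>{- int n..<int n}. if k = \<lfloor>s / L\<rfloor> then \<psi> s * e s else 0)"
      using lattice_cell_iff[OF L, of _ s] by (intro sum.cong) (auto simp: indicator_def)
    then show ?thesis by simp
  qed
  have lim1: "(\<lambda>n. LINT s|lborel. ?g n s) \<longlonglongrightarrow> (LINT s|lborel. \<psi> s * e s)"
  proof (rule integral_dominated_convergence[where w = "\<lambda>s. norm (\<psi> s * e s)"])
    show "AE s in lborel. (\<lambda>n. ?g n s) \<longlonglongrightarrow> \<psi> s * e s"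
    proof (intro AE_I2 tendsto_eventually)
      fix s
      show "\<forall>\<^sub>F n in sequentially. ?g n s = \<psi> s * e s"
        using eventually_gt_at_top[of "nat \<bar>\<lfloor>s / L\<rfloor>\<bar>"]
        unfolding g_eq by eventually_elim auto
    qed
    show "AE s in lborel. norm (?g n s) \<le> norm (\<psi> s * e s)" for n
      unfolding g_eq by (intro AE_I2) auto
    show "?g n \<in> borel_measurable lborel" for n by measurable
    show "(\<lambda>s. \<psi> s * e s) \<in> borel_measurable lborel" by measurable
    show "integrable lborel (\<lambda>s. norm (\<psi> s * e s))" using int by (rule integrable_norm)
  qed
  have part: "(LINT s|lborel. ?g n s) = (LINT s|lborel. indicator {0..<L} s *\<^sub>R (partial n s * e s))" for n
  proof -
    have ik: "integrable lborel (\<lambda>s. indicator (?I k) s *\<^sub>R (\<psi> s * e s))" for k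
      using int by (intro integrable_mult_indicator) auto
    have cell: "(LINT s|lborel. indicator (?I k) s *\<^sub>R (\<psi> s * e s))
        = (LINT s|lborel. indicator {0..<L} s *\<^sub>R (\<psi> (s + L * of_int k) * e s))" for k
    proof -
      have "(LINT s|lborel. indicator (?I k) s *\<^sub>R (\<psi> s * e s))
         = \<bar>1\<bar> *\<^sub>R (LINT s|lborel. indicator (?I k) (L * of_int k + 1 * s) *\<^sub>R (\<psi> (L * of_int k + 1 * s) * e (L * of_int k + 1 * s)))"
        by (rule lborel_integral_real_affine) simp
      also have "\<dots> = (LINT s|lborel. indicator {0..<L} s *\<^sub>R (\<psi> (s + L * of_int k) * e s))"
        using per[of _ k]
        by (simp, intro Bochner_Integration.integral_cong) (auto simp: indicator_def algebra_simps)
      finally show ?thesis .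
    qed
    have ik': "integrable lborel (\<lambda>s. indicator {0..<L} s *\<^sub>R (\<psi> (s + L * of_int k) * e s))" for k
    proof -
      have "integrable lborel (\<lambda>s. \<psi> (L * of_int k + 1 * s))"
        using integrable_psi by (rule lborel_integrable_real_affine) simp
      then have "integrable lborel (\<lambda>s. \<psi> (s + L * of_int k))" by (simp add: add.commute)
      then have "integrable lborel (\<lambda>s. \<psi> (s + L * of_int k) * e s)"
        by (rule Bochner_Integration.integrable_bound) (auto simp: norm_mult intro!: mult_right_le_one_le e1)
      then show ?thesis by (intro integrable_mult_indicator) auto
    qed
    have "(LINT s|lborel. ?g n s) = (\<Sum>k\<in>{- int n..<int n}. LINT s|lborel. indicator {0..<L} s *\<^sub>R (\<psi> (s + L * of_int k) * e s))"
      using ik by (simp only: Bochner_Integration.integral_sum cell)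
    also have "\<dots> = (LINT s|lborel. (\<Sum>k\<in>{- int n..<int n}. indicator {0..<L} s *\<^sub>R (\<psi> (s + L * of_int k) * e s)))"
      using ik' by (simp only: Bochner_Integration.integral_sum)
    also have "\<dots> = (LINT s|lborel. indicator {0..<L} s *\<^sub>R (partial n s * e s))"
      by (simp add: partial_def sum_distrib_right scaleR_sum_right)
    finally show ?thesis .
  qed
  have lim2: "(\<lambda>n. LINT s|lborel. indicator {0..<L} s *\<^sub>R (partial n s * e s))
      \<longlonglongrightarrow> (LINT s|lborel. indicator {0..<L} s *\<^sub>R (periodization s * e s))"
  proof (rule integral_dominated_convergence[where w = "\<lambda>s. M * indicator {0..<L} s"])
    show "AE s in lborel. (\<lambda>n. indicator {0..<L} s *\<^sub>R (partial n s * e s)) \<longlonglongrightarrow> indicator {0..<L} s *\<^sub>R (periodization s * e s)"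
      by (intro AE_I2 tendsto_intros partial_tendsto)
    show "AE s in lborel. norm (indicator {0..<L} s *\<^sub>R (partial n s * e s)) \<le> M * indicator {0..<L} s" for n
    proof (intro AE_I2)
      fix s
      have "cmod (partial n s) * cmod (e s) \<le> M * 1" using partial_bound e1 M0 by (intro mult_mono) auto
      then show "norm (indicator {0..<L} s *\<^sub>R (partial n s * e s)) \<le> M * indicator {0..<L} s"
        by (simp add: indicator_def norm_mult)
    qed
    show "integrable lborel (\<lambda>s. M * indicator {0..<L} s)"
      using L by (intro integrable_mult_right integrable_real_indicator) auto
  qed auto
  have "(LINT s|lborel. \<psi> s * e s) = (LINT s|lborel. indicator {0..<L} s *\<^sub>R (periodization s * e s))"
    using lim1 lim2 unfolding part by (rule LIMSEQ_unique)
  also have "\<dots> = (LINT s|lborel. indicator {0..L} s *\<^sub>R (periodization s * e s))"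
  proof (rule integral_cong_AE)
    have "AE s in lborel. s \<notin> {L}" by (rule AE_lborel_countable) simp
    then show "AE s in lborel. indicator {0..<L} s *\<^sub>R (periodization s * e s) = indicator {0..L} s *\<^sub>R (periodization s * e s)"
      by eventually_elim (auto simp: indicator_def)
  qed auto
  finally show ?thesis .
qed

text \<open>The Fourier coefficients of the periodization are the values of the transform of
  \<open>\<psi>\<close> at the points m/L, since the characters involved have period
  \<open>L\<close>.\<close>

lemma parseval_periodization:
  assumes X: "countable X" and cont: "\<And>s. 0 < s \<Longrightarrow> s < L \<Longrightarrow> s \<notin> X \<Longrightarrow> isCont periodization s"
  shows "(\<Sum>\<^sup>+m::int. nsq (LINT s|lborel. \<psi> s * cis (- 2 * pi * of_int m * s / L)))
     = ennreal L * (\<integral>\<^sup>+s. indicator {0..L} s * nsq (periodization s) \<partial>lborel)"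
proof -
  have "(LINT s|lborel. \<psi> s * cis (- 2 * pi * of_int m * s / L))
      = (LINT s|lborel. indicator {0..0+L} s *\<^sub>R (periodization s * cis (- 2 * pi * of_int m * s / L)))" for m
  proof -
    have "cis (- 2 * pi * of_int m * (s + L * of_int k) / L) = cis (- 2 * pi * of_int m * s / L)" for s and k :: int
    proof -
      have "- 2 * pi * of_int m * (s + L * of_int k) / L = - 2 * pi * of_int m * s / L + 2 * pi * of_int (- m * k)"
        using L by (simp add: field_simps)
      then have "cis (- 2 * pi * of_int m * (s + L * of_int k) / L) = cis (- 2 * pi * of_int m * s / L) * cis (2 * pi * of_int (- m * k))"
        by (simp only: cis_mult)
      then show ?thesis by (simp only: cis_multiple_2pi Ints_of_int mult_1_right)
    qed
    then show ?thesis unfolding add_0 by (intro integral_fold) auto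
  qed
  then show ?thesis
    using parseval_interval[OF L measurable_periodization periodization_bound X, of 0] cont by simp
qed

end

context exp_sampling begin

section \<open>Decomposition into fibres indexed by the offset\<close>

lemma isCont_phi0: assumes "t \<noteq> 0" shows "isCont phi0 t"
proof -
  have c: "isCont phi t" unfolding phi_def by (intro continuous_intros)
  show ?thesis
  proof (cases "t > 0")
    case True
    have "\<forall>\<^sub>F u in nhds t. phi0 u = phi u"
      using eventually_nhds_in_open[OF open_greaterThan[of 0], of t] True
      by (auto elim!: eventually_mono simp: phi0_def)
    with c show ?thesis by (subst isCont_cong)
  next
    case False
    have "\<forall>\<^sub>F u in nhds t. phi0 u = 0"
      using eventually_nhds_in_open[OF open_lessThan[of 0], of t] False assms
      by (auto elim!: eventually_mono simp: phi0_def)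
    then show ?thesis by (subst isCont_cong) auto
  qed
qed

lemma measurable_phi0 [measurable]: "phi0 \<in> borel_measurable borel"
proof -
  have [measurable]: "phi \<in> borel_measurable borel"
    unfolding phi_def by (intro borel_measurable_continuous_onI continuous_intros)
  show ?thesis unfolding phi0_def by measurable
qed

text \<open>For a fixed sample time \<open>T\<close>, the function phi0(T - s) F(s) periodizes to
  the filter output at \<open>T\<close> for offset s and impulses F(s + L k). Thus the sum over
  \<open>m\<close> becomes an integral over offsets.\<close>

lemma fiber_identity:
  assumes F: "\<And>s. isCont F s" and FB: "\<And>s. cmod (F s) \<le> FB"
  shows "(\<Sum>\<^sup>+m::int. nsq (LINT s|lborel. phi0 (T - s) * F s * cis (- 2 * pi * of_int m * s / L)))
     = ennreal L * (\<integral>\<^sup>+s. indicator {0..L} s * nsq (out s (\<lambda>k. F (s + L * of_int k)) T) \<partial>lborel)"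
proof (rule phi0_decay)
  fix C \<rho> :: real assume C: "C > 0" and rho: "\<rho> > 0" and dec: "\<And>t. cmod (phi0 t) \<le> C * exp (- \<rho> * \<bar>t\<bar>)"
  have FB0: "FB \<ge> 0" using FB[of 0] norm_ge_zero order_trans by blast
  have Fm [measurable]: "F \<in> borel_measurable borel"
    by (intro borel_measurable_continuous_onI) (simp add: continuous_on_eq_continuous_at F)
  define \<psi> where "\<psi> = (\<lambda>s. phi0 (T - s) * F s)"
  show ?thesis
  proof (rule exp_lattice_sum_bound[OF rho L_pos])
    fix K assume K: "K > 0" "\<And>a. (\<lambda>n::int. exp (- \<rho> * \<bar>L * of_int n - a\<bar>)) summable_on UNIV"
      "\<And>a. (\<Sum>\<^sub>\<infinity>n::int. exp (- \<rho> * \<bar>L * of_int n - a\<bar>)) \<le> K"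
    have psi_le: "cmod (\<psi> (s + L * of_int k)) \<le> C * FB * exp (- \<rho> * \<bar>L * of_int k - (T - s)\<bar>)" for s and k :: int
    proof -
      have "cmod (\<psi> (s + L * of_int k)) \<le> (C * exp (- \<rho> * \<bar>T - (s + L * of_int k)\<bar>)) * FB"
        unfolding \<psi>_def norm_mult using FB dec C by (intro mult_mono) auto
      also have "\<bar>T - (s + L * of_int k)\<bar> = \<bar>L * of_int k - (T - s)\<bar>" by (simp add: abs_minus_commute algebra_simps)
      finally show ?thesis by (simp add: mult_ac)
    qed
    have maj: "(\<lambda>k::int. C * FB * exp (- \<rho> * \<bar>L * of_int k - (T - s)\<bar>)) summable_on UNIV" for s
      by (intro summable_on_cmult_right K)
    interpret periodizable \<psi> L "C * FB * K"
    proof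
      show "L > 0" by (rule L_pos)
      show "\<psi> \<in> borel_measurable borel" unfolding \<psi>_def by measurable
      show sm: "(\<lambda>k. norm (\<psi> (s + L * of_int k))) summable_on (UNIV :: int set)" for s
        by (rule summable_on_comparison_test[OF maj[of s]]) (use psi_le in auto)
      show "(\<Sum>\<^sub>\<infinity>k::int. norm (\<psi> (s + L * of_int k))) \<le> C * FB * K" for s
      proof -
        have "(\<Sum>\<^sub>\<infinity>k::int. norm (\<psi> (s + L * of_int k))) \<le> (\<Sum>\<^sub>\<infinity>k::int. C * FB * exp (- \<rho> * \<bar>L * of_int k - (T - s)\<bar>))"
          by (intro infsum_mono sm maj psi_le)
        also have "\<dots> = C * FB * (\<Sum>\<^sub>\<infinity>k::int. exp (- \<rho> * \<bar>L * of_int k - (T - s)\<bar>))" by (rule infsum_cmult_right')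
        also have "\<dots> \<le> C * FB * K" using C FB0 K(3) by (intro mult_left_mono) auto
        finally show ?thesis .
      qed
    qed
    have per: "periodization s = out s (\<lambda>k. F (s + L * of_int k)) T" for s
      unfolding periodization_def out_def by (simp add: \<psi>_def add.commute)
    \<comment> \<open>The offsets for which \<open>T\<close> is itself an impulse time; only there
      can the jump of \<open>phi0\<close> at 0 break continuity.\<close>
    define X where "X = {u. (T - u) / L \<in> \<int>}"
    have "X = (\<lambda>k. T - L * of_int k) ` (UNIV :: int set)"
      using L_pos by (auto simp: X_def Ints_def image_iff field_simps)
    then have cX: "countable X" by simp
    have clX: "closed X"
      unfolding X_def using L_pos by (intro closed_vimage[OF closed_Ints, unfolded vimage_def] continuous_intros) auto
    have "isCont periodization s" if s: "0 < s" "s < L" "s \<notin> X" for s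
    proof -
      define Y where "Y = {0<..<L} - X"
      have Y: "open Y" "s \<in> Y" using clX s by (auto simp: Y_def)
      \<comment> \<open>Moving the centre from T - u to T costs at most exp(\<rho> L), as u lies in
        (0, L). The resulting majorant is independent of u, so the series converges uniformly on
        \<open>Y\<close>.\<close>
      have M: "cmod (\<psi> (u + L * of_int k)) \<le> C * FB * exp (\<rho> * L) * exp (- \<rho> * \<bar>L * of_int k - T\<bar>)" if "u \<in> Y" for u k
      proof -
        have "\<bar>L * of_int k - T\<bar> - L \<le> \<bar>L * of_int k - (T - u)\<bar>" using that by (auto simp: Y_def)
        then have "- \<rho> * \<bar>L * of_int k - (T - u)\<bar> \<le> \<rho> * L + - \<rho> * \<bar>L * of_int k - T\<bar>"
          using mult_left_mono[of "\<bar>L * of_int k - T\<bar> - L" "\<bar>L * of_int k - (T - u)\<bar>" \<rho>] rho by (simp add: algebra_simps)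
        then have "exp (- \<rho> * \<bar>L * of_int k - (T - u)\<bar>) \<le> exp (\<rho> * L) * exp (- \<rho> * \<bar>L * of_int k - T\<bar>)"
          unfolding exp_add[symmetric] by simp
        then have "C * FB * exp (- \<rho> * \<bar>L * of_int k - (T - u)\<bar>) \<le> C * FB * (exp (\<rho> * L) * exp (- \<rho> * \<bar>L * of_int k - T\<bar>))"
          using C FB0 by (intro mult_left_mono) auto
        then show ?thesis using psi_le[of u k] by (simp only: mult.assoc)
      qed
      have "uniform_limit Y (\<lambda>A u. \<Sum>k\<in>A. \<psi> (u + L * of_int k)) (\<lambda>u. \<Sum>\<^sub>\<infinity>k. \<psi> (u + L * of_int k)) (finite_subsets_at_top (UNIV :: int set))"
      proof (rule Weierstrass_m_test_general[where M = "\<lambda>k. C * FB * exp (\<rho> * L) * exp (- \<rho> * \<bar>L * of_int k - T\<bar>)"])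
        show "(\<lambda>k::int. C * FB * exp (\<rho> * L) * exp (- \<rho> * \<bar>L * of_int k - T\<bar>)) summable_on UNIV"
          by (intro summable_on_cmult_right K)
      qed (use M in auto)
      moreover have "continuous_on Y (\<lambda>u. \<Sum>k\<in>A. \<psi> (u + L * of_int k))" for A :: "int set"
      proof (intro continuous_on_sum)
        fix k :: int
        have "isCont (\<lambda>u. \<psi> (u + L * of_int k)) u" if u: "u \<in> Y" for u
        proof -
          have "T - (u + L * of_int k) \<noteq> 0"
          proof
            assume "T - (u + L * of_int k) = 0"
            then have "(T - u) / L = of_int k" using L_pos by (simp add: field_simps)
            then show False using u by (simp add: Y_def X_def)
          qed
          then have "isCont phi0 (T - (u + L * of_int k))" by (rule isCont_phi0)
          then have "isCont (\<lambda>u. phi0 (T - (u + L * of_int k))) u"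
            by (rule isCont_o2[rotated]) (intro continuous_intros)
          moreover have "isCont (\<lambda>u. F (u + L * of_int k)) u"
            by (rule isCont_o2[OF _ F]) (intro continuous_intros)
          ultimately show ?thesis unfolding \<psi>_def by (rule isCont_mult)
        qed
        then show "continuous_on Y (\<lambda>u. \<psi> (u + L * of_int k))"
          by (simp add: continuous_at_imp_continuous_on)
      qed
      ultimately have "continuous_on Y periodization"
        unfolding periodization_def[abs_def]
        by (intro uniform_limit_theorem[of _ _ "finite_subsets_at_top UNIV"]) (auto intro!: always_eventually)
      then show ?thesis using Y continuous_on_eq_continuous_at by blast
    qed
    from parseval_periodization[OF cX this] show ?thesis unfolding per unfolding \<psi>_def by simp
  qed
qed

text \<open>When \<open>F\<close> is the transform of the conjugate of f, the inner integrals have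
  the moduli of the Gabor coefficients of f, with both indices negated.\<close>

definition analysis_energy :: "(real \<Rightarrow> complex) \<Rightarrow> ennreal" where
  "analysis_energy F = (\<Sum>\<^sup>+n::int. (\<Sum>\<^sup>+m::int. nsq (LINT s|lborel. phi0 (b * of_int n - s) * F s * cis (- 2 * pi * of_int m * s / L))))"

text \<open>The sampling inequalities are applied to the fibre k -> F(s + L k) with offset s and
  then integrated over s in [0, L]. This needs constants uniform in the offset; boundedness of
  \<open>F\<close> makes every fibre a bounded sequence.\<close>

lemma frame_bounds_fourier_side:
  assumes irr: "L / b \<notin> \<rat>"
  shows "\<exists>C1>0. \<exists>C2>0. \<forall>F. (\<forall>s. isCont F s) \<and> bounded (range F) \<longrightarrow>
     (\<integral>\<^sup>+s. nsq (F s) \<partial>lborel) \<le> ennreal C1 * analysis_energy F \<and>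
     analysis_energy F \<le> ennreal C2 * (\<integral>\<^sup>+s. nsq (F s) \<partial>lborel)"
proof -
  obtain C1 where C1: "C1 > 0" and lower: "\<And>d x. bounded (range x) \<Longrightarrow>
     (\<Sum>\<^sup>+k. nsq (x k))
       \<le> ennreal C1 * (\<Sum>\<^sup>+n::int. nsq (out d x (b * of_int n)))"
    using sampling_lower_bound[OF irr] by blast
  obtain C2 where C2: "C2 > 0" and upper: "\<And>d x. bounded (range x) \<Longrightarrow>
     (\<Sum>\<^sup>+n::int. nsq (out d x (b * of_int n)))
       \<le> ennreal C2 * (\<Sum>\<^sup>+k. nsq (x k))"
    using sampling_upper_bound by blast
  have "(\<integral>\<^sup>+s. nsq (F s) \<partial>lborel) \<le> ennreal (C1 / L) * analysis_energy F \<and>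
     analysis_energy F \<le> ennreal (L * C2) * (\<integral>\<^sup>+s. nsq (F s) \<partial>lborel)"
    if F: "\<And>s. isCont F s" and bF: "bounded (range F)" for F
  proof -
    obtain FB where FB: "\<And>s. cmod (F s) \<le> FB" using bF by (auto simp: bounded_iff)
    have Fm [measurable]: "F \<in> borel_measurable borel"
      by (intro borel_measurable_continuous_onI) (simp add: continuous_on_eq_continuous_at F)
    let ?x = "\<lambda>s k. F (s + L * of_int k)"
    let ?S = "\<lambda>s. (\<Sum>\<^sup>+n::int. nsq (out s (?x s) (b * of_int n)))"
    let ?E = "\<lambda>s. (\<Sum>\<^sup>+k::int. nsq (?x s k))"
    have bx: "bounded (range (?x s))" for s using bF by (rule bounded_subset) auto
    \<comment> \<open>Offset and impulses vary together with s here; measurability comes from the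
      limit of finite symmetric sums.\<close>
    have out_m [measurable]: "(\<lambda>s. out s (?x s) T) \<in> borel_measurable borel" for T
    proof -
      have "(\<lambda>n. \<Sum>k\<in>{- int n..<int n}. phi0 (T - (L * of_int k + s)) * ?x s k) \<longlonglongrightarrow> out s (?x s) T" for s
        unfolding out_def by (rule symmetric_partial_sums[OF abs_summable_summable[OF out_summable[OF bx]]])
      moreover have "(\<lambda>s. \<Sum>k\<in>{- int n..<int n}. phi0 (T - (L * of_int k + s)) * ?x s k) \<in> borel_measurable borel" for n
        by measurable
      ultimately show ?thesis by (rule borel_measurable_LIMSEQ_metric[rotated])
    qed
    have E: "(\<integral>\<^sup>+s. nsq (F s) \<partial>lborel) = (\<integral>\<^sup>+s. indicator {0..L} s * ?E s \<partial>lborel)"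
      by (rule nn_integral_fold[OF L_pos]) measurable
    have A: "analysis_energy F = ennreal L * (\<integral>\<^sup>+s. indicator {0..L} s * ?S s \<partial>lborel)"
    proof -
      have "analysis_energy F = (\<Sum>\<^sup>+n::int. ennreal L * (\<integral>\<^sup>+s. indicator {0..L} s * nsq (out s (?x s) (b * of_int n)) \<partial>lborel))"
        unfolding analysis_energy_def fiber_identity[OF F FB] ..
      also have "\<dots> = ennreal L * (\<Sum>\<^sup>+n::int. (\<integral>\<^sup>+s. indicator {0..L} s * nsq (out s (?x s) (b * of_int n)) \<partial>lborel))"
        by (rule nn_integral_cmult) simp
      also have "(\<Sum>\<^sup>+n::int. (\<integral>\<^sup>+s. indicator {0..L} s * nsq (out s (?x s) (b * of_int n)) \<partial>lborel))
         = (\<integral>\<^sup>+s. (\<Sum>\<^sup>+n::int. indicator {0..L} s * nsq (out s (?x s) (b * of_int n))) \<partial>lborel)"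
        by (rule nn_integral_count_space_nn_integral[symmetric]) auto
      also have "\<dots> = (\<integral>\<^sup>+s. indicator {0..L} s * ?S s \<partial>lborel)"
        by (intro nn_integral_cong nn_integral_cmult) simp
      finally show ?thesis .
    qed
    have S_m: "(\<lambda>s. indicator {0..L} s * ?S s) \<in> borel_measurable lborel"
      by (intro borel_measurable_times_ennreal borel_measurable_indicator measurable_nn_integral_int) auto
    have E_m: "(\<lambda>s. indicator {0..L} s * ?E s) \<in> borel_measurable lborel"
      by (intro borel_measurable_times_ennreal borel_measurable_indicator measurable_nn_integral_int) auto
    have "(\<integral>\<^sup>+s. indicator {0..L} s * ?E s \<partial>lborel) \<le> (\<integral>\<^sup>+s. ennreal C1 * (indicator {0..L} s * ?S s) \<partial>lborel)"
      using lower[OF bx] by (intro nn_integral_mono) (auto simp: indicator_def)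
    also have "\<dots> = ennreal C1 * (\<integral>\<^sup>+s. indicator {0..L} s * ?S s \<partial>lborel)"
      by (rule nn_integral_cmult[OF S_m])
    also have "ennreal C1 = ennreal (C1 / L) * ennreal L"
      using L_pos C1 by (simp add: ennreal_mult[symmetric])
    finally have 1: "(\<integral>\<^sup>+s. nsq (F s) \<partial>lborel) \<le> ennreal (C1 / L) * analysis_energy F"
      unfolding A E by (simp only: mult.assoc)
    have "(\<integral>\<^sup>+s. indicator {0..L} s * ?S s \<partial>lborel) \<le> (\<integral>\<^sup>+s. ennreal C2 * (indicator {0..L} s * ?E s) \<partial>lborel)"
      using upper[OF bx] by (intro nn_integral_mono) (auto simp: indicator_def)
    also have "\<dots> = ennreal C2 * (\<integral>\<^sup>+s. indicator {0..L} s * ?E s \<partial>lborel)"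
      by (rule nn_integral_cmult[OF E_m])
    finally have 2: "analysis_energy F \<le> ennreal (L * C2) * (\<integral>\<^sup>+s. nsq (F s) \<partial>lborel)"
      unfolding A E using L_pos C2 by (simp add: ennreal_mult mult.assoc mult_left_mono)
    from 1 2 show ?thesis ..
  qed
  then show ?thesis using C1 C2 L_pos by (intro exI[of _ "C1 / L"] conjI exI[of _ "L * C2"]) auto
qed

end

section \<open>The Fourier transform of the Cauchy kernel\<close>

text \<open>The height sqrt R of the rectangle makes the vertical sides and the bottom side negligible.\<close>

lemma Cauchy_kernel_rectangle:
  fixes w :: complex
  assumes w: "Re w < 0" and xi: "\<xi> > 0" and R: "sqrt R > cmod w" "R \<ge> 1"
  shows "cmod (integral {-R..R} (\<lambda>t. 1 / (complex_of_real t - \<i> * w) * cis (- 2 * pi * t * \<xi>)) + 2 * pi * \<i> * exp (2 * pi * w * \<xi>))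
     \<le> 2 * sqrt R / (R - cmod w) + 2 * R * exp (- 2 * pi * \<xi> * sqrt R) / (sqrt R - cmod w)"
proof -
  \<comment> \<open>The pole. It lies below the real axis because Re w < 0, and for \<xi> > 0 the
    exponential decays downwards, so the contour is closed in the lower half plane.\<close>
  define p where "p = \<i> * w"
  have p: "Re p = - Im w" "Im p = Re w" by (auto simp: p_def)
  have pn: "cmod p = cmod w" by (simp add: p_def norm_mult)
  have sR: "sqrt R \<le> R" using R(2) real_sqrt_le_mono[of R "R * R"] by simp
  then have Rw: "R > cmod w" using R by linarith
  define a1 where "a1 = Complex (-R) (- sqrt R)"
  define a2 where "a2 = Complex R (- sqrt R)"
  define a3 where "a3 = Complex R 0"
  define a4 where "a4 = Complex (-R) 0"
  define f where "f = (\<lambda>z. exp (- 2 * pi * \<i> * z * \<xi>))"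
  define h where "h = (\<lambda>z. f z / (z - p))"
  have sR0: "sqrt R > 0" using R(2) by simp
  have rect: "rectpath a1 a3 = linepath a1 a2 +++ linepath a2 a3 +++ linepath a3 a4 +++ linepath a4 a1"
    by (simp add: rectpath_def a1_def a2_def a3_def a4_def Let_def)
  have pbox: "p \<in> box a1 a3"
    using w R Rw abs_Re_le_cmod[of p] abs_Im_le_cmod[of p] pn p
    by (auto simp: in_box_complex_iff a1_def a3_def)
  have img: "path_image (rectpath a1 a3) \<subseteq> UNIV - {p}"
    using path_image_rectpath_inter_box[of a1 a3] pbox R(2) sR0 by (auto simp: a1_def a3_def)
  have "((\<lambda>z. f z / (z - p)) has_contour_integral (2 * pi * \<i> * winding_number (rectpath a1 a3) p * f p)) (rectpath a1 a3)"
    by (rule Cauchy_integral_formula_convex_simple[where S = UNIV])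
       (use img in \<open>auto simp: f_def intro!: holomorphic_intros\<close>)
  also have "winding_number (rectpath a1 a3) p = 1" by (rule winding_number_rectpath[OF pbox])
  finally have total: "(h has_contour_integral (2 * pi * \<i> * f p)) (rectpath a1 a3)" by (simp add: h_def)
  have fp: "f p = exp (2 * pi * w * \<xi>)" by (simp add: f_def p_def algebra_simps)
  have seg: "closed_segment x y \<subseteq> path_image (rectpath a1 a3)"
    if "(x, y) \<in> {(a1,a2),(a2,a3),(a3,a4),(a4,a1)}" for x y
    using that unfolding rect by (auto simp: path_image_join)
  have hc: "continuous_on (closed_segment x y) h"
    if "(x, y) \<in> {(a1,a2),(a2,a3),(a3,a4),(a4,a1)}" for x y
    unfolding h_def f_def using seg[OF that] img by (intro continuous_intros) auto
  then have hi: "(h has_contour_integral contour_integral (linepath x y) h) (linepath x y)"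
    if "(x, y) \<in> {(a1,a2),(a2,a3),(a3,a4),(a4,a1)}" for x y
    using that by (intro has_contour_integral_integral contour_integrable_continuous_linepath) blast
  define I where "I = (\<lambda>x y. contour_integral (linepath x y) h)"
  have "(h has_contour_integral (I a1 a2 + (I a2 a3 + (I a3 a4 + I a4 a1)))) (rectpath a1 a3)"
    unfolding rect I_def by (intro has_contour_integral_join hi valid_path_join) auto
  then have sumI: "I a1 a2 + (I a2 a3 + (I a3 a4 + I a4 a1)) = 2 * pi * \<i> * f p"
    using total has_contour_integral_unique by blast
  have f_norm: "cmod (f z) = exp (2 * pi * \<xi> * Im z)" for z
    by (simp add: f_def)
  \<comment> \<open>The counterclockwise rectangle runs along the real axis from right to left; this
    produces the minus sign of the transform.\<close>
  have top: "I a3 a4 = - integral {-R..R} (\<lambda>t. 1 / (complex_of_real t - \<i> * w) * cis (- 2 * pi * t * \<xi>))"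
  proof -
    have "I a3 a4 = - I a4 a3"
      unfolding I_def using contour_integral_reversepath[of "linepath a4 a3" h] by simp
    also have "I a4 a3 = integral {Re a4..Re a3} (\<lambda>x. h (of_real x))"
      unfolding I_def using R(2) by (intro contour_integral_linepath_Reals_eq) (auto simp: a3_def a4_def complex_is_Real_iff)
    also have "(\<lambda>x. h (of_real x)) = (\<lambda>t. 1 / (complex_of_real t - \<i> * w) * cis (- 2 * pi * t * \<xi>))"
      by (auto simp: h_def f_def p_def cis_conv_exp fun_eq_iff algebra_simps)
    finally show ?thesis by (simp add: a3_def a4_def)
  qed
  have side: "cmod (I x y) \<le> 1 / (R - cmod w) * sqrt R"
    if xy: "(x, y) = (a2, a3) \<or> (x, y) = (a4, a1)" for x y
  proof -
    have "cmod (I x y) \<le> 1 / (R - cmod w) * cmod (y - x)"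
    proof (rule has_contour_integral_bound_linepath)
      show "(h has_contour_integral I x y) (linepath x y)" unfolding I_def using xy by (intro hi) auto
      show "0 \<le> 1 / (R - cmod w)" using Rw by simp
      fix z assume z: "z \<in> closed_segment x y"
      have zz: "\<bar>Re z\<bar> = R" "Im z \<le> 0"
        using z xy R(2) sR0 by (auto simp: a1_def a2_def a3_def a4_def closed_segment_same_Re closed_segment_eq_real_ivl split: if_splits)
      have "R - cmod w \<le> cmod (z - p)"
        using zz abs_Re_le_cmod[of z] norm_triangle_ineq2[of z p] pn by linarith
      moreover have "cmod (f z) \<le> 1" using zz xi by (simp add: f_norm mult_nonneg_nonpos)
      ultimately show "cmod (h z) \<le> 1 / (R - cmod w)"
        unfolding h_def norm_divide using Rw by (intro frac_le) auto
    qed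
    also have "cmod (y - x) = sqrt R"
      using xy R(2) by (auto simp: a1_def a2_def a3_def a4_def cmod_def)
    finally show ?thesis .
  qed
  have bottom: "cmod (I a1 a2) \<le> exp (- 2 * pi * \<xi> * sqrt R) / (sqrt R - cmod w) * (2 * R)"
  proof -
    have "cmod (I a1 a2) \<le> exp (- 2 * pi * \<xi> * sqrt R) / (sqrt R - cmod w) * cmod (a2 - a1)"
    proof (rule has_contour_integral_bound_linepath)
      show "(h has_contour_integral I a1 a2) (linepath a1 a2)" unfolding I_def by (intro hi) auto
      show "0 \<le> exp (- 2 * pi * \<xi> * sqrt R) / (sqrt R - cmod w)" using R by simp
      fix z assume z: "z \<in> closed_segment a1 a2"
      have zz: "Im z = - sqrt R"
        using z by (auto simp: a1_def a2_def closed_segment_same_Im)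
      have "sqrt R - cmod w \<le> cmod (z - p)"
        using zz abs_Im_le_cmod[of z] norm_triangle_ineq2[of z p] pn sR0 by simp
      moreover have "cmod (f z) \<le> exp (- 2 * pi * \<xi> * sqrt R)" using zz by (simp add: f_norm)
      ultimately show "cmod (h z) \<le> exp (- 2 * pi * \<xi> * sqrt R) / (sqrt R - cmod w)"
        unfolding h_def norm_divide using R by (intro frac_le) auto
    qed
    also have "a2 - a1 = complex_of_real (2 * R)" by (simp add: a1_def a2_def complex_eq_iff)
    also have "cmod (complex_of_real (2 * R)) = 2 * R" using R(2) by (simp only: norm_of_real)
    finally show ?thesis .
  qed
  have "integral {-R..R} (\<lambda>t. 1 / (complex_of_real t - \<i> * w) * cis (- 2 * pi * t * \<xi>)) + 2 * pi * \<i> * exp (2 * pi * w * \<xi>)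
      = I a1 a2 + (I a2 a3 + I a4 a1)"
    using sumI unfolding top fp by (simp add: algebra_simps)
  also have "cmod \<dots> \<le> cmod (I a1 a2) + (cmod (I a2 a3) + cmod (I a4 a1))"
    by (intro order_trans[OF norm_triangle_ineq] add_left_mono norm_triangle_ineq)
  also have "\<dots> \<le> 2 * sqrt R / (R - cmod w) + 2 * R * exp (- 2 * pi * \<xi> * sqrt R) / (sqrt R - cmod w)"
  proof -
    have "2 * sqrt R / (R - cmod w) = 1 / (R - cmod w) * sqrt R + 1 / (R - cmod w) * sqrt R"
      by simp
    moreover have "2 * R * exp (- 2 * pi * \<xi> * sqrt R) / (sqrt R - cmod w)
        = exp (- 2 * pi * \<xi> * sqrt R) / (sqrt R - cmod w) * (2 * R)"
      by simp
    ultimately show ?thesis using bottom side[OF disjI1[OF refl]] side[OF disjI2[OF refl]] by linarith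
  qed
  finally show ?thesis .
qed

lemma Cauchy_kernel_fourier:
  fixes w :: complex
  assumes w: "Re w < 0" and xi: "\<xi> > 0"
  shows "((\<lambda>R. integral {-R..R} (\<lambda>t. 1 / (complex_of_real t - \<i> * w) * cis (- 2 * pi * t * \<xi>)))
     \<longlongrightarrow> - 2 * pi * \<i> * exp (2 * pi * w * \<xi>)) at_top"
proof -
  define W where "W = cmod w"
  have b: "((\<lambda>R. 2 * sqrt R / (R - W) + 2 * R * exp (- 2 * pi * \<xi> * sqrt R) / (sqrt R - W)) \<longlongrightarrow> 0) at_top"
  proof -
    define c where "c = 2 * pi * \<xi>"
    have c: "c > 0" using xi by (simp add: c_def)
    have "((\<lambda>R. 2 * sqrt R / (R - W) + 2 * R * exp (- c * sqrt R) / (sqrt R - W)) \<longlongrightarrow> 0) at_top"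
      using c by real_asymp
    then show ?thesis by (simp add: c_def)
  qed
  have "\<forall>\<^sub>F R in at_top. norm (integral {-R..R} (\<lambda>t. 1 / (complex_of_real t - \<i> * w) * cis (- 2 * pi * t * \<xi>)) - (- 2 * pi * \<i> * exp (2 * pi * w * \<xi>)))
      \<le> 2 * sqrt R / (R - W) + 2 * R * exp (- 2 * pi * \<xi> * sqrt R) / (sqrt R - W)"
    using eventually_gt_at_top[of "W\<^sup>2"] eventually_ge_at_top[of 1]
  proof eventually_elim
    case (elim R)
    have "sqrt R > cmod w" using elim(1) by (simp add: W_def real_less_rsqrt)
    then show ?case
      using Cauchy_kernel_rectangle[OF w xi, of R] elim(2) by (simp add: W_def)
  qed
  from Lim_null_comparison[OF this b] show ?thesis by (rule LIM_zero_cancel)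
qed

lemma exp_half_line:
  fixes k :: complex
  assumes k: "Re k < 0"
  shows "set_integrable lborel {0<..} (\<lambda>x::real. exp (k * x))"
    and "(LINT x:{0<..}|lborel. exp (k * complex_of_real x)) = - 1 / k"
proof -
  have ei: "einterval 0 \<infinity> = {0<..}" by (auto simp: einterval_def zero_ereal_def)
  have r: "Re k < 0" by (rule k)
  have "set_integrable lborel (einterval 0 \<infinity>) (\<lambda>x::real. exp (Re k * x))"
  proof (rule interval_integral_FTC_nonneg(1)[where F = "\<lambda>x. exp (Re k * x) / Re k"])
    show "((\<lambda>x. exp (Re k * x) / Re k) has_real_derivative exp (Re k * x)) (at x)" for x
      using r by (auto intro!: derivative_eq_intros)
    show "(((\<lambda>x. exp (Re k * x) / Re k) \<circ> real_of_ereal) \<longlongrightarrow> 1 / Re k) (at_right 0)"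
      unfolding zero_ereal_def ereal_tendsto_simps by (rule tendsto_eq_rhs, (rule tendsto_intros)+) (use r in auto)
    show "(((\<lambda>x. exp (Re k * x) / Re k) \<circ> real_of_ereal) \<longlongrightarrow> 0) (at_left \<infinity>)"
      unfolding ereal_tendsto_simps using r by real_asymp
  qed auto
  then have "set_integrable lborel {0<..} (\<lambda>x::real. exp (Re k * x))" by (simp add: ei)
  then show int: "set_integrable lborel {0<..} (\<lambda>x::real. exp (k * x))"
    unfolding set_integrable_def
    by (rule Bochner_Integration.integrable_bound) (auto simp: indicator_def intro!: borel_measurable_times borel_measurable_continuous_onI continuous_intros)
  have "(LBINT x=0..\<infinity>. exp (k * complex_of_real x)) = 0 - 1 / k"
  proof (rule interval_integral_FTC_integrable[where F = "\<lambda>x. exp (k * complex_of_real x) / k"])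
    show "((\<lambda>x. exp (k * complex_of_real x) / k) has_vector_derivative exp (k * complex_of_real x)) (at x)" for x
    proof -
      have k0: "k \<noteq> 0" using k by auto
      have "((\<lambda>z. exp (k * z)) has_field_derivative exp (k * of_real x) * k) (at (of_real x))"
        by (auto intro!: derivative_eq_intros)
      from DERIV_cdivide[OF this, of k]
      have "((\<lambda>z. exp (k * z) / k) has_field_derivative exp (k * of_real x)) (at (of_real x))"
        using k0 by simp
      from has_vector_derivative_real_field[OF this] show ?thesis .
    qed
    show "(((\<lambda>x. exp (k * complex_of_real x) / k) \<circ> real_of_ereal) \<longlongrightarrow> 1 / k) (at_right 0)"
      unfolding zero_ereal_def ereal_tendsto_simps by (rule tendsto_eq_rhs, (rule tendsto_intros)+) (use k in auto)
    show "(((\<lambda>x. exp (k * complex_of_real x) / k) \<circ> real_of_ereal) \<longlongrightarrow> 0) (at_left \<infinity>)"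
      unfolding ereal_tendsto_simps
    proof (rule tendsto_norm_zero_cancel)
      have "((\<lambda>x. exp (Re k * x)) \<longlongrightarrow> 0) at_top" using r by real_asymp
      from tendsto_mult_left_zero[OF this, of "1 / cmod k"]
      show "((\<lambda>x. norm (exp (k * complex_of_real x) / k)) \<longlongrightarrow> 0) at_top" by (simp add: norm_divide)
    qed
    show "set_integrable lborel (einterval 0 \<infinity>) (\<lambda>x. exp (k * complex_of_real x))" using int by (simp add: ei)
  qed (auto intro!: continuous_intros)
  then show "(LINT x:{0<..}|lborel. exp (k * complex_of_real x)) = - 1 / k"
    by (simp add: interval_lebesgue_integral_def ei)
qed

section \<open>Density of compactly supported continuous functions\<close>

lemma L2_measurable: "f \<in> L2 \<Longrightarrow> f \<in> borel_measurable borel"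
  by (simp add: L2_def)

lemma L2_integrable: "f \<in> L2 \<Longrightarrow> integrable lborel (\<lambda>t. (cmod (f t))\<^sup>2)"
  by (simp add: L2_def)

lemma L2_norm_sq_nonneg: "0 \<le> L2_norm_sq f"
  unfolding L2_norm_sq_def by (intro Bochner_Integration.integral_nonneg) simp

text \<open>Used instead of the triangle inequality for the L2 norm, so that only squared norms
  occur; the price is constant factors.\<close>

lemma norm_add_sq_le: "(cmod (x + y))\<^sup>2 \<le> 2 * (cmod x)\<^sup>2 + 2 * (cmod y)\<^sup>2"
proof -
  have "(cmod (x + y))\<^sup>2 \<le> (cmod x + cmod y)\<^sup>2" by (intro power_mono norm_triangle_ineq) simp
  also have "\<dots> \<le> 2 * (cmod x)\<^sup>2 + 2 * (cmod y)\<^sup>2"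
    using sum_squares_bound[of "cmod x" "cmod y"] by (simp add: power2_sum)
  finally show ?thesis .
qed

lemma L2_add:
  assumes "f \<in> L2" "h \<in> L2"
  shows "(\<lambda>t. f t + h t) \<in> L2"
    and "L2_norm_sq (\<lambda>t. f t + h t) \<le> 2 * L2_norm_sq f + 2 * L2_norm_sq h"
proof -
  note [measurable] = assms[THEN L2_measurable]
  have i: "integrable lborel (\<lambda>t. 2 * (cmod (f t))\<^sup>2 + 2 * (cmod (h t))\<^sup>2)"
    using assms[THEN L2_integrable] by (intro Bochner_Integration.integrable_add integrable_mult_right)
  have j: "integrable lborel (\<lambda>t. (cmod (f t + h t))\<^sup>2)"
    by (rule Bochner_Integration.integrable_bound[OF i])
       (auto intro!: AE_I2 order_trans[OF norm_add_sq_le] simp: abs_of_nonneg)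
  then show "(\<lambda>t. f t + h t) \<in> L2" by (simp add: L2_def)
  have "L2_norm_sq (\<lambda>t. f t + h t) \<le> (LINT t|lborel. 2 * (cmod (f t))\<^sup>2 + 2 * (cmod (h t))\<^sup>2)"
    unfolding L2_norm_sq_def by (intro integral_mono i j norm_add_sq_le)
  also have "\<dots> = 2 * L2_norm_sq f + 2 * L2_norm_sq h"
    unfolding L2_norm_sq_def using assms[THEN L2_integrable] by simp
  finally show "L2_norm_sq (\<lambda>t. f t + h t) \<le> 2 * L2_norm_sq f + 2 * L2_norm_sq h" .
qed

lemma L2_uminus: "f \<in> L2 \<Longrightarrow> (\<lambda>t. - f t) \<in> L2" "L2_norm_sq (\<lambda>t. - f t) = L2_norm_sq f"
  by (auto simp: L2_def L2_norm_sq_def)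

lemma L2_diff: "f \<in> L2 \<Longrightarrow> h \<in> L2 \<Longrightarrow> (\<lambda>t. f t - h t) \<in> L2"
  using L2_add(1)[OF _ L2_uminus(1), of f h] by simp

lemma L2_mult_integrable:
  assumes "f \<in> L2" "h \<in> L2"
  shows "integrable lborel (\<lambda>t. f t * cnj (h t))"
proof -
  note [measurable] = assms[THEN L2_measurable]
  have i: "integrable lborel (\<lambda>t. (cmod (f t))\<^sup>2 + (cmod (h t))\<^sup>2)"
    using assms[THEN L2_integrable] by (rule Bochner_Integration.integrable_add)
  show ?thesis
  proof (rule Bochner_Integration.integrable_bound[OF i])
    show "AE t in lborel. norm (f t * cnj (h t)) \<le> norm ((cmod (f t))\<^sup>2 + (cmod (h t))\<^sup>2)"
    proof (rule AE_I2)
      fix t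
      have "2 * (cmod (f t) * cmod (h t)) \<le> (cmod (f t))\<^sup>2 + (cmod (h t))\<^sup>2"
        using sum_squares_bound[of "cmod (f t)" "cmod (h t)"] by simp
      moreover have "0 \<le> cmod (f t) * cmod (h t)" by simp
      ultimately have "cmod (f t) * cmod (h t) \<le> \<bar>(cmod (f t))\<^sup>2 + (cmod (h t))\<^sup>2\<bar>" by linarith
      then show "norm (f t * cnj (h t)) \<le> norm ((cmod (f t))\<^sup>2 + (cmod (h t))\<^sup>2)"
        by (simp only: norm_mult complex_mod_cnj real_norm_def)
    qed
  qed measurable
qed

lemma L2_inner_diff:
  assumes "f \<in> L2" "h \<in> L2" "e \<in> L2"
  shows "L2_inner (\<lambda>t. f t - h t) e = L2_inner f e - L2_inner h e"
  unfolding L2_inner_def left_diff_distrib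
  by (rule Bochner_Integration.integral_diff) (intro L2_mult_integrable assms)+

lemma L2_Cauchy_Schwarz:
  assumes "f \<in> L2" "h \<in> L2"
  shows "(cmod (L2_inner f h))\<^sup>2 \<le> L2_norm_sq f * L2_norm_sq h"
proof -
  note [measurable] = assms[THEN L2_measurable]
  have nn: "(\<integral>\<^sup>+t. (ennreal (cmod (u t)))\<^sup>2 \<partial>lborel) = ennreal (L2_norm_sq u)" if "u \<in> L2" for u
    using nn_integral_eq_integral[OF L2_integrable[OF that]] by (simp add: L2_norm_sq_def ennreal_power)
  have "ennreal (cmod (L2_inner f h)) \<le> (\<integral>\<^sup>+t. ennreal (cmod (f t * cnj (h t))) \<partial>lborel)"
    unfolding L2_inner_def by (rule integral_norm_bound_ennreal[OF L2_mult_integrable[OF assms]])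
  also have "\<dots> = (\<integral>\<^sup>+t. ennreal (cmod (f t)) * ennreal (cmod (h t)) \<partial>lborel)"
    by (simp add: norm_mult ennreal_mult)
  finally have "(ennreal (cmod (L2_inner f h)))\<^sup>2 \<le> (\<integral>\<^sup>+t. ennreal (cmod (f t)) * ennreal (cmod (h t)) \<partial>lborel)\<^sup>2"
    by (rule power_mono) simp
  also have "\<dots> \<le> (\<integral>\<^sup>+t. (ennreal (cmod (f t)))\<^sup>2 \<partial>lborel) * (\<integral>\<^sup>+t. (ennreal (cmod (h t)))\<^sup>2 \<partial>lborel)"
    by (rule Cauchy_Schwarz_nn_integral) measurable
  also have "\<dots> = ennreal (L2_norm_sq f * L2_norm_sq h)"
    by (simp add: nn assms ennreal_mult L2_norm_sq_nonneg)
  finally show ?thesis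
    by (simp add: ennreal_power L2_norm_sq_nonneg)
qed

text \<open>For these functions Plancherel is available and the transform is bounded and continuous,
  as the bounds on the Fourier side demand.\<close>

definition test_functions :: "(real \<Rightarrow> complex) set" where
  "test_functions = {h. continuous_on UNIV h \<and> (\<exists>R>0. \<forall>t. \<bar>t\<bar> > R \<longrightarrow> h t = 0)}"

lemma test_function_integrable:
  assumes "h \<in> test_functions"
  shows "integrable lborel h"
proof -
  obtain R where "R > 0" "\<And>t. \<bar>t\<bar> > R \<Longrightarrow> h t = 0" "continuous_on UNIV h"
    using assms by (auto simp: test_functions_def)
  then show ?thesis using plancherel_compact_support(2) by blast
qed

lemma test_function_L2:
  assumes "h \<in> test_functions"
  shows "h \<in> L2"
proof -
  have "(\<lambda>t. complex_of_real ((cmod (h t))\<^sup>2)) \<in> test_functions"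
    using assms by (auto simp: test_functions_def intro!: continuous_intros)
  from test_function_integrable[OF this] have "integrable lborel (\<lambda>t. (cmod (h t))\<^sup>2)"
    by (simp only: complex_of_real_integrable_eq)
  then show ?thesis
    using assms by (auto simp: L2_def test_functions_def intro: borel_measurable_continuous_onI)
qed

text \<open>For k > 0: equal to 1 on [-k, k], zero outside [-k-1, k+1], and linear in
  between.\<close>

definition cutoff :: "real \<Rightarrow> real \<Rightarrow> real" where
  "cutoff k t = max 0 (min 1 (k + 1 - \<bar>t\<bar>))"

text \<open>For k > 0 the radial projection onto the closed disc of radius \<open>k\<close>.\<close>

definition clip :: "real \<Rightarrow> complex \<Rightarrow> complex" where
  "clip k z = z /\<^sub>R max 1 (cmod z / k)"

lemma cutoff_bounds: "0 \<le> cutoff k t" "cutoff k t \<le> 1" by (auto simp: cutoff_def)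

lemma clip_factor: "0 < 1 / max 1 (cmod z / k)" "1 / max 1 (cmod z / k) \<le> 1"
  by (auto simp: max_def)

lemma clip_bound:
  assumes "k > 0" shows "cmod (clip k z) \<le> k"
proof -
  have m: "max 1 (cmod z / k) > 0" by simp
  have "cmod z \<le> k * max 1 (cmod z / k)"
    using assms by (simp add: max_def field_simps)
  then have "cmod z / max 1 (cmod z / k) \<le> k" using m by (simp add: pos_divide_le_eq)
  then show ?thesis using m by (simp add: clip_def divide_inverse_commute abs_of_pos)
qed

lemma continuous_cutoff: "continuous_on UNIV (cutoff k)"
  unfolding cutoff_def by (intro continuous_intros)

lemma continuous_clip: "k > 0 \<Longrightarrow> continuous_on UNIV (clip k)"
  unfolding clip_def by (intro continuous_intros) (auto simp: max_def)

text \<open>First f is truncated in argument and value by \<open>T k\<close>. Then the truncated f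
  is approximated by truncations of continuous functions tending to f almost everywhere; truncating
  these as well gives compact support and an integrable majorant, so pointwise convergence becomes
  convergence in L2.\<close>

lemma test_functions_dense:
  assumes f: "f \<in> L2" and eps: "\<epsilon> > 0"
  shows "\<exists>h\<in>test_functions. L2_norm_sq (\<lambda>t. f t - h t) \<le> \<epsilon>"
proof -
  note [measurable] = L2_measurable[OF f]
  define T where "T = (\<lambda>k u t. cutoff k t *\<^sub>R clip k (u t :: complex))"
  have [measurable]: "cutoff k \<in> borel_measurable borel" for k
    by (intro borel_measurable_continuous_onI continuous_cutoff)
  have T_meas [measurable]: "T (real (Suc k)) u \<in> borel_measurable borel" if [measurable]: "u \<in> borel_measurable borel" for k u
  proof -
    have [measurable]: "clip (real (Suc k)) \<in> borel_measurable borel"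
      by (intro borel_measurable_continuous_onI continuous_clip) simp
    show ?thesis unfolding T_def by measurable
  qed
  have "(\<lambda>k. LINT t|lborel. (cmod (f t - T (real (Suc k)) f t))\<^sup>2) \<longlonglongrightarrow> (LINT t|(lborel::real measure). 0::real)"
  proof (rule Bochner_Integration.integral_dominated_convergence[where w = "\<lambda>t. (cmod (f t))\<^sup>2"])
    show "integrable lborel (\<lambda>t. (cmod (f t))\<^sup>2)" by (rule L2_integrable[OF f])
    show "AE t in lborel. norm ((cmod (f t - T (real (Suc k)) f t))\<^sup>2) \<le> (cmod (f t))\<^sup>2" for k
    proof (rule AE_I2)
      fix t
      define \<sigma> where "\<sigma> = cutoff (real (Suc k)) t * (1 / max 1 (cmod (f t) / real (Suc k)))"
      have s: "0 \<le> \<sigma>" "\<sigma> \<le> 1"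
        using cutoff_bounds[of "real (Suc k)" t] clip_factor[of "f t" "real (Suc k)"] unfolding \<sigma>_def
        by (intro mult_nonneg_nonneg mult_le_one; simp)+
      have "f t - T (real (Suc k)) f t = (1 - \<sigma>) *\<^sub>R f t"
        by (simp add: T_def clip_def \<sigma>_def scaleR_left_diff_distrib divide_inverse)
      then have "cmod (f t - T (real (Suc k)) f t) \<le> cmod (f t)"
        using s by (simp add: mult_left_le_one_le)
      then show "norm ((cmod (f t - T (real (Suc k)) f t))\<^sup>2) \<le> (cmod (f t))\<^sup>2" by (simp add: power_mono)
    qed
    show "AE t in lborel. (\<lambda>k. (cmod (f t - T (real (Suc k)) f t))\<^sup>2) \<longlonglongrightarrow> 0"
    proof (intro AE_I2 tendsto_eventually)
      fix t
      obtain k0 :: nat where k0: "max \<bar>t\<bar> (cmod (f t)) \<le> k0" using real_arch_simple by blast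
      show "\<forall>\<^sub>F k in sequentially. (cmod (f t - T (real (Suc k)) f t))\<^sup>2 = 0"
        using eventually_ge_at_top[of k0]
      proof eventually_elim
        case (elim k)
        then have "\<bar>t\<bar> \<le> real (Suc k)" "cmod (f t) \<le> real (Suc k)" using k0 by auto
        then have "T (real (Suc k)) f t = f t" by (simp add: T_def cutoff_def clip_def max_def)
        then show ?case by simp
      qed
    qed
  qed measurable
  then have "(\<lambda>k. L2_norm_sq (\<lambda>t. f t - T (real (Suc k)) f t)) \<longlonglongrightarrow> 0" by (simp add: L2_norm_sq_def)
  \<comment> \<open>Two errors, each doubled by \<open>norm_add_sq_le\<close>: hence one quarter of
    \<epsilon> for each.\<close>
  then have "\<forall>\<^sub>F k in sequentially. L2_norm_sq (\<lambda>t. f t - T (real (Suc k)) f t) < \<epsilon> / 4"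
    using eps by (intro order_tendstoD) auto
  then obtain k0 where k0: "L2_norm_sq (\<lambda>t. f t - T (real (Suc k0)) f t) < \<epsilon> / 4"
    by (meson eventually_happens trivial_limit_sequentially)
  define k where "k = real (Suc k0)"
  have k: "k > 0" by (simp add: k_def)
  have "f \<in> borel_measurable lebesgue" by (intro measurable_completion) simp
  \<comment> \<open>By definition \<open>measurable_on\<close> supplies continuous functions
    converging outside a negligible set.\<close>
  then have "f measurable_on UNIV" by (rule lebesgue_measurable_imp_measurable_on) simp
  then obtain Z and g :: "nat \<Rightarrow> real \<Rightarrow> complex" where Z: "negligible Z"
    and g': "\<forall>n. continuous_on UNIV (g n)"
    and lim': "\<forall>t. t \<notin> Z \<longrightarrow> (\<lambda>n. g n t) \<longlonglongrightarrow> (if t \<in> UNIV then f t else 0)"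
    unfolding measurable_on_def by (elim exE conjE) (rule that)
  have g: "continuous_on UNIV (g n)" for n using g' ..
  have lim: "(\<lambda>n. g n t) \<longlonglongrightarrow> f t" if "t \<notin> Z" for t using lim' that by simp
  have gm: "g n \<in> borel_measurable borel" for n using g by (rule borel_measurable_continuous_onI)
  have "AE t in lebesgue. t \<notin> Z"
    using Z by (auto simp: negligible_iff_null_sets intro: AE_not_in)
  then have Z_AE: "AE t in lborel. t \<notin> Z" by (simp add: AE_completion_iff)
  have T_test: "T k (g n) \<in> test_functions" for n
  proof -
    have "continuous_on UNIV (T k (g n))"
      unfolding T_def
      by (intro continuous_on_scaleR continuous_cutoff continuous_on_compose2[OF continuous_clip[OF k] g]) auto
    moreover have "\<forall>t. \<bar>t\<bar> > k + 1 \<longrightarrow> T k (g n) t = 0" by (simp add: T_def cutoff_def)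
    ultimately show ?thesis unfolding test_functions_def using k by (intro CollectI conjI exI[of _ "k + 1"]) auto
  qed
  have T_bound: "cmod (T k u t) \<le> k * indicator {-k-1..k+1} t" for u t
  proof (cases "\<bar>t\<bar> \<le> k + 1")
    case True
    have "cmod (T k u t) \<le> 1 * k"
      unfolding T_def norm_scaleR using cutoff_bounds[of k t] clip_bound[OF k] by (intro mult_mono) auto
    then show ?thesis using True by (simp add: indicator_def abs_le_iff)
  qed (use k in \<open>simp add: T_def cutoff_def\<close>)
  have "(\<lambda>n. LINT t|lborel. (cmod (T k f t - T k (g n) t))\<^sup>2) \<longlonglongrightarrow> (LINT t|(lborel::real measure). 0::real)"
  proof (rule integral_dominated_convergence[where w = "\<lambda>t. (2 * k)\<^sup>2 * indicator {-k-1..k+1} t"])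
    show "integrable lborel (\<lambda>t. (2 * k)\<^sup>2 * indicator {-k-1..k+1} t)"
      by (intro integrable_mult_right integrable_real_indicator) (auto simp: emeasure_lborel_Icc_eq)
    show "AE t in lborel. norm ((cmod (T k f t - T k (g n) t))\<^sup>2) \<le> (2 * k)\<^sup>2 * indicator {-k-1..k+1} t" for n
    proof (rule AE_I2)
      fix t
      have "cmod (T k f t - T k (g n) t) \<le> 2 * k * indicator {-k-1..k+1} t"
        using norm_triangle_ineq4[of "T k f t" "T k (g n) t"] T_bound[of f t] T_bound[of "g n" t] by linarith
      then have "(cmod (T k f t - T k (g n) t))\<^sup>2 \<le> (2 * k * indicator {-k-1..k+1} t)\<^sup>2" by (rule power_mono) simp
      then show "norm ((cmod (T k f t - T k (g n) t))\<^sup>2) \<le> (2 * k)\<^sup>2 * indicator {-k-1..k+1} t"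
        by (cases "t \<in> {-k-1..k+1}") (auto simp: power_mult_distrib)
    qed
    show "AE t in lborel. (\<lambda>n. (cmod (T k f t - T k (g n) t))\<^sup>2) \<longlonglongrightarrow> 0"
      using Z_AE
    proof eventually_elim
      case (elim t)
      have "isCont (clip k) (f t)" using continuous_clip[OF k] by (simp add: continuous_on_eq_continuous_at)
      then have "(\<lambda>n. clip k (g n t)) \<longlonglongrightarrow> clip k (f t)"
        using lim[OF elim] by (rule isCont_tendsto_compose)
      then have "(\<lambda>n. (cmod (T k f t - T k (g n) t))\<^sup>2) \<longlonglongrightarrow> (cmod (T k f t - T k f t))\<^sup>2"
        unfolding T_def by (intro tendsto_intros)
      then show ?case by simp
    qed
    show "(\<lambda>t. (cmod (T k f t - T k (g n) t))\<^sup>2) \<in> borel_measurable lborel" for n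
      using T_meas[OF L2_measurable[OF f], of k0] T_meas[OF gm, of k0 n] unfolding k_def by measurable
  qed simp
  then have "(\<lambda>n. L2_norm_sq (\<lambda>t. T k f t - T k (g n) t)) \<longlonglongrightarrow> 0" by (simp add: L2_norm_sq_def)
  then have "\<forall>\<^sub>F n in sequentially. L2_norm_sq (\<lambda>t. T k f t - T k (g n) t) < \<epsilon> / 4"
    using eps by (intro order_tendstoD) auto
  then obtain n where n: "L2_norm_sq (\<lambda>t. T k f t - T k (g n) t) < \<epsilon> / 4"
    by (meson eventually_happens trivial_limit_sequentially)
  have Tf: "T k f \<in> L2"
  proof -
    have m: "T k f \<in> borel_measurable borel" using T_meas[OF L2_measurable[OF f], of k0] by (simp add: k_def)
    have i: "integrable lborel (\<lambda>t. k\<^sup>2 * indicator {-k-1..k+1} t)"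
      by (intro integrable_mult_right integrable_real_indicator) (auto simp: emeasure_lborel_Icc_eq)
    have "integrable lborel (\<lambda>t. (cmod (T k f t))\<^sup>2)"
    proof (rule Bochner_Integration.integrable_bound[OF i])
      show "AE t in lborel. norm ((cmod (T k f t))\<^sup>2) \<le> norm (k\<^sup>2 * indicator {-k-1..k+1} t)"
      proof (rule AE_I2)
        fix t
        have "(cmod (T k f t))\<^sup>2 \<le> (k * indicator {-k-1..k+1} t)\<^sup>2" using T_bound by (rule power_mono) simp
        then show "norm ((cmod (T k f t))\<^sup>2) \<le> norm (k\<^sup>2 * indicator {-k-1..k+1} t)"
          by (cases "t \<in> {-k-1..k+1}") (auto simp: power_mult_distrib)
      qed
    qed (use m in measurable)
    with m show ?thesis by (simp add: L2_def)
  qed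
  have hL2: "T k (g n) \<in> L2" using T_test by (rule test_function_L2)
  have "(\<lambda>t. f t - T k (g n) t) = (\<lambda>t. (f t - T k f t) + (T k f t - T k (g n) t))" by simp
  then have "L2_norm_sq (\<lambda>t. f t - T k (g n) t)
      \<le> 2 * L2_norm_sq (\<lambda>t. f t - T k f t) + 2 * L2_norm_sq (\<lambda>t. T k f t - T k (g n) t)"
    using L2_add(2)[OF L2_diff[OF f Tf] L2_diff[OF Tf hL2]] by simp
  also have "\<dots> \<le> \<epsilon>" using k0 n by (simp add: k_def)
  finally show ?thesis using T_test by blast
qed

section \<open>The Gabor frame\<close>

text \<open>The upper bound comes first, on finite partial sums, where an approximation error is
  controlled by Cauchy-Schwarz. Once it holds for every f in L2, it controls the error in the full
  sum and lets the lower bound pass to the limit. The factors 4 come from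
  \<open>norm_add_sq_le\<close> used twice.\<close>

lemma frame_from_test_functions:
  fixes e :: "'p \<Rightarrow> real \<Rightarrow> complex"
  assumes e: "\<And>p. e p \<in> L2" and C1: "C1 > 0" and C2: "C2 > 0"
    and lower: "\<And>h. h \<in> test_functions \<Longrightarrow> ennreal (L2_norm_sq h)
      \<le> ennreal C1 * (\<Sum>\<^sup>+p. nsq (L2_inner h (e p)))"
    and upper: "\<And>h. h \<in> test_functions \<Longrightarrow> (\<Sum>\<^sup>+p. nsq (L2_inner h (e p)))
      \<le> ennreal C2 * ennreal (L2_norm_sq h)"
  shows "\<exists>A B. 0 < A \<and> A \<le> B \<and> (\<forall>f\<in>L2. (\<lambda>p. (cmod (L2_inner f (e p)))\<^sup>2) summable_on UNIV \<and>
     A * L2_norm_sq f \<le> (\<Sum>\<^sub>\<infinity>p. (cmod (L2_inner f (e p)))\<^sup>2) \<and>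
     (\<Sum>\<^sub>\<infinity>p. (cmod (L2_inner f (e p)))\<^sup>2) \<le> B * L2_norm_sq f)"
proof -
  let ?q = "\<lambda>f p. (cmod (L2_inner f (e p)))\<^sup>2"
  have test_sum: "sum (?q h) S \<le> C2 * L2_norm_sq h" if h: "h \<in> test_functions" and S: "finite S" for h S
  proof -
    have "ennreal (sum (?q h) S) = (\<Sum>\<^sup>+p. ennreal (?q h p) * indicator S p)"
      using S by (simp add: nn_integral_count_space_indicator[symmetric] nn_integral_count_space_finite sum_nonneg)
    also have "\<dots> \<le> (\<Sum>\<^sup>+p. ennreal (?q h p))"
      by (intro nn_integral_mono) (auto simp: indicator_def)
    also have "\<dots> \<le> ennreal (C2 * L2_norm_sq h)"
      using upper[OF h] C2 by (simp add: ennreal_mult L2_norm_sq_nonneg)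
    finally show ?thesis using C2 by (simp add: L2_norm_sq_nonneg)
  qed
  have split: "?q f p \<le> 2 * ?q h p + 2 * ?q (\<lambda>t. f t - h t) p" if "f \<in> L2" "h \<in> L2" for f h p
    using norm_add_sq_le[of "L2_inner h (e p)" "L2_inner (\<lambda>t. f t - h t) (e p)"]
    by (simp add: L2_inner_diff[OF that e])
  have norm_split: "L2_norm_sq f \<le> 2 * L2_norm_sq h + 2 * L2_norm_sq (\<lambda>t. f t - h t)"
    if "f \<in> L2" "h \<in> L2" for f h
    using L2_add(2)[OF that(2) L2_diff[OF that]] by simp
  have norm_split': "L2_norm_sq h \<le> 2 * L2_norm_sq f + 2 * L2_norm_sq (\<lambda>t. f t - h t)"
    if "f \<in> L2" "h \<in> L2" for f h
  proof -
    have "L2_norm_sq h \<le> 2 * L2_norm_sq f + 2 * L2_norm_sq (\<lambda>t. h t - f t)"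
      using L2_add(2)[OF that(1) L2_diff[OF that(2,1)]] by simp
    also have "L2_norm_sq (\<lambda>t. h t - f t) = L2_norm_sq (\<lambda>t. f t - h t)"
      by (simp add: L2_norm_sq_def norm_minus_commute)
    finally show ?thesis .
  qed
  have up: "sum (?q f) S \<le> 4 * C2 * L2_norm_sq f" if f: "f \<in> L2" and S: "finite S" for f S
  proof (rule field_le_epsilon)
    fix \<epsilon> :: real assume eps: "\<epsilon> > 0"
    \<comment> \<open>A crude constant depending on the finite set \<open>S\<close>. It enters only
      through the choice of \<open>\<delta>\<close> and leaves no trace in the final bound.\<close>
    define G where "G = (\<Sum>p\<in>S. L2_norm_sq (e p))"
    have G: "G \<ge> 0" unfolding G_def by (intro sum_nonneg L2_norm_sq_nonneg)
    define \<delta> where "\<delta> = \<epsilon> / (4 * C2 + 2 * G)"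
    have d: "\<delta> > 0" unfolding \<delta>_def using eps C2 G by (intro divide_pos_pos add_pos_nonneg) auto
    obtain h where h: "h \<in> test_functions" "L2_norm_sq (\<lambda>t. f t - h t) \<le> \<delta>"
      using test_functions_dense[OF f d] by blast
    have hL: "h \<in> L2" using h(1) by (rule test_function_L2)
    have "sum (?q f) S \<le> (\<Sum>p\<in>S. 2 * ?q h p + 2 * ?q (\<lambda>t. f t - h t) p)"
      by (intro sum_mono split f hL)
    also have "\<dots> = 2 * sum (?q h) S + 2 * sum (?q (\<lambda>t. f t - h t)) S"
      by (simp add: sum.distrib sum_distrib_left)
    also have "sum (?q (\<lambda>t. f t - h t)) S \<le> (\<Sum>p\<in>S. L2_norm_sq (\<lambda>t. f t - h t) * L2_norm_sq (e p))"
      by (intro sum_mono L2_Cauchy_Schwarz L2_diff f hL e)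
    also have "\<dots> = L2_norm_sq (\<lambda>t. f t - h t) * G" by (simp add: G_def sum_distrib_left)
    also have "\<dots> \<le> \<delta> * G" using h(2) G by (intro mult_right_mono)
    also have "sum (?q h) S \<le> C2 * L2_norm_sq h" by (rule test_sum[OF h(1) S])
    also have "\<dots> \<le> C2 * (2 * L2_norm_sq f + 2 * \<delta>)"
      using norm_split'[OF f hL] h(2) C2 by (intro mult_left_mono) auto
    finally have "sum (?q f) S \<le> 4 * C2 * L2_norm_sq f + (4 * C2 + 2 * G) * \<delta>"
      by (simp add: algebra_simps)
    also have "(4 * C2 + 2 * G) * \<delta> = \<epsilon>" unfolding \<delta>_def using C2 G by simp
    finally show "sum (?q f) S \<le> 4 * C2 * L2_norm_sq f + \<epsilon>" .
  qed
  have sm: "?q f summable_on UNIV" if "f \<in> L2" for f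
    using up[OF that] by (intro nonneg_bdd_above_summable_on bdd_aboveI[of _ "4 * C2 * L2_norm_sq f"]) auto
  have up_inf: "infsum (?q f) UNIV \<le> 4 * C2 * L2_norm_sq f" if "f \<in> L2" for f
    using up[OF that] by (intro infsum_le_finite_sums[OF sm[OF that]])
  have low_test: "L2_norm_sq h \<le> C1 * infsum (?q h) UNIV" if h: "h \<in> test_functions" for h
  proof -
    have hL: "h \<in> L2" using h by (rule test_function_L2)
    have nn: "0 \<le> infsum (?q h) UNIV" by (intro infsum_nonneg) simp
    have "ennreal (L2_norm_sq h) \<le> ennreal (C1 * infsum (?q h) UNIV)"
      using lower[OF h] nn_integral_count_space_infsum[OF sm[OF hL]] C1 nn by (simp add: ennreal_mult)
    then show ?thesis using C1 nn by simp
  qed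
  have low: "L2_norm_sq f \<le> 4 * C1 * infsum (?q f) UNIV" if f: "f \<in> L2" for f
  proof (rule field_le_epsilon)
    fix \<epsilon> :: real assume eps: "\<epsilon> > 0"
    \<comment> \<open>The upper bound just obtained controls the error over all indices, so this
      choice involves no finite set.\<close>
    define \<delta> where "\<delta> = \<epsilon> / (16 * C1 * C2 + 2)"
    have cc: "16 * C1 * C2 + 2 > 0" using C1 C2 by (intro add_pos_pos) auto
    have d: "\<delta> > 0" unfolding \<delta>_def using eps cc by simp
    obtain h where h: "h \<in> test_functions" "L2_norm_sq (\<lambda>t. f t - h t) \<le> \<delta>"
      using test_functions_dense[OF f d] by blast
    have hL: "h \<in> L2" using h(1) by (rule test_function_L2)
    have fh: "(\<lambda>t. f t - h t) \<in> L2" by (rule L2_diff[OF f hL])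
    have "infsum (?q h) UNIV \<le> infsum (\<lambda>p. 2 * ?q f p + 2 * ?q (\<lambda>t. f t - h t) p) UNIV"
    proof (rule infsum_mono)
      fix p
      have "L2_inner h (e p) = L2_inner f (e p) + - L2_inner (\<lambda>t. f t - h t) (e p)"
        by (simp add: L2_inner_diff[OF f hL e])
      then show "?q h p \<le> 2 * ?q f p + 2 * ?q (\<lambda>t. f t - h t) p"
        using norm_add_sq_le[of "L2_inner f (e p)" "- L2_inner (\<lambda>t. f t - h t) (e p)"] by simp
    qed (intro sm hL summable_on_add summable_on_cmult_right f fh)+
    also have "\<dots> = 2 * infsum (?q f) UNIV + 2 * infsum (?q (\<lambda>t. f t - h t)) UNIV"
      by (subst infsum_add) (intro summable_on_cmult_right sm f fh, intro summable_on_cmult_right sm f fh, simp add: infsum_cmult_right')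
    also have "infsum (?q (\<lambda>t. f t - h t)) UNIV \<le> 4 * C2 * \<delta>"
      using up_inf[OF fh] h(2) C2 mult_left_mono[of "L2_norm_sq (\<lambda>t. f t - h t)" \<delta> "4 * C2"] by linarith
    finally have "C1 * infsum (?q h) UNIV \<le> C1 * (2 * infsum (?q f) UNIV + 2 * (4 * C2 * \<delta>))"
      using C1 by (intro mult_left_mono) auto
    then have "L2_norm_sq f \<le> 2 * (C1 * (2 * infsum (?q f) UNIV + 2 * (4 * C2 * \<delta>))) + 2 * \<delta>"
      using norm_split[OF f hL] low_test[OF h(1)] h(2) by linarith
    also have "\<dots> = 4 * C1 * infsum (?q f) UNIV + (16 * C1 * C2 + 2) * \<delta>" by (simp add: algebra_simps)
    also have "(16 * C1 * C2 + 2) * \<delta> = \<epsilon>" unfolding \<delta>_def using cc by simp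
    finally show "L2_norm_sq f \<le> 4 * C1 * infsum (?q f) UNIV + \<epsilon>" .
  qed
  define A where "A = 1 / (4 * C1)"
  \<comment> \<open>The maximum ensures \<open>A \<le> B\<close> without having to produce a nonzero
    element of L2.\<close>
  define B where "B = max A (4 * C2)"
  have "A > 0" "A \<le> B" using C1 by (auto simp: A_def B_def)
  moreover have "A * L2_norm_sq f \<le> infsum (?q f) UNIV" if "f \<in> L2" for f
    using low[OF that] C1 by (simp add: A_def pos_divide_le_eq mult_ac)
  moreover have "infsum (?q f) UNIV \<le> B * L2_norm_sq f" if "f \<in> L2" for f
    using up_inf[OF that] mult_right_mono[of "4 * C2" B "L2_norm_sq f"] L2_norm_sq_nonneg[of f]
    by (simp add: B_def)
  ultimately show ?thesis using sm by blast
qed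

section \<open>The rational window and its Gabor coefficients\<close>

lemma Cauchy_kernel_L2:
  assumes w: "Re w < 0"
  shows "(\<lambda>t. 1 / (complex_of_real t - \<i> * w)) \<in> L2"
proof -
  have "integrable lborel (\<lambda>x::real. inverse (1 + x\<^sup>2))"
    using integrable_inverse_1_plus_square by (simp add: set_integrable_def)
  then have "integrable lborel (\<lambda>x. inverse (1 + (Im w / Re w + 1 / Re w * x)\<^sup>2))"
    using w by (intro lborel_integrable_real_affine) auto
  then have i: "integrable lborel (\<lambda>x. (1 / (Re w)\<^sup>2) * inverse (1 + (Im w / Re w + 1 / Re w * x)\<^sup>2))"
    by (rule integrable_mult_right)
  have "(cmod (1 / (complex_of_real x - \<i> * w)))\<^sup>2 = (1 / (Re w)\<^sup>2) * inverse (1 + (Im w / Re w + 1 / Re w * x)\<^sup>2)" for x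
  proof -
    have "(cmod (complex_of_real x - \<i> * w))\<^sup>2 = (x + Im w)\<^sup>2 + (Re w)\<^sup>2" by (simp add: cmod_power2)
    moreover have "(Re w)\<^sup>2 * (1 + (Im w / Re w + 1 / Re w * x)\<^sup>2) = (x + Im w)\<^sup>2 + (Re w)\<^sup>2"
      using w by (simp add: field_simps power2_eq_square)
    moreover have "(cmod (1 / (complex_of_real x - \<i> * w)))\<^sup>2 = 1 / (cmod (complex_of_real x - \<i> * w))\<^sup>2"
      by (simp add: norm_divide power_divide)
    moreover have "(1 / (Re w)\<^sup>2) * inverse y = 1 / ((Re w)\<^sup>2 * y)" for y
      by (simp add: divide_inverse)
    ultimately show ?thesis by (simp only:)
  qed
  with i show ?thesis by (simp add: L2_def)
qed

lemma L2_cmult: "f \<in> L2 \<Longrightarrow> (\<lambda>t. c * f t) \<in> L2"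
  by (auto simp: L2_def norm_mult power_mult_distrib)

lemma L2_sum:
  assumes "finite J" "\<And>j. j \<in> J \<Longrightarrow> f j \<in> L2"
  shows "(\<lambda>t. \<Sum>j\<in>J. f j t) \<in> L2"
  using assms
proof (induction J rule: finite_induct)
  case empty
  then show ?case by (simp add: L2_def)
next
  case (insert j J)
  then show ?case using L2_add(1)[of "f j" "\<lambda>t. \<Sum>j\<in>J. f j t"] by simp
qed

lemma gabor_atom_L2:
  assumes g: "g \<in> L2"
  shows "gabor_atom g \<alpha> \<beta> m n \<in> L2"
proof -
  note [measurable] = L2_measurable[OF g]
  have "integrable lborel (\<lambda>t. (cmod (g (- \<alpha> * of_int m + 1 * t)))\<^sup>2)"
    by (rule lborel_integrable_real_affine[OF L2_integrable[OF g]]) simp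
  moreover have "gabor_atom g \<alpha> \<beta> m n = (\<lambda>t. cis (2 * pi * \<beta> * of_int n * t) * g (t - \<alpha> * of_int m))"
    by (simp add: fun_eq_iff gabor_atom_def)
  moreover have "(\<lambda>t. cis (2 * pi * \<beta> * of_int n * t) * g (t - \<alpha> * of_int m)) \<in> borel_measurable borel"
    by measurable
  ultimately show ?thesis by (simp add: L2_def norm_mult)
qed

context exp_sampling begin

text \<open>The inverse transform of \<open>phi0\<close> is computed directly as a rational
  function. This represents the window by an absolutely convergent integral, whereas its own
  transform exists only as a limit over [-R, R].\<close>

lemma phi0_cis_integral:
  shows "integrable lborel (\<lambda>\<xi>. phi0 \<xi> * cis (2 * pi * t * \<xi>))"
    and "(LINT \<xi>|lborel. phi0 \<xi> * cis (2 * pi * t * \<xi>)) = (\<Sum>j<N. c j / (lam j - 2 * pi * \<i> * t))"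
proof -
  define k where "k = (\<lambda>j. - lam j + 2 * pi * \<i> * t)"
  have k: "Re (k j) < 0" if "j < N" for j using lam_pos[OF that] by (simp add: k_def)
  have eq: "phi0 \<xi> * cis (2 * pi * t * \<xi>) = (\<Sum>j<N. c j * (indicator {0<..} \<xi> *\<^sub>R exp (k j * complex_of_real \<xi>)))" for \<xi>
  proof -
    have "exp (- lam j * of_real \<xi>) * cis (2 * pi * t * \<xi>) = exp (k j * of_real \<xi>)" for j
      unfolding cis_conv_exp exp_add[symmetric] by (simp add: k_def algebra_simps)
    then show ?thesis
      by (simp add: phi0_def phi_def indicator_def sum_distrib_right mult.assoc)
  qed
  have i: "integrable lborel (\<lambda>\<xi>. c j * (indicator {0<..} \<xi> *\<^sub>R exp (k j * complex_of_real \<xi>)))" if "j < N" for j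
    using exp_half_line(1)[OF k[OF that]] unfolding set_integrable_def by (rule integrable_mult_right)
  show "integrable lborel (\<lambda>\<xi>. phi0 \<xi> * cis (2 * pi * t * \<xi>))"
    unfolding eq using i by (intro Bochner_Integration.integrable_sum) auto
  have "(LINT \<xi>|lborel. phi0 \<xi> * cis (2 * pi * t * \<xi>)) = (\<Sum>j<N. LINT \<xi>|lborel. c j * (indicator {0<..} \<xi> *\<^sub>R exp (k j * complex_of_real \<xi>)))"
    unfolding eq using i by (intro Bochner_Integration.integral_sum) auto
  also have "\<dots> = (\<Sum>j<N. c j * (- 1 / k j))"
    using exp_half_line(2)[OF k] unfolding set_lebesgue_integral_def
    by (intro sum.cong refl) (simp only: integral_mult_right_zero lessThan_iff)
  also have "\<dots> = (\<Sum>j<N. c j / (lam j - 2 * pi * \<i> * t))"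
  proof (intro sum.cong refl)
    fix j assume "j \<in> {..<N}"
    have "k j = - (lam j - 2 * pi * \<i> * t)" by (simp add: k_def)
    then show "c j * (- 1 / k j) = c j / (lam j - 2 * pi * \<i> * t)"
      by (simp only: minus_divide_divide times_divide_eq_right mult_1_right)
  qed
  finally show "(LINT \<xi>|lborel. phi0 \<xi> * cis (2 * pi * t * \<xi>)) = (\<Sum>j<N. c j / (lam j - 2 * pi * \<i> * t))" .
qed

lemma phi0_integrable: "integrable lborel phi0"
  using phi0_cis_integral(1)[of 0] by (simp add: cis_zero)

text \<open>Conjugating f makes the filter causal, at the price of a sign change in both lattice indices.\<close>

lemma inner_gabor_atom:
  assumes g: "\<And>t. g t = (LINT \<xi>|lborel. phi0 \<xi> * cis (2 * pi * t * \<xi>))" and f: "integrable lborel f"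
  shows "cmod (L2_inner f (gabor_atom g (1 / L) b m n))
    = cmod (LINT s|lborel. phi0 (b * of_int (- n) - s) * fourier (\<lambda>t. cnj (f t)) s * cis (- 2 * pi * of_int (- m) * s / L))"
proof -
  define h where "h = (\<lambda>t. cnj (f t))"
  have h: "integrable lborel h" unfolding h_def using f by simp
  have [measurable]: "h \<in> borel_measurable borel" using borel_measurable_integrable[OF h] by simp
  let ?\<alpha> = "1 / L"
  let ?f = "\<lambda>t \<xi>. h t * phi0 \<xi> * cis (2 * pi * b * of_int n * t + 2 * pi * (t - ?\<alpha> * of_int m) * \<xi>)"
  \<comment> \<open>The modulus of the integrand is |h t| |phi0 \<xi>|, a product of integrable
    functions.\<close>
  have fub: "integrable (lborel \<Otimes>\<^sub>M lborel) (\<lambda>(t, \<xi>). ?f t \<xi>)"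
  proof (rule lborel_pair.Fubini_integrable)
    show "(\<lambda>(t, \<xi>). ?f t \<xi>) \<in> borel_measurable (lborel \<Otimes>\<^sub>M lborel)" by measurable
    show "integrable lborel (\<lambda>t. LINT \<xi>|lborel. norm (case (t, \<xi>) of (t, \<xi>) \<Rightarrow> ?f t \<xi>))"
      using h by (simp add: norm_mult)
    show "AE t in lborel. integrable lborel (\<lambda>\<xi>. case (t, \<xi>) of (t, \<xi>) \<Rightarrow> ?f t \<xi>)"
    proof (rule AE_I2)
      fix t
      have "integrable lborel (\<lambda>\<xi>. h t * phi0 \<xi>)" by (intro integrable_mult_right phi0_integrable)
      then show "integrable lborel (\<lambda>\<xi>. case (t, \<xi>) of (t, \<xi>) \<Rightarrow> ?f t \<xi>)"
        by (rule Bochner_Integration.integrable_bound) (auto simp: norm_mult)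
    qed
  qed
  have "cnj (L2_inner f (gabor_atom g ?\<alpha> b m n)) = (LINT t|lborel. h t * gabor_atom g ?\<alpha> b m n t)"
    unfolding L2_inner_def Bochner_Integration.integral_cnj[symmetric] by (simp add: h_def)
  also have "\<dots> = (LINT t|lborel. (LINT \<xi>|lborel. ?f t \<xi>))"
  proof (intro Bochner_Integration.integral_cong refl)
    fix t
    have "h t * gabor_atom g ?\<alpha> b m n t
       = (h t * cis (2 * pi * b * of_int n * t)) * (LINT \<xi>|lborel. phi0 \<xi> * cis (2 * pi * (t - ?\<alpha> * of_int m) * \<xi>))"
      by (simp only: gabor_atom_def g mult.assoc)
    also have "\<dots> = (LINT \<xi>|lborel. (h t * cis (2 * pi * b * of_int n * t)) * (phi0 \<xi> * cis (2 * pi * (t - ?\<alpha> * of_int m) * \<xi>)))"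
      by (rule integral_mult_right_zero[symmetric])
    also have "\<dots> = (LINT \<xi>|lborel. ?f t \<xi>)"
      by (intro Bochner_Integration.integral_cong refl) (simp only: cis_mult[symmetric] mult_ac)
    finally show "h t * gabor_atom g ?\<alpha> b m n t = (LINT \<xi>|lborel. ?f t \<xi>)" .
  qed
  also have "\<dots> = (LINT \<xi>|lborel. (LINT t|lborel. ?f t \<xi>))"
    using lborel_pair.Fubini_integral[OF fub] by simp
  also have "\<dots> = (LINT \<xi>|lborel. phi0 \<xi> * cis (- 2 * pi * ?\<alpha> * of_int m * \<xi>) * fourier h (- (\<xi> + b * of_int n)))"
  proof (intro Bochner_Integration.integral_cong refl)
    fix \<xi>
    have "?f t \<xi> = (phi0 \<xi> * cis (- 2 * pi * ?\<alpha> * of_int m * \<xi>)) * (h t * cis (- 2 * pi * t * (- (\<xi> + b * of_int n))))" for t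
    proof -
      have "cis (2 * pi * b * of_int n * t + 2 * pi * (t - ?\<alpha> * of_int m) * \<xi>)
         = cis (- 2 * pi * ?\<alpha> * of_int m * \<xi>) * cis (- 2 * pi * t * (- (\<xi> + b * of_int n)))"
        unfolding cis_mult by (simp add: algebra_simps)
      then show ?thesis by (simp only: mult_ac)
    qed
    then show "(LINT t|lborel. ?f t \<xi>) = phi0 \<xi> * cis (- 2 * pi * ?\<alpha> * of_int m * \<xi>) * fourier h (- (\<xi> + b * of_int n))"
      unfolding fourier_def by (simp only: integral_mult_right_zero)
  qed
  \<comment> \<open>Substituting \<xi> = - b n - s turns the correlation into the convolution form
    phi0(- b n - s), a sample at time - b n.\<close>
  also have "\<dots> = \<bar>- 1\<bar> *\<^sub>R (LINT s|lborel. phi0 (- b * of_int n + (- 1) * s) * cis (- 2 * pi * ?\<alpha> * of_int m * (- b * of_int n + (- 1) * s))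
       * fourier h (- ((- b * of_int n + (- 1) * s) + b * of_int n)))"
    by (rule lborel_integral_real_affine) simp
  \<comment> \<open>The shift leaves a phase independent of s, which has modulus 1 and disappears at
    the end.\<close>
  also have "\<dots> = (LINT s|lborel. cis (2 * pi * ?\<alpha> * of_int m * b * of_int n) * (phi0 (b * of_int (- n) - s) * fourier h s * cis (- 2 * pi * of_int (- m) * s / L)))"
  proof -
    have "phi0 (- b * of_int n + (- 1) * s) * cis (- 2 * pi * ?\<alpha> * of_int m * (- b * of_int n + (- 1) * s)) * fourier h (- ((- b * of_int n + (- 1) * s) + b * of_int n))
       = cis (2 * pi * ?\<alpha> * of_int m * b * of_int n) * (phi0 (b * of_int (- n) - s) * fourier h s * cis (- 2 * pi * of_int (- m) * s / L))" for s
    proof -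
      have 1: "cis (- 2 * pi * ?\<alpha> * of_int m * (- b * of_int n + (- 1) * s))
        = cis (2 * pi * ?\<alpha> * of_int m * b * of_int n) * cis (- 2 * pi * of_int (- m) * s / L)"
        unfolding cis_mult using L_pos by (intro arg_cong[where f = cis]) (simp add: field_simps)
      have 2: "- b * of_int n + (- 1) * s = b * of_int (- n) - s" by simp
      have 3: "- ((- b * of_int n + (- 1) * s) + b * of_int n) = s" by simp
      show ?thesis unfolding 1 3 unfolding 2 by (simp only: mult_ac)
    qed
    then show ?thesis by (simp only: abs_minus_cancel abs_one scaleR_one)
  qed
  also have "\<dots> = cis (2 * pi * ?\<alpha> * of_int m * b * of_int n) * (LINT s|lborel. phi0 (b * of_int (- n) - s) * fourier h s * cis (- 2 * pi * of_int (- m) * s / L))"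
    by (rule integral_mult_right_zero)
  finally have "cmod (cnj (L2_inner f (gabor_atom g ?\<alpha> b m n)))
     = cmod (LINT s|lborel. phi0 (b * of_int (- n) - s) * fourier h s * cis (- 2 * pi * of_int (- m) * s / L))"
    by (simp only: norm_mult norm_cis mult_1_left)
  then show ?thesis by (simp only: complex_mod_cnj h_def)
qed

lemma gabor_energy:
  assumes g: "\<And>t. g t = (LINT \<xi>|lborel. phi0 \<xi> * cis (2 * pi * t * \<xi>))" and f: "integrable lborel f"
  shows "(\<Sum>\<^sup>+p. nsq (L2_inner f (gabor_atom g (1 / L) b (fst p) (snd p))))
    = analysis_energy (fourier (\<lambda>t. cnj (f t)))"
proof -
  have neg: "bij_betw (uminus :: int \<Rightarrow> int) UNIV UNIV" by (rule bij_betwI[of _ _ _ uminus]) auto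
  let ?G = "\<lambda>m n. nsq (LINT s|lborel. phi0 (b * of_int n - s) * fourier (\<lambda>t. cnj (f t)) s * cis (- 2 * pi * of_int m * s / L))"
  have "(\<Sum>\<^sup>+p. nsq (L2_inner f (gabor_atom g (1 / L) b (fst p) (snd p))))
    = (\<Sum>\<^sup>+p. ?G (- fst p) (- snd p))"
    unfolding inner_gabor_atom[OF g f] ..
  also have "\<dots> = (\<Sum>\<^sup>+n. (\<Sum>\<^sup>+m. ?G (- m) (- n)))"
    using nn_integral_snd_count_space[of "\<lambda>p. ?G (- fst p) (- snd p)"] by simp
  also have "\<dots> = (\<Sum>\<^sup>+n. (\<Sum>\<^sup>+m. ?G m (- n)))"
    by (intro nn_integral_cong nn_integral_bij_count_space[OF neg])
  also have "\<dots> = (\<Sum>\<^sup>+n. (\<Sum>\<^sup>+m. ?G m n))"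
    by (rule nn_integral_bij_count_space[OF neg])
  finally show ?thesis by (simp only: analysis_energy_def)
qed

lemma gabor_frame_exponential:
  assumes irr: "L / b \<notin> \<rat>" and g: "\<And>t. g t = (LINT \<xi>|lborel. phi0 \<xi> * cis (2 * pi * t * \<xi>))"
    and gL: "g \<in> L2"
  shows "gabor_frame g (1 / L) b"
proof -
  obtain C1 C2 where C: "C1 > 0" "C2 > 0" and fb: "\<And>F. (\<And>s. isCont F s) \<Longrightarrow> bounded (range F) \<Longrightarrow>
     (\<integral>\<^sup>+s. nsq (F s) \<partial>lborel) \<le> ennreal C1 * analysis_energy F \<and>
     analysis_energy F \<le> ennreal C2 * (\<integral>\<^sup>+s. nsq (F s) \<partial>lborel)"
    using frame_bounds_fourier_side[OF irr] by blast
  let ?e = "\<lambda>p. gabor_atom g (1 / L) b (fst p) (snd p)"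
  have test: "ennreal (L2_norm_sq h) \<le> ennreal C1 * (\<Sum>\<^sup>+p. nsq (L2_inner h (?e p)))"
    "(\<Sum>\<^sup>+p. nsq (L2_inner h (?e p))) \<le> ennreal C2 * ennreal (L2_norm_sq h)"
    if h: "h \<in> test_functions" for h
  proof -
    define h' where "h' = (\<lambda>t. cnj (h t))"
    obtain R where R: "continuous_on UNIV h'" "\<And>t. \<bar>t\<bar> > R \<Longrightarrow> h' t = 0" "R > 0"
      using h by (auto simp: test_functions_def h'_def intro!: continuous_intros)
    have int: "integrable lborel h'" by (rule plancherel_compact_support(2)[OF R])
    have "(\<integral>\<^sup>+s. nsq (fourier h' s) \<partial>lborel) = (\<integral>\<^sup>+t. nsq (h' t) \<partial>lborel)"
      by (rule plancherel_compact_support(1)[OF R])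
    also have "\<dots> = ennreal (L2_norm_sq h)"
      unfolding L2_norm_sq_def h'_def
      using nn_integral_eq_integral[OF L2_integrable[OF test_function_L2[OF h]]] by simp
    finally have P: "(\<integral>\<^sup>+s. nsq (fourier h' s) \<partial>lborel) = ennreal (L2_norm_sq h)" .
    have "bounded (range (fourier h'))"
      unfolding bounded_iff using fourier_bound by blast
    from fb[OF isCont_fourier[OF int] this]
    show "ennreal (L2_norm_sq h) \<le> ennreal C1 * (\<Sum>\<^sup>+p. nsq (L2_inner h (?e p)))"
      "(\<Sum>\<^sup>+p. nsq (L2_inner h (?e p))) \<le> ennreal C2 * ennreal (L2_norm_sq h)"
      unfolding P gabor_energy[OF g test_function_integrable[OF h]] h'_def[symmetric] by auto
  qed
  show ?thesis
    using frame_from_test_functions[where e = ?e, OF gabor_atom_L2[OF gL] C test]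
    unfolding gabor_frame_def case_prod_beta' .
qed

end

section \<open>Identification of the window with the exponential filter\<close>

theorem theorem1p3:
  fixes N :: nat and a w :: "nat \<Rightarrow> complex" and g :: "real \<Rightarrow> complex"
  assumes g_def: "\<And>t. g t = (\<Sum>k=1..N. a k / (complex_of_real t - \<i> * w k))"
    and a_nz: "\<And>k. k \<in> {1..N} \<Longrightarrow> a k \<noteq> 0"
    and w_neg: "\<And>k. k \<in> {1..N} \<Longrightarrow> Re (w k) < 0"
    and w_dist: "\<And>j k. j \<in> {1..N} \<Longrightarrow> k \<in> {1..N} \<Longrightarrow> j \<noteq> k \<Longrightarrow> Re (w j) \<noteq> Re (w k)"
    and ghat_nz: "\<And>\<xi>. \<xi> > 0 \<Longrightarrow> \<exists>c. has_fourier_transform_at g \<xi> c \<and> c \<noteq> 0"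
  shows "\<forall>\<alpha> \<beta>. \<alpha> > 0 \<and> \<beta> > 0 \<and> \<alpha> * \<beta> < 1 \<and> \<alpha> * \<beta> \<notin> \<rat> \<longrightarrow> gabor_frame g \<alpha> \<beta>"
proof (intro allI impI, elim conjE)
  fix \<alpha> \<beta> :: real assume pos: "\<alpha> > 0" "\<beta> > 0" and lt: "\<alpha> * \<beta> < 1" and irr: "\<alpha> * \<beta> \<notin> \<rat>"
  \<comment> \<open>The factor -2 pi i is that of \<open>Cauchy_kernel_fourier\<close>, and
    \<open>lam\<close> has positive real part because Re w < 0. Indices move from 1..N to
    0..N-1.\<close>
  define c where "c = (\<lambda>j. - 2 * pi * \<i> * a (Suc j))"
  define lam where "lam = (\<lambda>j. - 2 * pi * w (Suc j))"
  have ghat: "(\<Sum>j<N. c j * exp (- lam j * of_real \<xi>)) \<noteq> 0" if xi: "\<xi> > 0" for \<xi>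
  proof -
    obtain z where z: "has_fourier_transform_at g \<xi> z" "z \<noteq> 0" using ghat_nz[OF xi] by blast
    let ?K = "\<lambda>k t. 1 / (complex_of_real t - \<i> * w k) * cis (- 2 * pi * t * \<xi>)"
    have ne: "complex_of_real t - \<i> * w k \<noteq> 0" if "k \<in> {1..N}" for k t
      using w_neg[OF that] by (auto simp: complex_eq_iff)
    have "((\<lambda>R. \<Sum>k=1..N. a k * integral {-R..R} (?K k)) \<longlongrightarrow> (\<Sum>k=1..N. a k * (- 2 * pi * \<i> * exp (2 * pi * w k * \<xi>)))) at_top"
      by (intro tendsto_sum tendsto_mult_left Cauchy_kernel_fourier w_neg xi)
    moreover have "integral {-R..R} (\<lambda>t. g t * cis (- 2 * pi * t * \<xi>)) = (\<Sum>k=1..N. a k * integral {-R..R} (?K k))" for R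
    proof -
      have i: "?K k integrable_on {-R..R}" if "k \<in> {1..N}" for k
        by (intro integrable_continuous_real continuous_intros) (use ne[OF that] in auto)
      have "g t * cis (- 2 * pi * t * \<xi>) = (\<Sum>k=1..N. a k * ?K k t)" for t
        by (simp add: g_def sum_distrib_right)
      then have "integral {-R..R} (\<lambda>t. g t * cis (- 2 * pi * t * \<xi>)) = integral {-R..R} (\<lambda>t. \<Sum>k=1..N. a k * ?K k t)"
        by simp
      also have "\<dots> = (\<Sum>k=1..N. integral {-R..R} (\<lambda>t. a k * ?K k t))"
        using i by (intro Henstock_Kurzweil_Integration.integral_sum integrable_on_mult_right) auto
      also have "\<dots> = (\<Sum>k=1..N. a k * integral {-R..R} (?K k))"
        by (intro sum.cong refl integral_mult_right)
      finally show ?thesis .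
    qed
    ultimately have "((\<lambda>R. integral {-R..R} (\<lambda>t. g t * cis (- 2 * pi * t * \<xi>))) \<longlongrightarrow> (\<Sum>k=1..N. a k * (- 2 * pi * \<i> * exp (2 * pi * w k * \<xi>)))) at_top"
      by (simp only:)
    \<comment> \<open>Uniqueness of limits identifies the nonzero transform value given by the
      hypothesis with the explicit exponential sum.\<close>
    from tendsto_unique[OF trivial_limit_at_top_linorder z(1)[unfolded has_fourier_transform_at_def] this]
    have "z = (\<Sum>k=1..N. a k * (- 2 * pi * \<i> * exp (2 * pi * w k * \<xi>)))" .
    also have "\<dots> = (\<Sum>j<N. c j * exp (- lam j * of_real \<xi>))"
      unfolding One_nat_def sum.atLeast1_atMost_eq[unfolded One_nat_def] by (simp add: c_def lam_def mult_ac)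
    finally show ?thesis using z(2) by simp
  qed
  \<comment> \<open>For N = 0 the exponential sum would be empty, hence zero.\<close>
  have N: "N > 0" using ghat[of 1] by (cases "N = 0") auto
  define L where "L = 1 / \<alpha>"
  interpret exp_sampling N c lam \<beta> L
  proof
    show "inj_on (\<lambda>j. Re (lam j)) {..<N}"
    proof (rule inj_onI)
      fix i j assume ij: "i \<in> {..<N}" "j \<in> {..<N}" "Re (lam i) = Re (lam j)"
      then have "Re (w (Suc i)) = Re (w (Suc j))" by (simp add: lam_def)
      with ij show "i = j" using w_dist[of "Suc i" "Suc j"] by auto
    qed
    show "c j \<noteq> 0" if "j < N" for j using a_nz[of "Suc j"] that by (simp add: c_def)
    show "0 < Re (lam j)" if "j < N" for j
      using w_neg[of "Suc j"] that by (simp add: lam_def mult_pos_neg)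
    show "\<beta> < L" using pos lt by (simp add: L_def field_simps)
  qed (use N pos ghat in auto)
  have "L / \<beta> = inverse (\<alpha> * \<beta>)" by (simp add: L_def field_simps)
  then have "L / \<beta> \<notin> \<rat>" using irr Rats_inverse[of "inverse (\<alpha> * \<beta>)"] by auto
  moreover have "g t = (LINT \<xi>|lborel. phi0 \<xi> * cis (2 * pi * t * \<xi>))" for t
  proof -
    have "g t = (\<Sum>j<N. a (Suc j) / (complex_of_real t - \<i> * w (Suc j)))"
      unfolding g_def One_nat_def by (rule sum.atLeast1_atMost_eq[unfolded One_nat_def])
    also have "\<dots> = (\<Sum>j<N. c j / (lam j - 2 * pi * \<i> * t))"
    proof (intro sum.cong refl)
      fix j
      have "lam j - 2 * pi * \<i> * t = (- 2 * pi * \<i>) * (complex_of_real t - \<i> * w (Suc j))"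
        by (simp add: lam_def algebra_simps)
      then show "a (Suc j) / (complex_of_real t - \<i> * w (Suc j)) = c j / (lam j - 2 * pi * \<i> * t)"
        by (simp add: c_def)
    qed
    finally show ?thesis by (simp only: phi0_cis_integral(2))
  qed
  moreover have "g \<in> L2"
  proof -
    have "(\<lambda>t. \<Sum>k=1..N. a k * (1 / (complex_of_real t - \<i> * w k))) \<in> L2"
      by (intro L2_sum L2_cmult Cauchy_kernel_L2 w_neg) auto
    moreover have "g = (\<lambda>t. \<Sum>k=1..N. a k * (1 / (complex_of_real t - \<i> * w k)))"
      by (simp add: fun_eq_iff g_def)
    ultimately show ?thesis by simp
  qed
  ultimately have "gabor_frame g (1 / L) \<beta>" by (rule gabor_frame_exponential)
  then show "gabor_frame g \<alpha> \<beta>" by (simp add: L_def)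
qed

end
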